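(* Let $q$ be a prime power, let $n>1$ be an integer that is not a prime power, let $\delta(n)$ be the number of positive divisors of $n$, and let $1<k<\delta(n)$. Let $(d_1,\ldots,d_k)$ be a tuple of divisors of $n$ with $d_1<\cdots<d_k<n$ such that $d_i\nmid d_j$ whenever $i\ne j$. Let $(a_1,\ldots,a_k)$ with $a_i\in\mathbb{F}_{q^{d_i}}^*$ satisfy $N_{d_i/\gcd(d_i,d_j)}(a_i)=N_{d_j/\gcd(d_i,d_j)}(a_j)$ for all $1\le i<j\le k$. If $\operatorname{lcm}(d_1,\ldots,d_k)<n$, then there exists $\alpha\in\mathbb{F}_{q^n}^*$ normal over $\mathbb{F}_q$ with $N_{n/d_i}(\alpha)=a_i$ for every $1\le i\le k$.
   Context: For a divisor $d$ of $m$ and $\alpha\in\mathbb{F}_{q^m}^*$, $N_{m/d}(\alpha)=\alpha^{(q^m-1)/(q^d-1)}$ denotes the norm of $\alpha$ from $\mathbb{F}_{q^m}$ to $\mathbb{F}_{q^d}$. An element $\beta\in\mathbb{F}_{q^n}$ is normal over $\mathbb{F}_q$ if $\{\beta,\beta^q,\ldots,\beta^{q^{n-1}}\}$ is an $\mathbb{F}_q$-basis of $\mathbb{F}_{q^n}$. *)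

theory Defs
  imports "HOL-Number_Theory.Number_Theory" "HOL-Computational_Algebra.Polynomial" "HOL-Library.Cardinality"
begin

text \<open>
  The field with \<open>q ^ n\<close> elements is a type of class \<open>finite_field\<close> and cardinality \<open>q ^ n\<close>.
  All fields \<open>GF q d\<close> with \<open>d\<close> dividing \<open>n\<close> live inside it, each being the set of roots of
  \<open>X ^ (q ^ d) - X\<close>. Lemma \<open>GF_unique_subfield\<close> below confirms that this is exactly the
  unique subfield with \<open>q ^ d\<close> elements.
\<close>

definition GF :: "nat \<Rightarrow> nat \<Rightarrow> 'a :: finite_field set" where
  "GF q d = {x. x ^ (q ^ d) = x}"

text \<open>
  For \<open>d\<close> dividing \<open>m\<close>, the norm from \<open>GF q m\<close> to \<open>GF q d\<close>; the division is then exact.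
\<close>

definition norm_GF :: "nat \<Rightarrow> nat \<Rightarrow> nat \<Rightarrow> 'a :: finite_field \<Rightarrow> 'a" where
  "norm_GF q m d x = x ^ ((q ^ m - 1) div (q ^ d - 1))"

text \<open>
  The family \<open>b\<close>, indexed by the finite set \<open>I\<close>, is a basis of the whole field as a vector
  space over its subfield \<open>K\<close>.
\<close>

definition basis_over :: "'a :: finite_field set \<Rightarrow> 'i set \<Rightarrow> ('i \<Rightarrow> 'a) \<Rightarrow> bool" where
  "basis_over K I b \<longleftrightarrow>
     (\<forall>c. (\<forall>i\<in>I. c i \<in> K) \<and> (\<Sum>i\<in>I. c i * b i) = 0 \<longrightarrow> (\<forall>i\<in>I. c i = 0)) \<and>
     (\<forall>x. \<exists>c. (\<forall>i\<in>I. c i \<in> K) \<and> x = (\<Sum>i\<in>I. c i * b i))"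

text \<open>To be used in a field with \<open>q ^ n\<close> elements.\<close>

definition normal_over_GF :: "nat \<Rightarrow> nat \<Rightarrow> 'a :: finite_field \<Rightarrow> bool" where
  "normal_over_GF q n x \<longleftrightarrow> basis_over (GF q 1) {..<n} (\<lambda>i. x ^ (q ^ i))"


definition is_subfield :: "'a :: field set \<Rightarrow> bool" where
  "is_subfield S \<longleftrightarrow> 0 \<in> S \<and> 1 \<in> S \<and> (\<forall>x\<in>S. \<forall>y\<in>S. x + y \<in> S \<and> x * y \<in> S) \<and>
     (\<forall>x\<in>S. - x \<in> S \<and> inverse x \<in> S)"

lemma q_power_CHAR:
  assumes "primepow q" "CARD('a :: finite_field) = q ^ n" "n > 0"
  shows   "\<exists>e. q = CHAR('a) ^ e"
proof -
  from assms obtain p k where pk: "prime p" "k > 0" "q = p ^ k"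
    by (auto simp: primepow_def)
  have "CHAR('a) dvd p ^ (k * n)"
    using CHAR_dvd_CARD[where ?'a = 'a] assms pk by (simp add: power_mult)
  moreover have "prime CHAR('a)"
    by (rule prime_CHAR_semidom) (simp add: finite_imp_CHAR_pos)
  ultimately have "CHAR('a) = p"
    using pk(1) prime_dvd_power primes_dvd_imp_eq by blast
  with pk show ?thesis by auto
qed

lemma is_subfield_GF:
  assumes "primepow q" "CARD('a :: finite_field) = q ^ n" "n > 0"
  shows   "is_subfield (GF q d :: 'a set)"
proof -
  obtain e where e: "q = CHAR('a) ^ e" using q_power_CHAR[OF assms] by blast
  have prime: "prime CHAR('a)"
    by (rule prime_CHAR_semidom) (simp add: finite_imp_CHAR_pos)
  have add: "(x + y) ^ (q ^ d) = x ^ (q ^ d) + y ^ (q ^ d)" for x y :: 'a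
    by (rule freshmans_dream'[OF prime, of _ "e * d"]) (simp add: e power_mult)
  have q: "q > 0"
    using assms(1) primepow_gt_Suc_0 by fastforce
  have minus: "(- x) ^ (q ^ d) = - (x ^ (q ^ d))" for x :: 'a
    using add[of x "- x"] q by (simp add: power_0_left add_eq_0_iff)
  show ?thesis
    unfolding is_subfield_def GF_def
    using q by (auto simp: add minus power_mult_distrib power_inverse)
qed

lemma diff_1_dvd_power_diff_1: "(x - 1 :: nat) dvd x ^ m - 1"
proof (cases "x = 0")
  case False
  hence "int (x - 1) dvd int (x ^ m - 1)"
    using power_diff_1_eq[of "int x" m] by (simp add: of_nat_diff)
  thus ?thesis by (simp only: of_nat_dvd_iff)
qed (auto simp: power_0_left)

lemma card_GF:
  assumes "primepow q" "CARD('a :: finite_field) = q ^ n" "n > 0" "d dvd n"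
  shows   "card (GF q d :: 'a set) = q ^ d"
proof -
  define Q where "Q = q ^ d"
  have d: "d > 0" using assms by (auto intro: Nat.gr0I)
  have q: "q > 1" using assms(1) primepow_gt_Suc_0 by fastforce
  have Q: "Q > 1" unfolding Q_def using d q by (intro one_less_power)
  from assms(4) obtain m where m: "n = d * m" by auto
  have "Q - 1 dvd q ^ n - 1"
    using diff_1_dvd_power_diff_1[of Q m] by (simp add: m Q_def power_mult)
  then obtain r where r: "q ^ n - 1 = (Q - 1) * r" by auto
  have qn: "q ^ n > 1" using q assms(3) by (intro one_less_power)
  have r0: "r > 0" using r qn by (intro Nat.gr0I) auto
  define f g :: "'a poly" where "f = monom 1 (Q - 1) - 1"
    and "g = (\<Sum>i<r. monom 1 (Q - 1) ^ i)"
  have fg: "monom 1 (q ^ n - 1) - 1 = f * g"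
    unfolding f_def g_def r by (subst power_diff_1_eq [symmetric]) (simp add: monom_power)
  have deg: "degree (monom 1 k - 1 :: 'a poly) = k" if "k > 0" for k
    using that degree_add_eq_left[of "- 1" "monom 1 k :: 'a poly"] by (simp add: degree_monom_eq)
  have degf: "degree f = Q - 1" unfolding f_def using Q by (intro deg) simp
  have degfg: "degree (f * g) = q ^ n - 1" unfolding fg [symmetric] using qn by (intro deg) simp
  have "f * g \<noteq> 0" using degfg qn by auto
  hence nz: "f \<noteq> 0" "g \<noteq> 0" by auto
  have degg: "degree g = (q ^ n - 1) - (Q - 1)"
    using degfg degf nz by (simp add: degree_mult_eq)
  have "x ^ (q ^ n - 1) = 1" if "x \<noteq> 0" for x :: 'a
  proof -
    have "x * x ^ (q ^ n - 1) = x"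
      using finite_field_power_card_eq_same[of x] assms(2) q power_minus_mult[of "q ^ n" x]
      by (simp add: mult.commute)
    thus ?thesis using that by simp
  qed
  hence "UNIV - {0} \<subseteq> {x. poly (f * g) x = 0}"
    by (auto simp flip: fg simp: poly_monom)
  hence "UNIV - {0} \<subseteq> {x. poly f x = 0} \<union> {x. poly g x = 0}" by auto
  hence "card (UNIV - {0 :: 'a}) \<le> card ({x. poly f x = 0} \<union> {x. poly g x = 0})"
    by (intro card_mono) auto
  also have "\<dots> \<le> card {x. poly f x = 0} + card {x. poly g x = 0}" by (rule card_Un_le)
  finally have "q ^ n - 1 \<le> card {x. poly f x = 0} + card {x. poly g x = 0}"
    using assms(2) by (simp add: card_Diff_singleton)
  moreover have "card {x. poly f x = 0} \<le> Q - 1" "card {x. poly g x = 0} \<le> (q ^ n - 1) - (Q - 1)"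
    using card_poly_roots_bound[OF nz(1)] card_poly_roots_bound[OF nz(2)] degf degg by auto
  moreover have "Q - 1 \<le> q ^ n - 1" using r r0 by simp
  ultimately have card: "card {x. poly f x = 0} = Q - 1" by linarith
  have "x ^ Q = x \<longleftrightarrow> x = 0 \<or> poly f x = 0" for x :: 'a
  proof -
    have "x ^ Q = x * x ^ (Q - 1)" using Q power_minus_mult[of Q x] by (simp add: mult.commute)
    thus ?thesis by (auto simp: f_def poly_monom)
  qed
  hence "GF q d = insert 0 {x :: 'a. poly f x = 0}"
    unfolding GF_def Q_def [symmetric] by auto
  moreover have "poly f 0 \<noteq> 0" using Q by (simp add: f_def poly_monom power_0_left)
  ultimately show ?thesis using card Q by (simp add: Q_def)
qed

lemma GF_unique_subfield:
  assumes "primepow q" "CARD('a :: finite_field) = q ^ n" "n > 0" "d dvd n"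
  shows   "is_subfield S \<and> card S = q ^ d \<longleftrightarrow> S = (GF q d :: 'a set)"
proof
  assume S: "is_subfield S \<and> card S = q ^ d"
  have "x ^ card S = x" if x: "x \<in> S" for x
  proof (cases "x = 0")
    case False
    have "(\<Prod>y\<in>S-{0}. x * y) = (\<Prod>y\<in>S-{0}. y)"
      by (rule prod.reindex_bij_witness[of _ "\<lambda>y. y * inverse x" "\<lambda>y. x * y"])
         (use False S x in \<open>auto simp: is_subfield_def mult.assoc\<close>)
    hence "x ^ card (S - {0}) = 1" by (simp add: prod.distrib)
    moreover have "card S = Suc (card (S - {0}))"
      using S by (intro card.remove) (auto simp: is_subfield_def)
    ultimately show ?thesis by simp
  next
    case True
    thus ?thesis using x by (auto simp: power_0_left card_eq_0_iff)
  qed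
  hence "S \<subseteq> GF q d" using S by (auto simp: GF_def)
  thus "S = GF q d" using card_GF[OF assms] S by (intro card_subset_eq) auto
qed (use is_subfield_GF[OF assms(1-3)] card_GF[OF assms] in auto)

end

theory Submission
  imports Defs Complex_Main
begin

text \<open>
  Let \<open>L\<close> be the least common multiple of the \<open>d i\<close>, a proper divisor of \<open>n\<close> which is not a prime
  power. By compatibility, and because gcd and lcm distribute over each other, the norm equations
  have a common solution \<open>\<beta>\<close> (a Chinese remainder argument on exponents of a primitive element). Let
  \<open>m\<close> be the lcm of the numbers \<open>q ^ (L div p) - 1\<close> for the primes \<open>p\<close> dividing \<open>L\<close>, and
  \<open>M = (q ^ n - 1) div m\<close>. The whole coset \<open>\<beta> K\<close> of \<open>K = {x. x ^ M = 1}\<close> solves the norm equations,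
  and \<open>card K = M\<close> is at least \<open>q ^ (n - L + totient L) * (1 - 1/q - 1/q^2)\<close>, which exceeds \<open>q ^ (n/2)\<close>.

  To find a normal element in \<open>\<beta> K\<close>, fix a Frobenius invariant nontrivial additive character \<open>\<psi>\<close>. If \<open>x\<close> is
  not normal, then \<open>\<psi>\<close> is trivial on \<open>x U\<close> for some minimal Frobenius invariant subspace \<open>U\<close>. The dimensions of these
  subspaces are controlled by \<open>gcd n (q ^ D - 1)\<close>, distinct ones are independent, and the
  second moment bounds the sums of \<open>\<psi>\<close> over cosets of \<open>K\<close> by \<open>sqrt (q ^ n - card K)\<close>. An
  inclusion-exclusion over a set \<open>H\<close> of low-dimensional minimal subspaces, combined with a union bound
  over the remaining ones, then yields a normal element as soon as a numerical inequality holds. It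
  is checked in ranges of \<open>q\<close> and \<open>n\<close>; for \<open>n = 12\<close> and \<open>q = 5, 7\<close> it fails for \<open>K\<close>, but holds after
  enlarging \<open>K\<close> by elements \<open>\<theta>\<close> with \<open>\<theta> ^ ((q - 1) ^ 2) = 1\<close>, multiplication by which preserves normality.
\<close>

section \<open>Additive characters\<close>


text \<open>A bound near \<open>q ^ (n/2)\<close> for character sums says something about a coset of
  \<open>K\<close> only if \<open>K\<close> is larger than that. The hypothesis on the lcm provides
  this: \<open>n >= 2 * L\<close>, so \<open>n - L + totient L >= n/2 + totient L\<close>. Passing
  from the lcm of the \<open>q ^ d i - 1\<close> to the possibly larger \<open>m\<close> makes
  everything depend on \<open>L\<close> alone, and \<open>(q ^ L - 1) / m\<close> is the cyclotomic
  value Phi_L(q). Incomparability of the \<open>d i\<close> makes \<open>L\<close> a non prime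
  power, so \<open>L >= 6\<close>.

  The minimal subspaces stand in for the irreducible factors of X^n - 1. Inclusion-exclusion costs a
  factor 2 for each of them, and there may be \<open>n\<close> of them. A union bound is much
  cheaper, but needs the proportions \<open>1 / card U\<close> to sum to less than 1, which the
  small dimensions can spoil; hence the split by dimension. Sieving dimensions up to
  \<open>s\<close> costs about \<open>2 ^ (q ^ s)\<close>, and it suffices that \<open>q ^ s\<close>
  is about \<open>sqrt n\<close>. So a lower bound for \<open>nu\<close> by a power of
  \<open>n\<close> with exponent above 1/2 settles large \<open>n\<close>; the delicate cases are
  small \<open>q\<close> and \<open>n\<close>.\<close>

lemma card_roots_unity_le:
  fixes x :: "'a :: field"
  assumes "k > 0"
  shows "card {x :: 'a. x ^ k = 1} \<le> k"
proof -
  have deg: "degree (monom 1 k - 1 :: 'a poly) = k"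
    using assms degree_add_eq_left[of "- 1" "monom 1 k :: 'a poly"] by (simp add: degree_monom_eq)
  hence "monom 1 k - 1 \<noteq> (0 :: 'a poly)" using assms by auto
  from card_poly_roots_bound[OF this] show ?thesis by (simp add: deg poly_monom)
qed

text \<open>The type is packed into a ring record so that the cyclicity of the unit group of a
  finite field applies; the rest translates products and powers back.\<close>

lemma finite_field_primitive_root:
  "\<exists>g :: 'a :: finite_field. g \<noteq> 0 \<and> (\<forall>x. x \<noteq> 0 \<longrightarrow> (\<exists>i::nat. x = g ^ i))"
proof -
  define R :: "'a ring" where
    "R = \<lparr>carrier = UNIV, monoid.mult = (*), one = 1, ring.zero = 0, add = (+)\<rparr>"
  interpret R: field R
  proof -
    have "\<exists>y. x + y = 0" for x :: 'a by (rule exI[of _ "- x"]) auto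
    moreover have "\<exists>y. x * y = 1" if "x \<noteq> 0" for x :: 'a using that by (intro exI[of _ "inverse x"]) auto
    ultimately show "field R"
      unfolding R_def by unfold_locales (auto simp: algebra_simps Units_def)
  qed
  have carr: "carrier R = UNIV" and mult: "x \<otimes>\<^bsub>R\<^esub> y = x * y" and one: "\<one>\<^bsub>R\<^esub> = 1" and zero: "\<zero>\<^bsub>R\<^esub> = 0" for x y
    by (auto simp: R_def)
  have carr': "carrier (mult_of R) = UNIV - {0}"
    by (simp add: carr zero)
  have pow: "x [^]\<^bsub>R\<^esub> (i :: nat) = x ^ i" for x i
  proof (induction i)
    case 0
    show ?case by (simp add: nat_pow_def one)
  next
    case (Suc i)
    have "x [^]\<^bsub>R\<^esub> Suc i = (x [^]\<^bsub>R\<^esub> i) \<otimes>\<^bsub>R\<^esub> x"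
      by (simp add: nat_pow_def)
    thus ?case unfolding Suc mult by (simp only: power_Suc2)
  qed
  have "finite (carrier R)" by (simp add: carr)
  from R.finite_field_mult_group_has_gen[OF this] obtain a where a: "a \<in> carrier (mult_of R)"
    "carrier (mult_of R) = {a[^]\<^bsub>R\<^esub> i | i::nat . i \<in> UNIV}" by (rule bexE)
  have "a \<noteq> 0" using a(1) carr' by auto
  moreover have eq: "UNIV - {0} = {a ^ i | i::nat. i \<in> UNIV}" using a(2) unfolding carr' pow .
  moreover have "\<exists>i::nat. x = a ^ i" if "x \<noteq> 0" for x
  proof -
    have "x \<in> UNIV - {0}" using that by simp
    thus ?thesis unfolding eq by simp
  qed
  ultimately show ?thesis by (intro exI[of _ a]) simp
qed

locale field_ext =
  fixes q n :: nat and ty :: "'a :: finite_field itself"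
  assumes q: "primepow q" and card: "CARD('a) = q ^ n" and n: "n > 0"
begin

lemma q_gt_1: "q > 1" using q primepow_gt_Suc_0 by fastforce

lemma qn_gt_1: "q ^ n > 1" using q_gt_1 n by (rule one_less_power)

lemma prime_char: "prime CHAR('a)"
  by (rule prime_CHAR_semidom) (simp add: finite_imp_CHAR_pos)

lemma pow_qn: "x ^ (q ^ n) = (x :: 'a)"
  using finite_field_power_card_eq_same[of x] card by simp

lemma pow_qn_minus_1: "x \<noteq> 0 \<Longrightarrow> x ^ (q ^ n - 1) = (1 :: 'a)"
proof -
  assume x: "x \<noteq> 0"
  have "x * x ^ (q ^ n - 1) = x"
    using pow_qn[of x] power_minus_mult[of "q ^ n" x] q_gt_1 by (simp del: One_nat_def add: mult.commute)
  thus ?thesis using x by (simp del: One_nat_def)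
qed

lemma frob_add: "(x + y) ^ (q ^ i) = x ^ (q ^ i) + (y ^ (q ^ i) :: 'a)"
proof -
  obtain e where e: "q = CHAR('a) ^ e" using q_power_CHAR[OF q card n] by blast
  show ?thesis
    by (rule freshmans_dream'[OF prime_char, of _ "e * i"]) (simp add: e power_mult)
qed

lemma frob_sum: "(\<Sum>i\<in>A. f i) ^ (q ^ j) = (\<Sum>i\<in>A. (f i :: 'a) ^ (q ^ j))"
proof -
  obtain e where e: "q = CHAR('a) ^ e" using q_power_CHAR[OF q card n] by blast
  show ?thesis
    by (rule freshmans_dream_sum'[OF prime_char, of _ "e * j"]) (simp add: e power_mult)
qed

lemma frob_minus: "(- x) ^ (q ^ i) = - (x ^ (q ^ i) :: 'a)"
  using frob_add[of x "- x" i] q_gt_1 by (simp add: power_0_left add_eq_0_iff)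

lemma frob_diff: "(x - y) ^ (q ^ i) = x ^ (q ^ i) - (y ^ (q ^ i) :: 'a)"
  using frob_add[of x "- y" i] by (simp add: frob_minus)

lemma frob_inj: "x ^ (q ^ i) = y ^ (q ^ i) \<Longrightarrow> x = (y :: 'a)"
  using frob_diff[of x y i] by simp

text \<open>With \<open>q ^ n - 1 = k * r\<close> and a generator \<open>g\<close>, the powers
  \<open>g ^ (r * i)\<close> for \<open>i < k\<close> are distinct solutions, and a polynomial of
  degree \<open>k\<close> has no more roots.\<close>

lemma card_roots_unity:
  assumes "k dvd q ^ n - 1"
  shows "card {x :: 'a. x ^ k = 1} = k"
proof -
  obtain g :: 'a where g: "g \<noteq> 0" "\<And>x. x \<noteq> 0 \<Longrightarrow> \<exists>i::nat. x = g ^ i"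
    using finite_field_primitive_root by blast
  have k0: "k > 0" using assms qn_gt_1 by (intro Nat.gr0I) auto
  obtain r where r: "q ^ n - 1 = k * r" using assms by auto
  have r0: "r > 0" using r qn_gt_1 by (intro Nat.gr0I) auto
  have ord: "g ^ i \<noteq> 1" if "0 < i" "i < q ^ n - 1" for i
  proof
    assume "g ^ i = 1"
    have "UNIV - {0} \<subseteq> (\<lambda>j. g ^ j) ` {..<i}"
    proof
      fix x :: 'a assume "x \<in> UNIV - {0}"
      then obtain j where j: "x = g ^ j" using g(2) by auto
      have "g ^ j = g ^ (j mod i) * (g ^ i) ^ (j div i)"
        unfolding power_mult[symmetric] power_add[symmetric] by simp
      hence "x = g ^ (j mod i)" using \<open>g ^ i = 1\<close> j by simp
      thus "x \<in> (\<lambda>j. g ^ j) ` {..<i}" using that by auto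
    qed
    hence "card (UNIV - {0 :: 'a}) \<le> i"
      by (metis card_lessThan finite_imageI finite_lessThan surj_card_le)
    thus False using that card by (simp add: card_Diff_singleton)
  qed
  have "inj_on (\<lambda>i. g ^ (r * i)) {..<k}"
  proof (rule linorder_inj_onI)
    fix i j assume ij: "i < j" "i \<in> {..<k}" "j \<in> {..<k}"
    have "g ^ (r * j) = g ^ (r * i) * g ^ (r * (j - i))"
      using ij by (simp add: power_add[symmetric] algebra_simps flip: distrib_left)
    moreover have "r * (j - i) < r * k" using ij r0 by auto
    hence "g ^ (r * (j - i)) \<noteq> 1" using ij r r0 by (intro ord) (auto simp: mult.commute)
    ultimately show "g ^ (r * i) \<noteq> g ^ (r * j)" using g(1) by auto
  qed auto
  hence "card ((\<lambda>i. g ^ (r * i)) ` {..<k}) = k" by (simp add: card_image)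
  moreover have "(\<lambda>i. g ^ (r * i)) ` {..<k} \<subseteq> {x. x ^ k = 1}"
  proof -
    have "(g ^ (r * i)) ^ k = 1" for i
    proof -
      have "(g ^ (r * i)) ^ k = (g ^ (q ^ n - 1)) ^ i"
        unfolding r by (simp add: power_mult[symmetric] mult_ac)
      thus ?thesis using pow_qn_minus_1[OF g(1)] by simp
    qed
    thus ?thesis by auto
  qed
  ultimately have "k \<le> card {x :: 'a. x ^ k = 1}"
    by (metis card_mono finite)
  thus ?thesis using card_roots_unity_le[OF k0, where ?'a = 'a] by simp
qed

text \<open>Take \<open>exp (2 * pi * i * Tr x / p)\<close> with the absolute trace
  \<open>Tr\<close> to the prime field. Frobenius only permutes the summands of \<open>Tr\<close>,
  which gives the invariance; \<open>Tr\<close> is a polynomial of degree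
  \<open>p ^ (N - 1)\<close>, too small to vanish everywhere, which gives nontriviality.\<close>

lemma ex_additive_character:
  "\<exists>\<psi> :: 'a \<Rightarrow> complex. (\<forall>x y. \<psi> (x + y) = \<psi> x * \<psi> y) \<and> (\<forall>x. cmod (\<psi> x) = 1)
     \<and> (\<exists>x. \<psi> x \<noteq> 1) \<and> (\<forall>x. \<psi> (x ^ q) = \<psi> x)"
proof -
  define p where "p = CHAR('a)"
  have p: "prime p" using prime_char by (simp add: p_def)
  have p1: "p > 1" using p prime_gt_1_nat by auto
  obtain e where e: "q = p ^ e" using q_power_CHAR[OF q card n] by (auto simp: p_def)
  define N where "N = e * n"
  have cardN: "CARD('a) = p ^ N" by (simp add: card e N_def power_mult)
  have e0: "e > 0" using e q_gt_1 by (intro Nat.gr0I) auto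
  have N0: "N > 0" using e0 n by (simp add: N_def)
  have add: "(x + y) ^ (p ^ i) = x ^ (p ^ i) + (y ^ (p ^ i) :: 'a)" for x y i
    by (rule freshmans_dream'[OF prime_char, of _ i]) (simp add: p_def)
  have sum: "(\<Sum>i\<in>A. f i) ^ p = (\<Sum>i\<in>A. (f i :: 'a) ^ p)" for A and f :: "nat \<Rightarrow> 'a"
    by (rule freshmans_dream_sum'[OF prime_char, of _ 1]) (simp add: p_def)
  define Tr :: "'a \<Rightarrow> 'a" where "Tr x = (\<Sum>i<N. x ^ (p ^ i))" for x
  have Tr_add: "Tr (x + y) = Tr x + Tr y" for x y by (simp add: Tr_def add sum.distrib)
  have powN: "x ^ (p ^ N) = x" for x :: 'a
    using finite_field_power_card_eq_same[of x] by (simp add: cardN)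
  have shift: "(\<Sum>i<N. x ^ (p ^ Suc i)) = Tr x" for x
  proof -
    have "(\<Sum>i<N. x ^ (p ^ Suc i)) + x ^ (p ^ 0) = (\<Sum>i<Suc N. x ^ (p ^ i))"
      by (subst sum.lessThan_Suc_shift) (simp add: add.commute)
    also have "\<dots> = Tr x + x" by (simp add: Tr_def powN)
    finally show ?thesis by simp
  qed
  have Tr_p1: "Tr x ^ p = Tr x" for x
  proof -
    have "Tr x ^ p = (\<Sum>i<N. x ^ (p ^ Suc i))"
      unfolding Tr_def sum by (simp add: power_mult[symmetric] mult.commute)
    thus ?thesis using shift by simp
  qed
  have Tr_p2: "Tr (x ^ p) = Tr x" for x
  proof -
    have "Tr (x ^ p) = (\<Sum>i<N. x ^ (p ^ Suc i))"
      unfolding Tr_def by (simp add: power_mult[symmetric])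
    thus ?thesis using shift by simp
  qed
  have Tr_q: "Tr (x ^ q) = Tr x" for x
  proof -
    have "Tr (x ^ (p ^ i)) = Tr x" for i
      by (induction i) (simp_all add: Tr_p2 power_mult mult.commute[of p])
    thus ?thesis by (simp add: e)
  qed
  have of_nat_pow: "(of_nat k :: 'a) ^ p = of_nat k" for k
  proof (induction k)
    case (Suc k)
    have "(of_nat (Suc k) :: 'a) ^ p = (1 + of_nat k) ^ (p ^ 1)" by simp
    also have "\<dots> = 1 + of_nat k" unfolding add using Suc by simp
    finally show ?case by simp
  qed (use p1 in auto)
  \<comment> \<open>There are at most \<open>p\<close> fixed points of the \<open>p\<close>-th power
    map, and the images of the numbers below \<open>p\<close> are already that many. So every trace
    value lifts to a natural number.\<close>
  have "\<exists>k. of_nat k = y" if "y ^ p = y" for y :: 'a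
  proof -
    define A where "A = {y :: 'a. y ^ p = y}"
    have "inj_on (of_nat :: nat \<Rightarrow> 'a) {..<p}"
    proof (rule inj_onI)
      fix a b assume "a \<in> {..<p}" "b \<in> {..<p}" "(of_nat a :: 'a) = of_nat b"
      hence "[a = b] (mod p)" by (simp add: of_nat_eq_iff_cong_CHAR p_def)
      with \<open>a \<in> {..<p}\<close> \<open>b \<in> {..<p}\<close> show "a = b" by (simp add: cong_def)
    qed
    hence c: "card ((of_nat :: nat \<Rightarrow> 'a) ` {..<p}) = p" by (simp add: card_image)
    have sub: "(of_nat :: nat \<Rightarrow> 'a) ` {..<p} \<subseteq> A" using of_nat_pow by (auto simp: A_def)
    have "A \<subseteq> insert 0 {x. x ^ (p - 1) = 1}"
    proof
      fix x assume "x \<in> A"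
      hence "x * x ^ (p - 1) = x * 1" using p1 power_minus_mult[of p x] by (simp add: A_def mult.commute)
      thus "x \<in> insert 0 {x. x ^ (p - 1) = 1}" by (subst (asm) mult_cancel_left) auto
    qed
    hence "card A \<le> card (insert 0 {x :: 'a. x ^ (p - 1) = 1})" by (intro card_mono) auto
    also have "\<dots> \<le> Suc (card {x :: 'a. x ^ (p - 1) = 1})" by (rule card_insert_le_m1) auto
    also have "\<dots> \<le> p" using card_roots_unity_le[of "p - 1", where ?'a = 'a] p1 by linarith
    finally have "card A \<le> card ((of_nat :: nat \<Rightarrow> 'a) ` {..<p})" using c by simp
    hence "A = (of_nat :: nat \<Rightarrow> 'a) ` {..<p}"
      using sub by (metis card_seteq finite)
    moreover have "y \<in> A" using that by (simp add: A_def)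
    ultimately show ?thesis by auto
  qed
  hence "\<forall>x. \<exists>k. of_nat k = Tr x" using Tr_p1 by blast
  then obtain k where k: "\<And>x. of_nat (k x) = Tr x" by metis
  define \<psi> where "\<psi> x = cis (2 * pi * real (k x) / real p)" for x
  have cis_cong: "cis (2 * pi * real a / real p) = cis (2 * pi * real b / real p)"
    if "(of_nat a :: 'a) = of_nat b" for a b
    using that
  proof (induction a b rule: linorder_wlog)
    case (le a b)
    hence "[a = b] (mod p)" by (simp add: of_nat_eq_iff_cong_CHAR p_def)
    then obtain m where m: "b = a + p * m" using le
      by (metis cong_altdef_nat cong_sym dvdE le_add_diff_inverse)
    have "2 * pi * real b / real p = 2 * pi * real a / real p + 2 * pi * real m"
      using p1 by (simp add: m field_simps)
    thus ?case by (simp add: cis_mult[symmetric] cis_multiple_2pi)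
  qed auto
  have "\<psi> (x + y) = \<psi> x * \<psi> y" for x y
  proof -
    have "\<psi> x * \<psi> y = cis (2 * pi * real (k x + k y) / real p)"
      by (simp add: \<psi>_def cis_mult add_divide_distrib ring_distribs)
    also have "\<dots> = \<psi> (x + y)" unfolding \<psi>_def
      by (rule cis_cong) (simp add: k Tr_add)
    finally show ?thesis by simp
  qed
  moreover have "cmod (\<psi> x) = 1" for x by (simp add: \<psi>_def)
  moreover have "\<exists>x. \<psi> x \<noteq> 1"
  proof -
    define P :: "'a poly" where "P = (\<Sum>i<N. monom 1 (p ^ i))"
    have "coeff P (p ^ (N - 1)) = (\<Sum>i<N. if i = N - 1 then 1 else 0)"
      unfolding P_def coeff_sum using p1 by (intro sum.cong) (auto simp: coeff_monom)
    also have "\<dots> = 1" using N0 by simp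
    finally have P0: "P \<noteq> 0" by auto
    have "degree P \<le> p ^ (N - 1)"
      unfolding P_def using p1
      by (intro degree_sum_le) (auto intro!: order.trans[OF degree_monom_le] power_increasing)
    also have "\<dots> < p ^ N" using p1 N0 by (intro power_strict_increasing) auto
    finally have "card {x. poly P x = 0} < CARD('a)"
      using card_poly_roots_bound[OF P0] by (simp add: cardN)
    then obtain x where "poly P x \<noteq> 0" by (metis (mono_tags, lifting) UNIV_I mem_Collect_eq nat_less_le subsetI subset_antisym)
    hence "Tr x \<noteq> 0" by (simp add: P_def Tr_def poly_sum poly_monom)
    hence "(of_nat (k x) :: 'a) \<noteq> 0" by (simp add: k)
    hence nd: "\<not> p dvd k x" by (auto simp: of_nat_eq_0_iff_char_dvd p_def)
    have "\<psi> x \<noteq> 1"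
    proof
      assume "\<psi> x = 1"
      hence "cos (2 * pi * real (k x) / real p) = 1" by (simp add: \<psi>_def complex_eq_iff)
      then obtain m :: int where "2 * pi * real (k x) / real p = real_of_int m * 2 * pi"
        by (auto simp: cos_one_2pi_int)
      hence "real (k x) = real_of_int m * real p" using p1 by (simp add: field_simps)
      hence "int (k x) = m * int p" by (metis of_int_eq_iff of_int_mult of_int_of_nat_eq)
      hence "int p dvd int (k x)" by simp
      thus False using nd by simp
    qed
    thus ?thesis ..
  qed
  moreover have "\<psi> (x ^ q) = \<psi> x" for x
    unfolding \<psi>_def by (rule cis_cong) (simp add: k Tr_q)
  ultimately show ?thesis by blast
qed

end

locale field_ext_char = field_ext q n ty for q n :: nat and ty :: "'a :: finite_field itself" +
  fixes \<psi> :: "'a \<Rightarrow> complex"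
  assumes psi_add: "\<psi> (x + y) = \<psi> x * \<psi> y"
    and psi_norm: "cmod (\<psi> x) = 1"
    and psi_nontrivial: "\<exists>x. \<psi> x \<noteq> 1"
    and psi_frob: "\<psi> (x ^ q) = \<psi> x"
begin

lemma psi_0: "\<psi> 0 = 1"
  using psi_add[of 0 0] psi_norm[of 0] by (metis add.right_neutral mult_cancel_left2 norm_zero zero_neq_one)

lemma psi_minus: "\<psi> (- x) = cnj (\<psi> x)"
proof -
  have "\<psi> x * \<psi> (- x) = 1" using psi_add[of x "- x"] psi_0 by simp
  moreover have "\<psi> x * cnj (\<psi> x) = 1" by (simp add: complex_norm_square[symmetric] psi_norm)
  moreover have "\<psi> x \<noteq> 0" using psi_norm[of x] by auto
  ultimately show ?thesis by (metis mult_left_cancel)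
qed

lemma psi_sum: "finite A \<Longrightarrow> \<psi> (\<Sum>i\<in>A. f i) = (\<Prod>i\<in>A. \<psi> (f i))"
  by (induction A rule: finite_induct) (simp_all add: psi_0 psi_add)

lemma psi_subgroup_sum:
  assumes "\<And>x y. x \<in> V \<Longrightarrow> y \<in> V \<Longrightarrow> x + y \<in> V" "\<And>x. x \<in> V \<Longrightarrow> - x \<in> V" "v \<in> V" "\<psi> (v * y) \<noteq> 1"
  shows "(\<Sum>x\<in>V. \<psi> (x * y)) = 0"
proof -
  have "(\<Sum>x\<in>V. \<psi> (x * y)) = (\<Sum>x\<in>V. \<psi> ((v + x) * y))"
    by (rule sum.reindex_bij_witness[of _ "\<lambda>x. v + x" "\<lambda>x. x + - v"]) (use assms in \<open>auto simp del: add_uminus_conv_diff\<close>)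
  also have "\<dots> = \<psi> (v * y) * (\<Sum>x\<in>V. \<psi> (x * y))"
    by (simp add: psi_add sum_distrib_left distrib_right)
  finally show ?thesis using assms(4) by (simp add: algebra_simps)
qed

lemma psi_orth: "y \<noteq> 0 \<Longrightarrow> (\<Sum>x\<in>UNIV. \<psi> (x * y)) = 0"
proof -
  assume y: "y \<noteq> 0"
  obtain z where "\<psi> z \<noteq> 1" using psi_nontrivial by blast
  thus ?thesis using y by (intro psi_subgroup_sum[of _ "z / y"]) auto
qed

text \<open>Second moment: the squares of all sums \<open>T c\<close> add up to
  \<open>M * q ^ n\<close>. The value at \<open>c\<close> is repeated on the \<open>M\<close>
  elements of the coset of \<open>c\<close>, and \<open>T 0 = M\<close> takes away
  \<open>M ^ 2\<close>; dividing by \<open>M\<close> gives the bound.\<close>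

lemma subgroup_sum_bound:
  assumes M: "M dvd q ^ n - 1" and c: "c \<noteq> 0"
  defines "G \<equiv> {x :: 'a. x ^ M = 1}"
  shows "cmod (\<Sum>x\<in>G. \<psi> (c * x)) \<le> sqrt (real (q ^ n) - real M)"
proof -
  define T where "T c = (\<Sum>x\<in>G. \<psi> (c * x))" for c
  have M0: "M > 0" using M qn_gt_1 by (intro Nat.gr0I) auto
  have cG: "card G = M" unfolding G_def by (rule card_roots_unity[OF M])
  have G0: "0 \<notin> G" using M0 by (simp add: G_def power_0_left)
  have "(\<Sum>c\<in>UNIV. T c * cnj (T c)) = (\<Sum>c\<in>UNIV. \<Sum>x\<in>G. \<Sum>y\<in>G. \<psi> (c * (x - y)))"
    unfolding T_def cnj_sum sum_product
    by (simp add: psi_minus[symmetric] psi_add[symmetric] right_diff_distrib)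
  also have "\<dots> = (\<Sum>x\<in>G. \<Sum>y\<in>G. \<Sum>c\<in>UNIV. \<psi> (c * (x - y)))"
    by (subst sum.swap, rule sum.cong[OF refl], rule sum.swap)
  also have "\<dots> = (\<Sum>x\<in>G. \<Sum>y\<in>G. if x = y then of_nat (q ^ n) else 0)"
    by (intro sum.cong refl) (auto simp: psi_orth psi_0 card)
  also have "\<dots> = of_nat (M * q ^ n)" by (simp add: cG)
  finally have "(\<Sum>c\<in>UNIV. T c * cnj (T c)) = of_nat (M * q ^ n)" .
  hence "complex_of_real (\<Sum>c\<in>UNIV. (cmod (T c))\<^sup>2) = complex_of_real (real (M * q ^ n))"
    by (simp flip: complex_norm_square)
  hence tot: "(\<Sum>c\<in>UNIV. (cmod (T c))\<^sup>2) = real (M * q ^ n)" unfolding of_real_eq_iff .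
  have Tinv: "T (c * g) = T c" if "g \<in> G" for g c
    unfolding T_def
    by (rule sum.reindex_bij_witness[of _ "\<lambda>x. x / g" "\<lambda>x. g * x"])
       (use that G0 in \<open>auto simp: G_def power_mult_distrib power_divide mult_ac\<close>)
  have T0: "T 0 = of_nat M" by (simp add: T_def psi_0 cG)
  have inj: "inj_on (\<lambda>g. c * g) G" using c by (auto intro: inj_onI)
  have "real M * (cmod (T c))\<^sup>2 + (real M)\<^sup>2 = (\<Sum>d\<in>(\<lambda>g. c * g) ` G. (cmod (T d))\<^sup>2) + (\<Sum>d\<in>{0}. (cmod (T d))\<^sup>2)"
    by (subst sum.reindex[OF inj]) (simp add: Tinv cG T0)
  also have "\<dots> = (\<Sum>d\<in>(\<lambda>g. c * g) ` G \<union> {0}. (cmod (T d))\<^sup>2)"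
    by (rule sum.union_disjoint[symmetric]) (use c G0 in auto)
  also have "\<dots> \<le> (\<Sum>c\<in>UNIV. (cmod (T c))\<^sup>2)" by (intro sum_mono2) auto
  also have "\<dots> = real M * real (q ^ n)" by (simp add: tot)
  finally have "real M * ((cmod (T c))\<^sup>2 + real M) \<le> real M * real (q ^ n)"
    by (simp add: power2_eq_square distrib_left)
  hence "(cmod (T c))\<^sup>2 \<le> real (q ^ n) - real M" using M0 by simp
  thus ?thesis unfolding T_def by (rule real_le_rsqrt)
qed

end

section \<open>Minimal Frobenius invariant subspaces\<close>

context field_ext
begin

definition Fq :: "'a set" where "Fq = GF q 1"

definition frob_subspace :: "'a set \<Rightarrow> bool" where
  "frob_subspace V \<longleftrightarrow> 0 \<in> V \<and> (\<forall>x\<in>V. \<forall>y\<in>V. x + y \<in> V) \<and> (\<forall>c\<in>Fq. \<forall>x\<in>V. c * x \<in> V) \<and> (\<forall>x\<in>V. x ^ q \<in> V)"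

text \<open>These are the simple submodules when X acts as Frobenius. They correspond to the monic
  irreducible factors of X^n - 1 over \<open>Fq\<close>, but the factorization itself is never
  written down.\<close>

definition minimals :: "'a set set" where
  "minimals = {V. frob_subspace V \<and> V \<noteq> {0} \<and> (\<forall>W. frob_subspace W \<and> W \<subseteq> V \<longrightarrow> W = {0} \<or> W = V)}"

text \<open>The dimension is read off from the cardinality, which avoids any theory of bases;
  \<open>card_minimal\<close> shows that it is meaningful on \<open>minimals\<close>.\<close>

definition fdim :: "'a set \<Rightarrow> nat" where
  "fdim U = (THE d. card U = q ^ d)"

lemma Fq_subfield: "is_subfield Fq"
  unfolding Fq_def by (rule is_subfield_GF[OF q card n])

lemma card_Fq: "card Fq = q"
  using card_GF[OF q card n, of 1] by (simp add: Fq_def)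

lemma Fq_frob: "c \<in> Fq \<Longrightarrow> c ^ (q ^ i) = (c :: 'a)"
  by (induction i) (simp_all add: Fq_def GF_def power_mult)

lemma Fq_0 [simp]: "(0 :: 'a) \<in> Fq" and Fq_1 [simp]: "(1 :: 'a) \<in> Fq"
  and Fq_add: "c \<in> Fq \<Longrightarrow> d \<in> Fq \<Longrightarrow> c + d \<in> Fq"
  and Fq_mult: "c \<in> Fq \<Longrightarrow> d \<in> Fq \<Longrightarrow> c * d \<in> Fq"
  and Fq_minus: "c \<in> Fq \<Longrightarrow> - c \<in> Fq"
  and Fq_inverse: "c \<in> Fq \<Longrightarrow> inverse c \<in> Fq"
  using Fq_subfield unfolding is_subfield_def by blast+

lemma Fq_diff: "c \<in> Fq \<Longrightarrow> d \<in> Fq \<Longrightarrow> c - d \<in> Fq"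
  using Fq_add[of c "- d"] Fq_minus[of d] by simp

lemma frob_subspaceD:
  assumes "frob_subspace V"
  shows "0 \<in> V" "x \<in> V \<Longrightarrow> y \<in> V \<Longrightarrow> x + y \<in> V" "c \<in> Fq \<Longrightarrow> x \<in> V \<Longrightarrow> c * x \<in> V"
    "x \<in> V \<Longrightarrow> x ^ (q ^ i) \<in> V" "x \<in> V \<Longrightarrow> - x \<in> V"
proof -
  show 1: "0 \<in> V" "x \<in> V \<Longrightarrow> y \<in> V \<Longrightarrow> x + y \<in> V" "c \<in> Fq \<Longrightarrow> x \<in> V \<Longrightarrow> c * x \<in> V" for x y c
    using assms by (auto simp: frob_subspace_def)
  show "x \<in> V \<Longrightarrow> x ^ (q ^ i) \<in> V"
  proof (induction i)
    case (Suc i)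
    hence "(x ^ (q ^ i)) ^ q \<in> V" using assms by (auto simp: frob_subspace_def)
    thus ?case by (simp add: power_mult[symmetric] mult.commute)
  qed simp
  show "x \<in> V \<Longrightarrow> - x \<in> V"
    using 1(3)[of "- 1" x] Fq_minus[of 1] by simp
qed

lemma frob_subspace_sum:
  assumes "frob_subspace V" "\<And>i. i \<in> A \<Longrightarrow> f i \<in> V"
  shows "(\<Sum>i\<in>A. f i) \<in> V"
  using assms(2) by (induction A rule: infinite_finite_induct) (auto intro: frob_subspaceD[OF assms(1)])

lemma frob_subspace_Int: "frob_subspace V \<Longrightarrow> frob_subspace W \<Longrightarrow> frob_subspace (V \<inter> W)"
  unfolding frob_subspace_def by simp

lemma frob_subspace_GF: "frob_subspace (GF q t)"
  unfolding frob_subspace_def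
proof (intro conjI ballI)
  show "0 \<in> (GF q t :: 'a set)" using q_gt_1 by (simp add: GF_def power_0_left)
  fix x y :: 'a assume "x \<in> GF q t"
  thus "x ^ q \<in> GF q t" unfolding GF_def mem_Collect_eq by (metis power_mult mult.commute)
  show "x + y \<in> GF q t" if "y \<in> GF q t" using that \<open>x \<in> GF q t\<close> by (simp add: GF_def frob_add)
next
  fix c x :: 'a assume "c \<in> Fq" "x \<in> GF q t"
  thus "c * x \<in> GF q t" using Fq_frob[of c t] by (simp add: GF_def power_mult_distrib)
qed

lemma minimalsD:
  assumes "U \<in> minimals"
  shows "frob_subspace U" "\<exists>u\<in>U. u \<noteq> 0" "frob_subspace W \<Longrightarrow> x \<in> W \<inter> U \<Longrightarrow> x \<noteq> 0 \<Longrightarrow> U \<subseteq> W"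
proof -
  show 1: "frob_subspace U" using assms by (simp add: minimals_def)
  show "\<exists>u\<in>U. u \<noteq> 0" using assms frob_subspaceD(1)[OF 1] by (auto simp: minimals_def)
  assume "frob_subspace W" "x \<in> W \<inter> U" "x \<noteq> 0"
  moreover have "frob_subspace (W \<inter> U)" using calculation 1 by (intro frob_subspace_Int)
  ultimately have "W \<inter> U = U" using assms unfolding minimals_def by blast
  thus "U \<subseteq> W" by blast
qed

lemma minimals_eqI: "U \<in> minimals \<Longrightarrow> V \<in> minimals \<Longrightarrow> x \<in> U \<Longrightarrow> x \<in> V \<Longrightarrow> x \<noteq> 0 \<Longrightarrow> U = V"
  using minimalsD(3)[of U V x] minimalsD(3)[of V U x] minimalsD(1) by blast

lemma ex_minimal_subset:
  assumes "frob_subspace V" "V \<noteq> {0}"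
  shows "\<exists>U\<in>minimals. U \<subseteq> V"
proof -
  define C where "C = {W. frob_subspace W \<and> W \<noteq> {0} \<and> W \<subseteq> V}"
  have "V \<in> C" "finite C" using assms by (auto simp: C_def)
  then obtain U where U: "U \<in> C" "\<And>W. W \<in> C \<Longrightarrow> W \<subseteq> U \<Longrightarrow> U = W"
    using finite_has_minimal[of C] by auto
  hence "U \<in> minimals" unfolding minimals_def C_def by blast
  thus ?thesis using U by (auto simp: C_def)
qed

lemma self_add_zero: "(x :: 'a) = x + x \<Longrightarrow> x = 0" by (metis add_cancel_right_right)

text \<open>This is the minimal polynomial of Frobenius on \<open>U\<close>, as a linearized
  polynomial. By minimality \<open>U\<close> is spanned by the conjugates of any nonzero
  \<open>u\<close>. The first conjugate depending on the earlier ones gives a relation of degree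
  \<open>q ^ d\<close>; it vanishes on \<open>U\<close>, and since it has at most
  \<open>q ^ d = card U\<close> roots, \<open>U\<close> is its whole root set.\<close>

lemma minimal_annihilator:
  assumes U: "U \<in> minimals"
  shows "\<exists>d c. d > 0 \<and> (\<forall>i. c i \<in> Fq) \<and> card U = q ^ d \<and> U = {x. (\<Sum>i\<le>d. c i * x ^ (q ^ i)) = 0}"
proof -
  obtain u where u: "u \<in> U" "u \<noteq> 0" using minimalsD(2)[OF U] by blast
  define span where "span k = {\<Sum>i<k. c i * u ^ (q ^ i) | c. \<forall>i. c i \<in> Fq}" for k :: nat
  have ex: "u ^ (q ^ n) \<in> span n"
  proof -
    have "u ^ (q ^ n) = (\<Sum>i<n. (if i = 0 then 1 else 0) * u ^ (q ^ i))"
      using n by (simp add: pow_qn if_distrib[of "\<lambda>x. x * _"] cong: if_cong)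
    thus ?thesis unfolding span_def by (intro CollectI exI[of _ "\<lambda>i. if i = 0 then 1 else 0"]) auto
  qed
  define d where "d = (LEAST k. u ^ (q ^ k) \<in> span k)"
  have dP: "u ^ (q ^ d) \<in> span d" unfolding d_def by (rule LeastI[of "\<lambda>k. u ^ (q ^ k) \<in> span k", OF ex])
  have dmin: "u ^ (q ^ k) \<notin> span k" if "k < d" for k
    using not_less_Least that unfolding d_def by blast
  have d0: "d > 0" using dP u by (cases "d = 0") (auto simp: span_def)
  obtain b where b: "\<And>i. b i \<in> Fq" "u ^ (q ^ d) = (\<Sum>i<d. b i * u ^ (q ^ i))"
    using dP unfolding span_def by blast
  have indep: "e k = 0" if e: "\<And>i. e i \<in> Fq" "(\<Sum>i<d. e i * u ^ (q ^ i)) = 0" "k < d" for e k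
  proof (rule ccontr)
    assume "e k \<noteq> 0"
    define A where "A = {i. i < d \<and> e i \<noteq> 0}"
    have A: "finite A" "k \<in> A" using \<open>e k \<noteq> 0\<close> e(3) by (auto simp: A_def)
    define m where "m = Max A"
    have m: "m \<in> A" "\<And>i. i \<in> A \<Longrightarrow> i \<le> m" unfolding m_def using A by (auto intro: Max_in)
    have md: "m < d" "e m \<noteq> 0" using m by (auto simp: A_def)
    have z: "e i = 0" if "i < d" "m < i" for i using m(2)[of i] that by (auto simp: A_def)
    have "(\<Sum>i<d. e i * u ^ (q ^ i)) = (\<Sum>i<Suc m. e i * u ^ (q ^ i))"
      using md z by (intro sum.mono_neutral_right) auto
    hence "e m * u ^ (q ^ m) = - (\<Sum>i<m. e i * u ^ (q ^ i))" using e(2) by (simp add: add_eq_0_iff2)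
    hence "inverse (e m) * (e m * u ^ (q ^ m)) = inverse (e m) * - (\<Sum>i<m. e i * u ^ (q ^ i))" by simp
    hence "u ^ (q ^ m) = (\<Sum>i<m. (- inverse (e m) * e i) * u ^ (q ^ i))"
      using md by (simp add: sum_distrib_left sum_negf mult.assoc[symmetric])
    hence "u ^ (q ^ m) \<in> span m" unfolding span_def
      by (intro CollectI exI[of _ "\<lambda>i. - inverse (e m) * e i"] conjI) (use e(1) in \<open>auto intro!: Fq_mult Fq_minus Fq_inverse\<close>)
    thus False using dmin md by blast
  qed
  define F where "F = PiE {..<d} (\<lambda>_. Fq)"
  define h where "h = (\<lambda>f. \<Sum>i<d. f i * u ^ (q ^ i))"
  have "inj_on h F"
  proof (rule inj_onI)
    fix f g assume fg: "f \<in> F" "g \<in> F" "h f = h g"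
    define e where "e i = (if i < d then f i - g i else 0)" for i
    have e1: "e i \<in> Fq" for i using fg by (auto simp: e_def F_def PiE_def intro!: Fq_diff)
    have e2: "(\<Sum>i<d. e i * u ^ (q ^ i)) = 0"
      using fg(3) by (simp add: e_def h_def left_diff_distrib sum_subtractf)
    have "f i = g i" if "i < d" for i using indep[OF e1 e2 that] that by (simp add: e_def)
    thus "f = g" using fg by (intro PiE_ext[of f "{..<d}" "\<lambda>_. Fq" g]) (auto simp: F_def)
  qed
  moreover have "h ` F = span d"
  proof (intro equalityI subsetI)
    fix x assume "x \<in> h ` F"
    then obtain f where f: "f \<in> F" "x = h f" by auto
    thus "x \<in> span d" unfolding span_def h_def
      by (intro CollectI exI[of _ "\<lambda>i. if i < d then f i else 0"]) (auto simp: F_def PiE_def)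
  next
    fix x assume "x \<in> span d"
    then obtain c where c: "\<And>i. c i \<in> Fq" "x = (\<Sum>i<d. c i * u ^ (q ^ i))" unfolding span_def by blast
    thus "x \<in> h ` F" by (intro image_eqI[of _ _ "restrict c {..<d}"]) (auto simp: h_def F_def)
  qed
  ultimately have cspan: "card (span d) = q ^ d"
    using card_image[of h F] by (simp add: F_def card_PiE card_Fq)
  have "frob_subspace (span d)"
    unfolding frob_subspace_def
  proof (intro conjI ballI)
    show "0 \<in> span d" unfolding span_def by (intro CollectI exI[of _ "\<lambda>_. 0"]) auto
    fix x assume x: "x \<in> span d"
    then obtain c where c: "\<And>i. c i \<in> Fq" "x = (\<Sum>i<d. c i * u ^ (q ^ i))" unfolding span_def by blast
    {
      fix y assume "y \<in> span d"
      then obtain c' where c': "\<And>i. c' i \<in> Fq" "y = (\<Sum>i<d. c' i * u ^ (q ^ i))" unfolding span_def by blast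
      show "x + y \<in> span d" unfolding span_def
        by (intro CollectI exI[of _ "\<lambda>i. c i + c' i"]) (auto simp: c c' Fq_add sum.distrib distrib_right)
    }
    \<comment> \<open>Coefficients after one application of Frobenius, as for a companion matrix:
      indices shift up by one, and the overflow \<open>u ^ (q ^ d)\<close> is rewritten by the
      relation \<open>b\<close>.\<close>
    define c' where "c' i = (if i = 0 then 0 else c (i - 1)) + c (d - 1) * b i" for i
    obtain d' where d': "d = Suc d'" using d0 by (cases d) auto
    have "x ^ q = (\<Sum>i<d. (c i * u ^ (q ^ i)) ^ q)" using frob_sum[of _ _ 1] by (simp add: c(2))
    also have "\<dots> = (\<Sum>i<d. c i * u ^ (q ^ Suc i))"
      using Fq_frob[OF c(1), of _ 1] by (simp add: power_mult_distrib power_mult[symmetric] mult.commute)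
    also have "\<dots> = (\<Sum>i<d'. c i * u ^ (q ^ Suc i)) + c (d - 1) * (\<Sum>i<d. b i * u ^ (q ^ i))"
      unfolding b(2)[symmetric] by (simp add: d')
    also have "(\<Sum>i<d'. c i * u ^ (q ^ Suc i)) = (\<Sum>i<d. (if i = 0 then 0 else c (i - 1)) * u ^ (q ^ i))"
      unfolding d' sum.lessThan_Suc_shift by simp
    also have "\<dots> + c (d - 1) * (\<Sum>i<d. b i * u ^ (q ^ i)) = (\<Sum>i<d. c' i * u ^ (q ^ i))"
      by (simp add: c'_def distrib_right sum.distrib sum_distrib_left mult.assoc)
    finally have "x ^ q = (\<Sum>i<d. c' i * u ^ (q ^ i))" .
    moreover have "c' i \<in> Fq" for i unfolding c'_def by (intro Fq_add Fq_mult c b) (auto intro: c)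
    ultimately show "x ^ q \<in> span d" unfolding span_def by blast
  next
    fix a x assume a: "a \<in> Fq" and x: "x \<in> span d"
    then obtain c where c: "\<And>i. c i \<in> Fq" "x = (\<Sum>i<d. c i * u ^ (q ^ i))" unfolding span_def by blast
    show "a * x \<in> span d" unfolding span_def
      by (intro CollectI exI[of _ "\<lambda>i. a * c i"]) (use a c in \<open>auto simp: Fq_mult sum_distrib_left mult.assoc\<close>)
  qed
  moreover have "u \<in> span d"
    unfolding span_def using d0
    by (intro CollectI exI[of _ "\<lambda>i. if i = 0 then 1 else 0"])
       (auto simp: if_distrib[of "\<lambda>x. x * _"] cong: if_cong)
  ultimately have "U \<subseteq> span d" using minimalsD(3)[OF U, of "span d" u] u by blast
  moreover have "span d \<subseteq> U"
  proof
    fix x assume "x \<in> span d"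
    then obtain c where c: "\<And>i. c i \<in> Fq" "x = (\<Sum>i<d. c i * u ^ (q ^ i))" unfolding span_def by blast
    show "x \<in> U" unfolding c(2) using c(1) u(1) minimalsD(1)[OF U]
      by (intro frob_subspace_sum) (auto intro: frob_subspaceD)
  qed
  ultimately have Uspan: "U = span d" by blast
  define a where "a i = (if i < d then - b i else if i = d then 1 else 0)" for i
  have a: "a i \<in> Fq" for i by (auto simp: a_def intro: b Fq_minus)
  have au: "(\<Sum>i\<le>d. a i * u ^ (q ^ i)) = 0"
    by (simp add: a_def b(2) sum_negf lessThan_Suc_atMost[symmetric])
  define Z where "Z = {x. (\<Sum>i\<le>d. a i * x ^ (q ^ i)) = 0}"
  \<comment> \<open>The relation has coefficients in \<open>Fq\<close>, hence commutes with
    Frobenius: holding for \<open>u\<close>, it holds for all conjugates and so on their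
    span.\<close>
  have "U \<subseteq> Z"
  proof
    fix x assume "x \<in> U"
    then obtain c where c: "\<And>i. c i \<in> Fq" "x = (\<Sum>i<d. c i * u ^ (q ^ i))" unfolding Uspan span_def by blast
    have xi: "x ^ (q ^ i) = (\<Sum>j<d. c j * u ^ (q ^ (i + j)))" for i
      unfolding c(2) frob_sum
      by (intro sum.cong refl) (simp add: power_mult_distrib Fq_frob[OF c(1)] power_add power_mult[symmetric] mult_ac)
    have "(\<Sum>i\<le>d. a i * x ^ (q ^ i)) = (\<Sum>j<d. \<Sum>i\<le>d. c j * (a i * u ^ (q ^ (i + j))))"
      unfolding xi sum_distrib_left by (subst sum.swap) (simp add: mult_ac)
    also have "\<dots> = (\<Sum>j<d. c j * (\<Sum>i\<le>d. a i * u ^ (q ^ i)) ^ (q ^ j))"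
      unfolding frob_sum sum_distrib_left
      by (intro sum.cong refl) (simp add: power_mult_distrib Fq_frob[OF a] power_add power_mult[symmetric])
    also have "\<dots> = 0" unfolding au using q_gt_1 by (simp add: power_0_left)
    finally show "x \<in> Z" by (simp add: Z_def)
  qed
  moreover have "card Z \<le> q ^ d"
  proof -
    define P :: "'a poly" where "P = (\<Sum>i\<le>d. monom (a i) (q ^ i))"
    have "coeff P (q ^ d) = (\<Sum>i\<le>d. if i = d then 1 else 0)"
      unfolding P_def coeff_sum using q_gt_1 by (intro sum.cong) (auto simp: coeff_monom a_def)
    also have "\<dots> = 1" by simp
    finally have P0: "P \<noteq> 0" by auto
    have "degree P \<le> q ^ d"
      unfolding P_def using q_gt_1
      by (intro degree_sum_le) (auto intro!: order.trans[OF degree_monom_le] power_increasing)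
    moreover have "Z = {x. poly P x = 0}" by (simp add: Z_def P_def poly_sum poly_monom)
    ultimately show ?thesis using card_poly_roots_bound[OF P0] by simp
  qed
  ultimately have "U = Z" using cspan by (intro card_seteq) (auto simp: Uspan)
  moreover have "card U = q ^ d" using cspan Uspan by simp
  ultimately show ?thesis using d0 a unfolding Z_def by (intro exI[of _ d] exI[of _ a] conjI allI)
qed

lemma card_minimal:
  assumes "U \<in> minimals"
  shows "card U = q ^ fdim U" "fdim U > 0"
proof -
  obtain d where d: "d > 0" "card U = q ^ d" using minimal_annihilator[OF assms] by blast
  have "fdim U = d" unfolding fdim_def d(2) using q_gt_1 by (intro the_equality) auto
  thus "card U = q ^ fdim U" "fdim U > 0" using d by auto
qed

text \<open>\<open>B\<close> is the composition of the annihilators of the members of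
  \<open>T\<close>. It preserves each invariant subspace, so on a minimal subspace outside
  \<open>T\<close> a newly acquired zero would lie in two different minimal subspaces and thus be 0.
  Its purpose is to isolate one summand in \<open>minimals_independent\<close>.\<close>

lemma minimals_killer:
  assumes "finite T" "T \<subseteq> minimals"
  shows "\<exists>B. (\<forall>x y. B (x + y) = B x + B y) \<and> (\<forall>V. frob_subspace V \<longrightarrow> B ` V \<subseteq> V) \<and>
             (\<forall>U\<in>T. \<forall>x\<in>U. B x = 0) \<and> (\<forall>U\<in>minimals - T. \<forall>x\<in>U. B x = 0 \<longrightarrow> x = 0)"
  using assms
proof (induction T rule: finite_induct)
  case empty
  show ?case by (rule exI[of _ "\<lambda>x. x"]) auto
next
  case (insert U T)
  hence "T \<subseteq> minimals" by simp
  from insert.IH[OF this] obtain B where B': "(\<forall>x y. B (x + y) = B x + B y) \<and> (\<forall>V. frob_subspace V \<longrightarrow> B ` V \<subseteq> V) \<and>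
    (\<forall>U\<in>T. \<forall>x\<in>U. B x = 0) \<and> (\<forall>U\<in>minimals - T. \<forall>x\<in>U. B x = 0 \<longrightarrow> x = 0)" by (rule exE)
  have B: "B (x + y) = B x + B y" "frob_subspace V \<Longrightarrow> x \<in> V \<Longrightarrow> B x \<in> V"
    "U \<in> T \<Longrightarrow> x \<in> U \<Longrightarrow> B x = 0" "U \<in> minimals - T \<Longrightarrow> x \<in> U \<Longrightarrow> B x = 0 \<Longrightarrow> x = 0" for x y U V
    using B' by (simp_all add: image_subset_iff)
  have U: "U \<in> minimals" using insert by auto
  obtain d c where c: "\<And>i. c i \<in> Fq" "U = {x. (\<Sum>i\<le>d. c i * x ^ (q ^ i)) = 0}"
    using minimal_annihilator[OF U] by blast
  define A where "A x = (\<Sum>i\<le>d. c i * x ^ (q ^ i))" for x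
  have UA: "x \<in> U \<longleftrightarrow> A x = 0" for x by (subst c(2)) (simp add: A_def)
  have A: "A (x + y) = A x + A y" "frob_subspace V \<Longrightarrow> x \<in> V \<Longrightarrow> A x \<in> V" for x y V
    unfolding A_def by (simp add: frob_add distrib_left sum.distrib)
       (intro frob_subspace_sum frob_subspaceD c)
  have A0: "A 0 = 0" using A(1)[of 0 0] unfolding add_0_left by (rule self_add_zero)
  show ?case
  proof (intro exI[of _ "\<lambda>x. A (B x)"] conjI allI impI ballI)
    show "A (B (x + y)) = A (B x) + A (B y)" for x y by (simp add: A B)
    show "(\<lambda>x. A (B x)) ` V \<subseteq> V" if "frob_subspace V" for V using A(2) B(2) that by auto
    show "A (B x) = 0" if "V \<in> insert U T" "x \<in> V" for V x
    proof (cases "V = U")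
      case True
      hence "B x \<in> U" using that B(2)[OF minimalsD(1)[OF U]] by simp
      thus ?thesis by (simp add: UA)
    next
      case False
      thus ?thesis using B(3)[of V x] that A0 by simp
    qed
    show "x = 0" if V: "V \<in> minimals - insert U T" "x \<in> V" "A (B x) = 0" for V x
    proof -
      have "B x \<in> V" using B(2)[OF minimalsD(1)] V by blast
      moreover have "B x \<in> U" using V by (simp add: UA)
      ultimately have "B x = 0" using minimals_eqI[OF U, of V "B x"] V by auto
      thus ?thesis using B(4)[of V x] V by auto
    qed
  qed
qed

text \<open>Applying the map that kills all members of \<open>T\<close> other than \<open>U\<close>
  leaves only the term of \<open>U\<close>, on which this map is injective.\<close>

lemma minimals_independent:
  assumes T: "T \<subseteq> minimals" and f: "\<And>U. U \<in> T \<Longrightarrow> f U \<in> U" and s: "(\<Sum>U\<in>T. f U) = 0" and U: "U \<in> T"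
  shows "f U = 0"
proof -
  have "finite T" by simp
  have "finite (T - {U})" "T - {U} \<subseteq> minimals" using T by auto
  from minimals_killer[OF this] obtain B where B': "(\<forall>x y. B (x + y) = B x + B y) \<and> (\<forall>V. frob_subspace V \<longrightarrow> B ` V \<subseteq> V) \<and>
    (\<forall>V\<in>T - {U}. \<forall>x\<in>V. B x = 0) \<and> (\<forall>V\<in>minimals - (T - {U}). \<forall>x\<in>V. B x = 0 \<longrightarrow> x = 0)" by (rule exE)
  have B: "B (x + y) = B x + B y" "V \<in> T - {U} \<Longrightarrow> x \<in> V \<Longrightarrow> B x = 0"
    "V \<in> minimals - (T - {U}) \<Longrightarrow> x \<in> V \<Longrightarrow> B x = 0 \<Longrightarrow> x = 0" for x y V
    using B' by simp_all
  have B0: "B 0 = 0" using B(1)[of 0 0] unfolding add_0_left by (rule self_add_zero)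
  have Bs: "B (\<Sum>V\<in>A. g V) = (\<Sum>V\<in>A. B (g V))" if "finite A" for A and g :: "'a set \<Rightarrow> 'a"
    using that by (induction A rule: finite_induct) (simp_all add: B0 B(1))
  have "0 = B (\<Sum>V\<in>T. f V)" by (simp add: s B0)
  also have "\<dots> = (\<Sum>V\<in>T. B (f V))" by (rule Bs) fact
  also have "\<dots> = B (f U) + (\<Sum>V\<in>T - {U}. B (f V))" using \<open>finite T\<close> U by (rule sum.remove)
  also have "(\<Sum>V\<in>T - {U}. B (f V)) = 0" by (intro sum.neutral ballI B(2)) (use f in auto)
  finally have "B (f U) = 0" by simp
  thus ?thesis using B(3)[of U "f U"] T U f by auto
qed

text \<open>All Frobenius orbits on \<open>U - {0}\<close> have the same length \<open>t\<close>: if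
  a power of Frobenius fixes one nonzero element, its fixed space contains \<open>U\<close> by
  minimality. Hence \<open>t\<close> divides \<open>card U - 1\<close>.\<close>

lemma minimal_frob_period:
  assumes U: "U \<in> minimals" and x: "x \<in> U"
  shows "x ^ (q ^ (q ^ fdim U - 1)) = x"
proof -
  define P where "P t \<longleftrightarrow> t > 0 \<and> (\<forall>x\<in>U. x ^ (q ^ t) = x)" for t :: nat
  have "P n" using n by (simp add: P_def pow_qn)
  define t where "t = (LEAST t. P t)"
  have Pt: "P t" unfolding t_def by (rule LeastI) fact
  have t0: "t > 0" and tx: "\<And>x. x \<in> U \<Longrightarrow> x ^ (q ^ t) = x" using Pt by (auto simp: P_def)
  have tmin: "\<not> P s" if "s < t" for s using that not_less_Least unfolding t_def by blast
  have per: "x ^ (q ^ (t * m)) = x" if "x \<in> U" for x m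
    using that by (induction m) (simp_all add: power_add power_mult[of x] tx)
  define orb where "orb u = range (\<lambda>i. u ^ (q ^ i))" for u :: 'a
  have orb': "orb u = (\<lambda>i. u ^ (q ^ i)) ` {..<t}" if "u \<in> U" for u
  proof (intro equalityI subsetI)
    fix y assume "y \<in> orb u"
    then obtain i where i: "y = u ^ (q ^ i)" by (auto simp: orb_def)
    have "u ^ (q ^ (t * (i div t) + i mod t)) = u ^ (q ^ (i mod t))"
      unfolding power_add power_mult[of u] per[OF that] ..
    hence "y = u ^ (q ^ (i mod t))" by (simp add: i)
    thus "y \<in> (\<lambda>i. u ^ (q ^ i)) ` {..<t}" using t0 by auto
  qed (auto simp: orb_def)
  have inj: "inj_on (\<lambda>i. u ^ (q ^ i)) {..<t}" if "u \<in> U" "u \<noteq> 0" for u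
  proof (rule linorder_inj_onI)
    fix i j assume ij: "i < j" "i \<in> {..<t}" "j \<in> {..<t}"
    show "u ^ (q ^ i) \<noteq> u ^ (q ^ j)"
    proof
      assume "u ^ (q ^ i) = u ^ (q ^ j)"
      also have "u ^ (q ^ j) = (u ^ (q ^ (j - i))) ^ (q ^ i)"
        using ij by (simp add: power_mult[symmetric] power_add[symmetric])
      finally have "u ^ (q ^ (j - i)) = u" by (rule frob_inj[symmetric])
      hence "U \<subseteq> GF q (j - i)" using that by (intro minimalsD(3)[OF U frob_subspace_GF, of u]) (auto simp: GF_def)
      hence "P (j - i)" using ij by (auto simp: P_def GF_def)
      moreover have "j - i < t" using ij by auto
      ultimately show False using tmin by blast
    qed
  qed auto
  have orb_eq: "orb (u ^ (q ^ i)) = orb u" if "u \<in> U" for u i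
  proof (intro equalityI subsetI)
    fix y assume "y \<in> orb (u ^ (q ^ i))"
    then obtain j where "y = (u ^ (q ^ i)) ^ (q ^ j)" by (auto simp: orb_def)
    thus "y \<in> orb u" by (auto simp: orb_def power_mult[symmetric] power_add[symmetric])
  next
    fix y assume "y \<in> orb u"
    then obtain j where j: "y = u ^ (q ^ j)" by (auto simp: orb_def)
    have "i \<le> t * i" using t0 by simp
    have "y = (u ^ (q ^ (t * i))) ^ (q ^ j)" by (simp add: per[OF that] j)
    also have "\<dots> = u ^ (q ^ (t * i + j))" by (simp only: power_add power_mult)
    also have "t * i + j = i + (t * i - i + j)" using \<open>i \<le> t * i\<close> by linarith
    also have "u ^ (q ^ (i + (t * i - i + j))) = (u ^ (q ^ i)) ^ (q ^ (t * i - i + j))"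
      by (simp only: power_add power_mult)
    finally show "y \<in> orb (u ^ (q ^ i))" by (auto simp: orb_def)
  qed
  have cU: "card (U - {0}) = q ^ fdim U - 1"
    using card_minimal(1)[OF U] frob_subspaceD(1)[OF minimalsD(1)[OF U]] by simp
  have Un: "\<Union>(orb ` (U - {0})) = U - {0}"
  proof (intro equalityI subsetI)
    fix y assume "y \<in> \<Union>(orb ` (U - {0}))"
    then obtain u i where "u \<in> U" "u \<noteq> 0" "y = u ^ (q ^ i)" by (auto simp: orb_def)
    thus "y \<in> U - {0}" using frob_subspaceD(4)[OF minimalsD(1)[OF U]] by simp
  next
    fix y assume "y \<in> U - {0}"
    moreover have "y \<in> orb y" unfolding orb_def by (rule range_eqI[of _ _ 0]) simp
    ultimately show "y \<in> \<Union>(orb ` (U - {0}))" by blast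
  qed
  have "t * card (orb ` (U - {0})) = card (\<Union>(orb ` (U - {0})))"
  proof (rule card_partition)
    show "card c = t" if "c \<in> orb ` (U - {0})" for c

    proof -
      from that obtain u where u: "u \<in> U" "u \<noteq> 0" "c = orb u" by auto
      show ?thesis using card_image[OF inj[OF u(1,2)]] by (simp add: u(3) orb'[OF u(1)])
    qed
    show "c1 \<inter> c2 = {}" if c: "c1 \<in> orb ` (U - {0})" "c2 \<in> orb ` (U - {0})" "c1 \<noteq> c2" for c1 c2
    proof (rule ccontr)
      obtain u v where uv: "u \<in> U" "v \<in> U" "c1 = orb u" "c2 = orb v" using c by auto
      assume "c1 \<inter> c2 \<noteq> {}"
      then obtain i j where "u ^ (q ^ i) = v ^ (q ^ j)" using uv by (auto simp: orb_def)
      hence "orb u = orb v" using orb_eq[OF uv(1), of i] orb_eq[OF uv(2), of j] by simp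
      thus False using c uv by simp
    qed
  qed auto
  hence "t dvd q ^ fdim U - 1" unfolding Un cU by (metis dvd_triv_left)
  thus ?thesis using per[OF x] by auto
qed

lemma GF_gcd:
  assumes "x \<in> GF q a" "x \<in> GF q b" "a > 0"
  shows "(x :: 'a) \<in> GF q (gcd a b)"
proof -
  obtain u v where uv: "a * u = b * v + gcd a b" using bezout_nat[of a b] assms(3) by auto
  have per: "x ^ (q ^ (t * m)) = x" if "x \<in> GF q t" for t m
    using that by (induction m) (simp_all add: power_add power_mult[of x] GF_def)
  have "x = x ^ (q ^ (b * v + gcd a b))" using per[OF assms(1), of u] uv by simp
  also have "\<dots> = x ^ (q ^ gcd a b)" unfolding power_add power_mult[of x] per[OF assms(2)] ..
  finally show ?thesis by (simp add: GF_def)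
qed

text \<open>By independence the sums of one element from each \<open>U\<close> are distinct, and
  they all lie in a field with \<open>q ^ g\<close> elements.\<close>

lemma sum_fdim_le:
  assumes T: "T \<subseteq> minimals" and g: "g dvd n" "\<And>U. U \<in> T \<Longrightarrow> U \<subseteq> GF q g"
  shows "(\<Sum>U\<in>T. fdim U) \<le> g"
proof -
  define F where "F = PiE T (\<lambda>U. U)"
  have fin: "finite T" by simp
  have "inj_on (\<lambda>f. \<Sum>U\<in>T. f U) F"
  proof (rule inj_onI)
    fix f h assume fh: "f \<in> F" "h \<in> F" "(\<Sum>U\<in>T. f U) = (\<Sum>U\<in>T. h U)"
    have "f U - h U = 0" if "U \<in> T" for U
    proof (rule minimals_independent[OF T _ _ that, of "\<lambda>U. f U - h U"])
      show "(\<Sum>U\<in>T. f U - h U) = 0" using fh(3) by (simp add: sum_subtractf)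
      show "f V - h V \<in> V" if "V \<in> T" for V
        using that T fh frob_subspaceD(2)[OF minimalsD(1), of V "f V" "- h V"] frob_subspaceD(5)[OF minimalsD(1), of V "h V"]
        by (auto simp: F_def PiE_def Pi_def)
    qed
    thus "f = h" using fh by (intro PiE_ext[of f T "\<lambda>U. U" h]) (auto simp: F_def)
  qed
  moreover have "(\<lambda>f. \<Sum>U\<in>T. f U) ` F \<subseteq> GF q g"
    using g(2) by (auto simp: F_def PiE_def Pi_def intro!: frob_subspace_sum[OF frob_subspace_GF])
  ultimately have "card F \<le> card (GF q g :: 'a set)" by (metis card_image card_mono finite)
  also have "card F = q ^ (\<Sum>U\<in>T. fdim U)"
    using T card_minimal(1) fin by (simp add: F_def card_PiE power_sum subset_iff)
  also have "card (GF q g :: 'a set) = q ^ g" by (rule card_GF[OF q card n g(1)])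
  finally show ?thesis using q_gt_1 by simp
qed

lemma minimal_subset_GF:
  assumes "U \<in> minimals" "fdim U dvd D"
  shows "U \<subseteq> GF q (gcd n (q ^ D - 1))"
proof
  fix x assume x: "x \<in> U"
  have "q ^ fdim U - 1 dvd q ^ D - 1"
    using assms(2) diff_1_dvd_power_diff_1[of "q ^ fdim U"] by (auto simp: power_mult)
  then obtain m where m: "q ^ D - 1 = (q ^ fdim U - 1) * m" by auto
  have "x ^ (q ^ ((q ^ fdim U - 1) * m)) = x"
    using minimal_frob_period[OF assms(1) x]
    by (induction m) (simp_all add: power_add power_mult[of x] del: One_nat_def)
  hence "x \<in> GF q (q ^ D - 1)" unfolding m by (simp add: GF_def)
  moreover have "x \<in> GF q n" by (simp add: GF_def pow_qn)
  ultimately show "x \<in> GF q (gcd n (q ^ D - 1))" using n by (intro GF_gcd)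
qed

text \<open>The right side is the number of roots of X^n - 1 in a field with \<open>q ^ D\<close>
  elements. Here it appears as a common Frobenius period: \<open>n\<close> and
  \<open>q ^ D - 1\<close> are both periods, so all these subspaces lie in one subfield.\<close>

lemma sum_fdim_dvd: "(\<Sum>U | U \<in> minimals \<and> fdim U dvd D. fdim U) \<le> gcd n (q ^ D - 1)"
  by (rule sum_fdim_le) (use minimal_subset_GF in auto)

text \<open>The hypothesis makes \<open>s\<close> a power of the characteristic, where X^n - 1 is
  the \<open>s\<close>-th power of X^N - 1. In terms of periods: each divides \<open>n\<close> and
  is coprime to \<open>s\<close>, so it divides \<open>N\<close>.\<close>

lemma sum_fdim_total:
  assumes "n = s * N" "\<And>D. D > 0 \<Longrightarrow> coprime s (q ^ D - 1)"
  shows "(\<Sum>U\<in>minimals. fdim U) \<le> N"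
proof (rule sum_fdim_le)
  fix U assume U: "U \<in> minimals"
  define g where "g = gcd n (q ^ fdim U - 1)"
  have "g dvd s * N" unfolding g_def assms(1)[symmetric] by simp
  moreover have "coprime g s"
    using coprime_divisors[of g "q ^ fdim U - 1" s s] assms(2)[OF card_minimal(2)[OF U]]
    by (simp add: g_def coprime_commute del: One_nat_def)
  ultimately have "g dvd N" by (simp add: coprime_dvd_mult_right_iff)
  then obtain m where m: "N = g * m" by (elim dvdE)
  have "U \<subseteq> GF q g" unfolding g_def by (rule minimal_subset_GF[OF U]) simp
  also have "GF q g \<subseteq> (GF q N :: 'a set)"
  proof
    fix x :: 'a assume "x \<in> GF q g"
    hence "x ^ (q ^ (g * m)) = x" by (induction m) (simp_all add: power_add power_mult[of x] GF_def)
    thus "x \<in> GF q N" by (simp add: GF_def m)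
  qed
  finally show "U \<subseteq> GF q N" .
qed (use assms in auto)

end

context field_ext_char
begin

text \<open>The conjugates of \<alpha> span a proper invariant subspace \<open>W\<close>. Its
  orthogonal complement \<open>V\<close> with respect to \<open>\<psi> (x * y)\<close> is invariant
  and nonzero, so it contains a minimal subspace.\<close>

lemma not_normal_imp_orthogonal:
  assumes "\<not> normal_over_GF q n \<alpha>"
  shows "\<exists>U\<in>minimals. \<forall>u\<in>U. \<psi> (u * \<alpha>) = 1"
proof -
  define h where "h c = (\<Sum>i<n. c i * \<alpha> ^ (q ^ i))" for c :: "nat \<Rightarrow> 'a"
  define F where "F = PiE {..<n} (\<lambda>_. Fq)"
  define W where "W = h ` F"
  have cF: "card F = q ^ n" by (simp add: F_def card_PiE card_Fq)
  have res: "h (restrict c {..<n}) = h c" for c by (simp add: h_def)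
  have WI: "h c \<in> W" if "\<And>i. i < n \<Longrightarrow> c i \<in> Fq" for c
  proof -
    have "restrict c {..<n} \<in> F" using that by (auto simp: F_def)
    hence "h (restrict c {..<n}) \<in> W" unfolding W_def by (rule imageI)
    thus ?thesis by (simp only: res)
  qed
  have WE: "\<exists>c. (\<forall>i. c i \<in> Fq) \<and> x = h c" if xW: "x \<in> W" for x
  proof -
    obtain f where f: "x = h f" "f \<in> F" using xW unfolding W_def by (rule imageE)
    thus ?thesis by (intro exI[of _ "\<lambda>i. if i < n then f i else 0"]) (auto simp: h_def F_def PiE_def)
  qed
  have "W \<noteq> UNIV"
  proof
    assume W: "W = UNIV"
    hence "card (h ` F) = card F" using cF card by (simp add: W_def)
    hence inj: "inj_on h F" by (intro eq_card_imp_inj_on) (auto simp: F_def intro: finite_PiE)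
    have "normal_over_GF q n \<alpha>" unfolding normal_over_GF_def basis_over_def Fq_def[symmetric]
    proof (intro conjI allI impI)
      fix c assume c: "(\<forall>i\<in>{..<n}. c i \<in> Fq) \<and> (\<Sum>i\<in>{..<n}. c i * \<alpha> ^ (q ^ i)) = 0"
      have "restrict c {..<n} = restrict (\<lambda>_. 0) {..<n}"
        by (rule inj_onD[OF inj]) (use c in \<open>auto simp: res F_def\<close>, simp add: h_def)
      hence "restrict c {..<n} i = restrict (\<lambda>_. 0) {..<n} i" for i by simp
      thus "\<forall>i\<in>{..<n}. c i = 0" by (metis restrict_apply')
    next
      fix x
      have "x \<in> W" using W by simp
      from WE[OF this] show "\<exists>c. (\<forall>i\<in>{..<n}. c i \<in> Fq) \<and> x = (\<Sum>i\<in>{..<n}. c i * \<alpha> ^ (q ^ i))"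
        by (auto simp: h_def)
    qed
    thus False using assms by blast
  qed
  hence "W \<subset> UNIV" by auto
  hence cW: "card W < q ^ n" using psubset_card_mono[of UNIV W] card by simp
  have W_add: "x + y \<in> W" if "x \<in> W" "y \<in> W" for x y
  proof -
    from WE[OF that(1)] WE[OF that(2)] obtain c c' where "\<forall>i. c i \<in> Fq" "x = h c" "\<forall>i. c' i \<in> Fq" "y = h c'" by auto
    thus ?thesis using WI[of "\<lambda>i. c i + c' i"] by (simp add: h_def sum.distrib distrib_right Fq_add)
  qed
  have W_scale: "a * x \<in> W" if "x \<in> W" "a \<in> Fq" for x a
  proof -
    from WE[OF that(1)] obtain c where "\<forall>i. c i \<in> Fq" "x = h c" by auto
    thus ?thesis using WI[of "\<lambda>i. a * c i"] that by (simp add: h_def sum_distrib_left mult.assoc Fq_mult)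
  qed
  have W_minus: "- x \<in> W" if "x \<in> W" for x using W_scale[OF that, of "- 1"] Fq_minus[of 1] by simp
  have W_0: "0 \<in> W" using WI[of "\<lambda>_. 0"] by (simp add: h_def)
  have alpha_W: "\<alpha> \<in> W"
  proof -
    have "h (\<lambda>i. if i = 0 then 1 else 0) = \<alpha>"
      using n by (simp add: h_def if_distrib[of "\<lambda>x. x * _"] cong: if_cong)
    thus ?thesis using WI[of "\<lambda>i. if i = 0 then 1 else 0"] by auto
  qed
  \<comment> \<open>Invariance of \<open>V\<close> requires moving Frobenius to the other argument
    of \<open>\<psi>\<close>, that is, \<open>q\<close>-th roots inside \<open>W\<close>. They exist
    because an injective self-map of a finite set is onto.\<close>
  have W_root: "\<exists>y\<in>W. x = y ^ q" if x: "x \<in> W" for x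
  proof -
    have "w ^ q \<in> W" if "w \<in> W" for w
    proof -
      from WE[OF that] obtain c where c: "\<forall>i. c i \<in> Fq" "w = h c" by auto
      obtain n' where n': "n = Suc n'" using n by (cases n) auto
      have "w ^ q = (\<Sum>i<n. (c i * \<alpha> ^ (q ^ i)) ^ q)" using frob_sum[of _ _ 1] by (simp add: c(2) h_def)
      also have "\<dots> = (\<Sum>i<n. c i * \<alpha> ^ (q ^ Suc i))"
        using Fq_frob[of "c _" 1] c(1) by (simp add: power_mult_distrib power_mult[symmetric] mult.commute)
      also have "\<dots> = (\<Sum>i<n'. c i * \<alpha> ^ (q ^ Suc i)) + c n' * \<alpha>"
        unfolding n' using pow_qn[of \<alpha>] by (simp add: n')
      also have "\<dots> = h (\<lambda>i. if i = 0 then c n' else c (i - 1))"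
        unfolding h_def n' by (subst sum.lessThan_Suc_shift[where n = n']) simp
      also have "\<dots> \<in> W" using c(1) by (intro WI) auto
      finally show ?thesis .
    qed
    hence "(\<lambda>w. w ^ q) ` W \<subseteq> W" by auto
    moreover have "inj_on (\<lambda>w. w ^ q) W" using frob_inj[of _ 1] by (auto intro: inj_onI)
    ultimately have "(\<lambda>w. w ^ q) ` W = W" by (intro endo_inj_surj) auto
    thus ?thesis using x by blast
  qed
  define V where "V = {\<beta>. \<forall>w\<in>W. \<psi> (\<beta> * w) = 1}"
  have "frob_subspace V" unfolding frob_subspace_def
  proof (intro conjI ballI)
    show "0 \<in> V" by (simp add: V_def psi_0)
    fix x assume x: "x \<in> V"
    show "x + y \<in> V" if "y \<in> V" for y using x that by (simp add: V_def distrib_right psi_add)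
    show "x ^ q \<in> V" unfolding V_def
    proof (intro CollectI ballI)
      fix w assume "w \<in> W"
      then obtain y where y: "y \<in> W" "w = y ^ q" using W_root by blast
      have "\<psi> (x ^ q * w) = \<psi> ((x * y) ^ q)" by (simp add: y power_mult_distrib)
      also have "\<dots> = 1" unfolding psi_frob using x y by (simp add: V_def)
      finally show "\<psi> (x ^ q * w) = 1" .
    qed
  next
    fix c x assume cx: "c \<in> Fq" "x \<in> V"
    show "c * x \<in> V" unfolding V_def
    proof (intro CollectI ballI)
      fix w assume "w \<in> W"
      hence "\<psi> (x * (c * w)) = 1" using cx W_scale[of w c] by (simp add: V_def)
      thus "\<psi> (c * x * w) = 1" by (simp add: mult_ac)
    qed
  qed
  \<comment> \<open>Double counting: if \<open>V\<close> were 0, summing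
    \<open>\<psi> (w * \<beta>)\<close> over both variables in the two possible orders would give
    \<open>card W = q ^ n\<close>.\<close>
  moreover have "V \<noteq> {0}"
  proof
    assume V: "V = {0}"
    have in0: "(\<Sum>w\<in>W. \<psi> (w * \<beta>)) = 0" if "\<beta> \<noteq> 0" for \<beta>
    proof -
      have "\<beta> \<notin> V" using that V by simp
      then obtain w where "w \<in> W" "\<psi> (w * \<beta>) \<noteq> 1" by (auto simp: V_def mult.commute)
      thus ?thesis using W_add W_minus by (intro psi_subgroup_sum)
    qed
    have "(\<Sum>\<beta>\<in>UNIV. \<Sum>w\<in>W. \<psi> (w * \<beta>)) = (\<Sum>\<beta>\<in>(UNIV :: 'a set). if \<beta> = 0 then of_nat (card W) else 0)"
      by (rule sum.cong[OF refl]) (auto simp: in0 psi_0)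
    hence "(\<Sum>\<beta>\<in>UNIV. \<Sum>w\<in>W. \<psi> (w * \<beta>)) = of_nat (card W)" by simp
    moreover have "(\<Sum>\<beta>\<in>UNIV. \<Sum>w\<in>W. \<psi> (w * \<beta>)) = (\<Sum>w\<in>W. \<Sum>\<beta>\<in>UNIV. \<psi> (\<beta> * w))"
      by (subst sum.swap) (simp add: mult.commute)
    moreover have "\<dots> = (\<Sum>w\<in>W. if w = 0 then of_nat (q ^ n) else 0)"
      by (rule sum.cong[OF refl]) (auto simp: psi_orth psi_0 card)
    moreover have "\<dots> = of_nat (q ^ n)" using W_0 by simp
    ultimately have "(of_nat (card W) :: complex) = of_nat (q ^ n)" by simp
    hence "card W = q ^ n" by (simp only: of_nat_eq_iff)
    thus False using cW by simp
  qed
  ultimately obtain U where U: "U \<in> minimals" "U \<subseteq> V" using ex_minimal_subset by blast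
  thus ?thesis using alpha_W by (intro bexI[of _ U]) (auto simp: V_def)
qed

end

section \<open>The sieve\<close>

context field_ext_char
begin

text \<open>Expanding the product gives one character sum for each choice of elements
  \<open>g U\<close>. By independence only the zero choice has sum 0 and yields the main term; every
  other choice is bounded by the second moment estimate, weighted by its coefficients.\<close>

lemma minimals_character_sum:
  assumes T: "T \<subseteq> minimals" and M: "M dvd q ^ n - 1" and a: "\<alpha> \<noteq> 0"
  defines "G \<equiv> {x :: 'a. x ^ M = 1}"
  shows "cmod ((\<Sum>x\<in>G. \<Prod>U\<in>T. \<Sum>u\<in>U. of_real (\<kappa> U u) * \<psi> (u * (\<alpha> * x))) - of_real (real M * (\<Prod>U\<in>T. \<kappa> U 0)))
          \<le> sqrt (real (q ^ n) - real M) * ((\<Prod>U\<in>T. \<Sum>u\<in>U. \<bar>\<kappa> U u\<bar>) - (\<Prod>U\<in>T. \<bar>\<kappa> U 0\<bar>))"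
proof -
  define E where "E = sqrt (real (q ^ n) - real M)"
  define F where "F = PiE T (\<lambda>U. U)"
  define z where "z = restrict (\<lambda>U. 0 :: 'a) T"
  define W where "W g = (\<Prod>U\<in>T. \<kappa> U (g U))" for g :: "'a set \<Rightarrow> 'a"
  define R where "R g = (\<Sum>x\<in>G. \<psi> ((\<Sum>U\<in>T. g U) * \<alpha> * x))" for g :: "'a set \<Rightarrow> 'a"
  have finT: "finite T" by simp
  have finF: "finite F" unfolding F_def by (intro finite_PiE) auto
  have T0: "0 \<in> U" if "U \<in> T" for U using that T frob_subspaceD(1)[OF minimalsD(1)] by blast
  have zF: "z \<in> F" using T0 by (auto simp: z_def F_def)
  have "(\<Sum>x\<in>G. \<Prod>U\<in>T. \<Sum>u\<in>U. of_real (\<kappa> U u) * \<psi> (u * (\<alpha> * x)))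
      = (\<Sum>x\<in>G. \<Sum>g\<in>F. \<Prod>U\<in>T. of_real (\<kappa> U (g U)) * \<psi> (g U * (\<alpha> * x)))"
    unfolding F_def by (intro sum.cong refl prod_sum_PiE) auto
  also have "\<dots> = (\<Sum>x\<in>G. \<Sum>g\<in>F. of_real (W g) * \<psi> ((\<Sum>U\<in>T. g U) * \<alpha> * x))"
    by (simp add: W_def prod.distrib psi_sum[OF finT, symmetric] sum_distrib_right mult.assoc)
  also have "\<dots> = (\<Sum>g\<in>F. of_real (W g) * R g)"
    by (subst sum.swap) (simp add: R_def sum_distrib_left)
  also have "\<dots> = of_real (W z) * R z + (\<Sum>g\<in>F - {z}. of_real (W g) * R g)"
    by (rule sum.remove[OF finF zF])
  also have "R z = of_nat M"
    using card_roots_unity[OF M] by (simp add: R_def z_def psi_0 G_def)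
  also have "W z = (\<Prod>U\<in>T. \<kappa> U 0)" by (simp add: W_def z_def)
  finally have "(\<Sum>x\<in>G. \<Prod>U\<in>T. \<Sum>u\<in>U. of_real (\<kappa> U u) * \<psi> (u * (\<alpha> * x))) - of_real (real M * (\<Prod>U\<in>T. \<kappa> U 0))
      = (\<Sum>g\<in>F - {z}. of_real (W g) * R g)" by simp
  also have "cmod \<dots> \<le> (\<Sum>g\<in>F - {z}. \<bar>W g\<bar> * E)"
  proof (rule sum_norm_le)
    fix g assume g: "g \<in> F - {z}"
    have "(\<Sum>U\<in>T. g U) \<noteq> 0"
    proof
      assume s: "(\<Sum>U\<in>T. g U) = 0"
      have "g U = 0" if "U \<in> T" for U
        using minimals_independent[OF T _ s that] g by (auto simp: F_def PiE_def Pi_def)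
      hence "g = z" using g by (intro PiE_ext[of g T "\<lambda>U. U" z]) (use zF in \<open>auto simp: F_def z_def\<close>)
      thus False using g by simp
    qed
    hence "cmod (R g) \<le> E" unfolding R_def E_def G_def using a by (intro subgroup_sum_bound[OF M]) auto
    thus "cmod (of_real (W g) * R g) \<le> \<bar>W g\<bar> * E" by (simp add: norm_mult mult_left_mono)
  qed
  also have "\<dots> = E * ((\<Sum>g\<in>F. \<bar>W g\<bar>) - \<bar>W z\<bar>)"
    by (subst sum.remove[OF finF zF]) (simp add: sum_distrib_right sum_distrib_left mult.commute)
  also have "(\<Sum>g\<in>F. \<bar>W g\<bar>) = (\<Prod>U\<in>T. \<Sum>u\<in>U. \<bar>\<kappa> U u\<bar>)"
    unfolding F_def W_def abs_prod by (intro prod_sum_PiE[symmetric]) auto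
  also have "\<bar>W z\<bar> = (\<Prod>U\<in>T. \<bar>\<kappa> U 0\<bar>)" by (simp add: W_def z_def abs_prod)
  finally show ?thesis unfolding E_def .
qed

text \<open>Let \<open>f\<close> be the indicator of avoiding all conditions in \<open>H\<close>. At
  a non-normal point some condition of \<open>H\<close> or \<open>B\<close> is met, so
  \<open>f * (1 - (number of conditions of B met))\<close> is at most 0. If a whole coset had no
  normal element, the sum of this weight would be nonpositive, against the estimate in
  \<open>main\<close>.\<close>

lemma normal_in_coset:
  fixes \<alpha> :: 'a
  assumes M: "M dvd q ^ n - 1" and a: "\<alpha> \<noteq> 0" and HB: "H \<union> B = minimals" "H \<inter> B = {}"
  defines "l \<equiv> (\<Sum>U\<in>B. 1 / real (card U))"
  assumes main: "real M * (1 - l) > sqrt (real (q ^ n) - real M) * (2 ^ card H * (1 + real (card B)) - (1 + l))"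
  shows "\<exists>x. x ^ M = 1 \<and> normal_over_GF q n (\<alpha> * x)"
proof (rule ccontr)
  assume non: "\<not> (\<exists>x. x ^ M = 1 \<and> normal_over_GF q n (\<alpha> * x))"
  define G where "G = {x :: 'a. x ^ M = 1}"
  define E where "E = sqrt (real (q ^ n) - real M)"
  define bad where "bad U y = (if \<forall>u\<in>U. \<psi> (u * y) = 1 then 1 else 0 :: real)" for U y
  \<comment> \<open>Fourier coefficients of \<open>1 - bad U\<close>. Their absolute sum is twice
    the coefficient at 0, which is the source of the factor \<open>2 ^ card H\<close>. For
    \<open>bad U\<close> itself the absolute sum is 1, so a member of \<open>B\<close> costs only a
    summand.\<close>
  define k1 where "k1 U u = (if u = 0 then 1 - 1 / real (card U) else - 1 / real (card U))" for U :: "'a set" and u :: 'a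
  define f where "f y = (\<Prod>U\<in>H. 1 - bad U y)" for y
  define \<rho> where "\<rho> = (\<Prod>U\<in>H. 1 - 1 / real (card U))"
  have HBm: "U \<in> minimals" if "U \<in> H \<or> U \<in> B" for U using HB that by blast
  have cU: "real (card U) > 1" if "U \<in> minimals" for U
  proof -
    have "q ^ fdim U > 1" using card_minimal(2)[OF that] q_gt_1 by (intro one_less_power) auto
    thus ?thesis unfolding card_minimal(1)[OF that] by linarith
  qed
  have U0: "0 \<in> U" if "U \<in> minimals" for U using frob_subspaceD(1)[OF minimalsD(1)[OF that]] .
  have bad_eq: "of_real (bad U y) = (\<Sum>u\<in>U. of_real (1 / real (card U)) * \<psi> (u * y))" if U: "U \<in> minimals" for U y
  proof (cases "\<forall>u\<in>U. \<psi> (u * y) = 1")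
    case True
    thus ?thesis using cU[OF U] U0[OF U] by (auto simp: bad_def)
  next
    case False
    then obtain v where "v \<in> U" "\<psi> (v * y) \<noteq> 1" by blast
    hence "(\<Sum>u\<in>U. \<psi> (u * y)) = 0"
      by (intro psi_subgroup_sum[of U v y] frob_subspaceD[OF minimalsD(1)[OF U]])
    moreover have "bad U y = 0" using False by (auto simp: bad_def)
    ultimately show ?thesis by (simp flip: sum_divide_distrib sum_distrib_left)
  qed
  have k1_eq: "of_real (1 - bad U y) = (\<Sum>u\<in>U. of_real (k1 U u) * \<psi> (u * y))" if U: "U \<in> minimals" for U y
  proof -
    have "(\<Sum>u\<in>U. of_real (k1 U u) * \<psi> (u * y))
        = (\<Sum>u\<in>U. (if u = 0 then 1 else 0) - of_real (1 / real (card U)) * \<psi> (u * y))"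
      by (intro sum.cong refl) (auto simp: k1_def psi_0)
    also have "\<dots> = 1 - of_real (bad U y)"
      unfolding sum_subtractf bad_eq[OF U] using U0[OF U] by simp
    finally show ?thesis by simp
  qed
  have k1_abs: "(\<Sum>u\<in>U. \<bar>k1 U u\<bar>) = 2 * (1 - 1 / real (card U))" if U: "U \<in> minimals" for U
  proof -
    have "(\<Sum>u\<in>U. \<bar>k1 U u\<bar>) = \<bar>k1 U 0\<bar> + (\<Sum>u\<in>U - {0}. \<bar>k1 U u\<bar>)"
      by (rule sum.remove) (use U0[OF U] in auto)
    also have "(\<Sum>u\<in>U - {0}. \<bar>k1 U u\<bar>) = (real (card U) - 1) / real (card U)"
      using U0[OF U] cU[OF U] by (simp add: k1_def of_nat_diff)
    also have "\<dots> = 1 - 1 / real (card U)" using cU[OF U] by (auto simp: diff_divide_distrib)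
    also have "\<bar>k1 U 0\<bar> = 1 - 1 / real (card U)" using cU[OF U] by (simp add: k1_def)
    finally show ?thesis by simp
  qed
  have rho0: "\<rho> > 0" unfolding \<rho>_def
  proof (rule prod_pos)
    fix U assume "U \<in> H"
    hence "real (card U) > 1" using cU HBm by blast
    thus "0 < 1 - 1 / real (card U)" by (simp add: field_simps)
  qed
  have pr1: "(\<Prod>U\<in>H. \<Sum>u\<in>U. \<bar>k1 U u\<bar>) = 2 ^ card H * \<rho>"
  proof -
    have "(\<Prod>U\<in>H. \<Sum>u\<in>U. \<bar>k1 U u\<bar>) = (\<Prod>U\<in>H. 2 * (1 - 1 / real (card U)))"
      using HBm by (intro prod.cong refl k1_abs) auto
    thus ?thesis unfolding \<rho>_def prod.distrib by simp
  qed
  have pr2: "(\<Prod>U\<in>H. k1 U 0) = \<rho>" by (simp add: k1_def \<rho>_def)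
  have pr3: "(\<Prod>U\<in>H. \<bar>k1 U 0\<bar>) = \<rho>" using rho0 unfolding abs_prod[symmetric] pr2 by simp
  have bA: "\<bar>(\<Sum>x\<in>G. f (\<alpha> * x)) - real M * \<rho>\<bar> \<le> E * (2 ^ card H * \<rho> - \<rho>)"
  proof -
    have eq: "complex_of_real ((\<Sum>x\<in>G. f (\<alpha> * x)) - real M * \<rho>) =
      (\<Sum>x\<in>G. \<Prod>U\<in>H. \<Sum>u\<in>U. of_real (k1 U u) * \<psi> (u * (\<alpha> * x))) - of_real (real M * (\<Prod>U\<in>H. k1 U 0))"
    proof -
      have "complex_of_real (f y) = (\<Prod>U\<in>H. \<Sum>u\<in>U. of_real (k1 U u) * \<psi> (u * y))" for y
        unfolding f_def of_real_prod using HBm by (intro prod.cong refl k1_eq) auto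
      thus ?thesis by (simp add: pr2)
    qed
    have "\<bar>(\<Sum>x\<in>G. f (\<alpha> * x)) - real M * \<rho>\<bar> = cmod (complex_of_real ((\<Sum>x\<in>G. f (\<alpha> * x)) - real M * \<rho>))"
      by (simp only: norm_of_real)
    also note eq
    also have "cmod ((\<Sum>x\<in>G. \<Prod>U\<in>H. \<Sum>u\<in>U. of_real (k1 U u) * \<psi> (u * (\<alpha> * x))) - of_real (real M * (\<Prod>U\<in>H. k1 U 0)))
      \<le> E * ((\<Prod>U\<in>H. \<Sum>u\<in>U. \<bar>k1 U u\<bar>) - (\<Prod>U\<in>H. \<bar>k1 U 0\<bar>))"
      unfolding G_def E_def using HBm by (intro minimals_character_sum M a) auto
    finally show ?thesis by (simp add: pr1 pr3)
  qed
  have bB: "\<bar>(\<Sum>x\<in>G. f (\<alpha> * x) * bad U (\<alpha> * x)) - real M * \<rho> / real (card U)\<bar>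
              \<le> E * (2 ^ card H * \<rho> - \<rho> / real (card U))" if U: "U \<in> B" for U
  proof -
    have Um: "U \<in> minimals" and UH: "U \<notin> H" using U HB by blast+
    define k where "k V u = (if V = U then 1 / real (card U) else k1 V u)" for V u
    have kH: "(\<Prod>V\<in>insert U H. g V (k V)) = g U (\<lambda>_. 1 / real (card U)) * (\<Prod>V\<in>H. g V (k1 V))"
      for g :: "'a set \<Rightarrow> ('a \<Rightarrow> real) \<Rightarrow> 'b :: comm_monoid_mult"
    proof -
      have "(\<Prod>V\<in>H. g V (k V)) = (\<Prod>V\<in>H. g V (k1 V))"
        using UH by (intro prod.cong refl arg_cong[of _ _ "g _"] ext) (auto simp: k_def)
      moreover have "k U = (\<lambda>_. 1 / real (card U))" by (auto simp: k_def)
      ultimately show ?thesis using UH by simp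
    qed
    have p2: "(\<Prod>V\<in>insert U H. k V 0) = \<rho> / real (card U)"
      using kH[of "\<lambda>V h. h 0"] by (simp add: pr2)
    have p3: "(\<Prod>V\<in>insert U H. \<bar>k V 0\<bar>) = \<rho> / real (card U)"
      using kH[of "\<lambda>V h. \<bar>h 0\<bar>"] by (simp add: pr3)
    have p1: "(\<Prod>V\<in>insert U H. \<Sum>u\<in>V. \<bar>k V u\<bar>) = 2 ^ card H * \<rho>"
      using kH[of "\<lambda>V h. \<Sum>u\<in>V. \<bar>h u\<bar>"] U0[OF Um] by (auto simp: pr1)
    have p4: "complex_of_real (f y * bad U y) = (\<Prod>V\<in>insert U H. \<Sum>u\<in>V. of_real (k V u) * \<psi> (u * y))" for y
    proof -
      have "(\<Prod>V\<in>H. \<Sum>u\<in>V. of_real (k1 V u) * \<psi> (u * y)) = of_real (f y)"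
        unfolding f_def of_real_prod using HBm by (intro prod.cong refl k1_eq[symmetric]) auto
      moreover have "(\<Sum>u\<in>U. of_real (1 / real (card U)) * \<psi> (u * y)) = of_real (bad U y)"
        by (rule bad_eq[OF Um, symmetric])
      ultimately show ?thesis using kH[of "\<lambda>V h. \<Sum>u\<in>V. of_real (h u) * \<psi> (u * y)"] by simp
    qed
    have eq: "complex_of_real ((\<Sum>x\<in>G. f (\<alpha> * x) * bad U (\<alpha> * x)) - real M * \<rho> / real (card U)) =
      (\<Sum>x\<in>G. \<Prod>V\<in>insert U H. \<Sum>u\<in>V. of_real (k V u) * \<psi> (u * (\<alpha> * x))) - of_real (real M * (\<Prod>V\<in>insert U H. k V 0))"
      unfolding p2 of_real_diff of_real_sum p4 by simp
    have "\<bar>(\<Sum>x\<in>G. f (\<alpha> * x) * bad U (\<alpha> * x)) - real M * \<rho> / real (card U)\<bar>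
        = cmod (complex_of_real ((\<Sum>x\<in>G. f (\<alpha> * x) * bad U (\<alpha> * x)) - real M * \<rho> / real (card U)))"
      by (simp only: norm_of_real)
    also note eq
    also have "cmod ((\<Sum>x\<in>G. \<Prod>V\<in>insert U H. \<Sum>u\<in>V. of_real (k V u) * \<psi> (u * (\<alpha> * x))) - of_real (real M * (\<Prod>V\<in>insert U H. k V 0)))
      \<le> E * ((\<Prod>V\<in>insert U H. \<Sum>u\<in>V. \<bar>k V u\<bar>) - (\<Prod>V\<in>insert U H. \<bar>k V 0\<bar>))"
      unfolding G_def E_def using HBm U by (intro minimals_character_sum M a) auto
    finally show ?thesis unfolding p1 p3 .
  qed
  have neg: "f y * (1 - (\<Sum>U\<in>B. bad U y)) \<le> 0" if y: "y = \<alpha> * x" "x \<in> G" for x y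
  proof -
    have "\<not> normal_over_GF q n y" using non y by (auto simp: G_def)
    then obtain U where U: "U \<in> minimals" "\<forall>u\<in>U. \<psi> (u * y) = 1" using not_normal_imp_orthogonal by blast
    have bU: "bad U y = 1" using U by (simp add: bad_def)
    have f0: "f y \<ge> 0" unfolding f_def by (intro prod_nonneg) (auto simp: bad_def)
    show ?thesis
    proof (cases "U \<in> H")
      case True
      hence "f y = 0" unfolding f_def using bU by (intro prod_zero) auto
      thus ?thesis by simp
    next
      case False
      hence "U \<in> B" using U HB by blast
      hence "bad U y \<le> (\<Sum>U\<in>B. bad U y)" by (intro member_le_sum) (auto simp: bad_def)
      thus ?thesis using bU f0 by (intro mult_nonneg_nonpos) auto
    qed
  qed
  \<comment> \<open>Both main and error terms carry the common factor \<open>\<rho>\<close>, which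
    then cancels and leaves exactly the hypothesis \<open>main\<close>.\<close>
  have "(real M * \<rho> - E * (2 ^ card H * \<rho> - \<rho>)) -
      (\<Sum>U\<in>B. real M * \<rho> / real (card U) + E * (2 ^ card H * \<rho> - \<rho> / real (card U)))
      \<le> (\<Sum>x\<in>G. f (\<alpha> * x)) - (\<Sum>U\<in>B. \<Sum>x\<in>G. f (\<alpha> * x) * bad U (\<alpha> * x))"
  proof (intro diff_mono sum_mono)
    show "real M * \<rho> - E * (2 ^ card H * \<rho> - \<rho>) \<le> (\<Sum>x\<in>G. f (\<alpha> * x))"
      using bA by linarith
    show "(\<Sum>x\<in>G. f (\<alpha> * x) * bad U (\<alpha> * x)) \<le> real M * \<rho> / real (card U) + E * (2 ^ card H * \<rho> - \<rho> / real (card U))"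
      if "U \<in> B" for U using bB[OF that] by linarith
  qed
  also have "\<dots> = (\<Sum>x\<in>G. f (\<alpha> * x) * (1 - (\<Sum>U\<in>B. bad U (\<alpha> * x))))"
    by (subst sum.swap) (simp add: right_diff_distrib sum_subtractf sum_distrib_left)
  also have "\<dots> \<le> 0" by (intro sum_nonpos neg[OF refl])
  also have "(\<Sum>U\<in>B. real M * \<rho> / real (card U) + E * (2 ^ card H * \<rho> - \<rho> / real (card U)))
      = (\<Sum>U\<in>B. (real M * \<rho> - E * \<rho>) * (1 / real (card U)) + E * 2 ^ card H * \<rho>)"
    by (intro sum.cong refl) (simp add: diff_divide_distrib algebra_simps)
  also have "\<dots> = (real M * \<rho> - E * \<rho>) * l + real (card B) * (E * 2 ^ card H * \<rho>)"
    unfolding l_def sum.distrib sum_distrib_left[symmetric] by simp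
  finally have "\<rho> * (real M * (1 - l) - E * (2 ^ card H * (1 + real (card B)) - (1 + l))) \<le> 0"
    by (simp add: algebra_simps)
  hence "real M * (1 - l) - E * (2 ^ card H * (1 + real (card B)) - (1 + l)) \<le> 0"
    using rho0 by (simp add: mult_le_0_iff)
  thus False using main unfolding E_def by simp
qed

text \<open>A coarser criterion for numerical use: the square root is replaced by
  \<open>q ^ (n/2)\<close>, so only the ratio \<open>X\<close> of \<open>M\<close> to it
  matters.\<close>

lemma normal_in_coset_split:
  fixes \<alpha> :: 'a
  assumes M: "M dvd q ^ n - 1" and a: "\<alpha> \<noteq> 0" and H: "H \<subseteq> minimals"
    and X: "X * sqrt (real q) ^ n \<le> real M" "X > 0"
    and l: "l = (\<Sum>U\<in>minimals - H. (1 / real q) ^ fdim U)" "l < 1"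
    and main: "X * (1 - l) \<ge> 2 ^ card H * (1 + real (card (minimals - H)))"
  shows "\<exists>x. x ^ M = 1 \<and> normal_over_GF q n (\<alpha> * x)"
proof -
  have l': "(\<Sum>U\<in>minimals - H. 1 / real (card U)) = l"
    unfolding l by (intro sum.cong refl) (simp add: card_minimal power_divide)
  have l0: "l \<ge> 0" unfolding l by (intro sum_nonneg) auto
  define E where "E = sqrt (real (q ^ n) - real M)"
  define Q where "Q = 2 ^ card H * (1 + real (card (minimals - H)))"
  have M0: "M > 0" using M qn_gt_1 by (intro Nat.gr0I) auto
  have Mle: "M \<le> q ^ n" using dvd_imp_le[OF M] qn_gt_1 by simp
  have E: "0 \<le> E" "E \<le> sqrt (real q) ^ n"
    using M0 Mle unfolding E_def by (auto simp: real_sqrt_power[symmetric] simp del: real_sqrt_power simp flip: of_nat_power)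
  have Q1: "1 \<le> Q" unfolding Q_def using mult_mono[of 1 "2 ^ card H" 1 "1 + real (card (minimals - H))"] by simp
  have sq: "sqrt (real q) ^ n > 0" using q_gt_1 by simp
  have "E * (Q - (1 + l)) < sqrt (real q) ^ n * Q"
  proof (cases "Q - (1 + l) \<ge> 0")
    case True
    hence "E * (Q - (1 + l)) \<le> sqrt (real q) ^ n * (Q - (1 + l))" using E by (intro mult_right_mono)
    also have "\<dots> < sqrt (real q) ^ n * Q" using sq l0 by simp
    finally show ?thesis .
  next
    case False
    hence "E * (Q - (1 + l)) \<le> 0" using E by (intro mult_nonneg_nonpos) auto
    also have "0 < sqrt (real q) ^ n * Q" using sq Q1 by simp
    finally show ?thesis .
  qed
  also have "\<dots> \<le> sqrt (real q) ^ n * (X * (1 - l))" using main sq unfolding Q_def by simp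
  also have "\<dots> \<le> real M * (1 - l)" using X l(2) by (simp add: mult.commute mult.left_commute mult_right_mono)
  finally show ?thesis using H
    by (intro normal_in_coset[OF M a, of H "minimals - H"]) (auto simp: l' E_def Q_def)
qed

text \<open>
  Here \<open>\<theta> ^ (q - 1)\<close> lies in \<open>Fq\<close>, so the conjugates of \<open>\<theta> * \<alpha>\<close> are those of \<open>\<alpha>\<close> scaled by
  \<open>\<theta>\<close> and elements of \<open>Fq\<close>.
\<close>

lemma normal_mult_kummer:
  fixes \<alpha> \<theta> :: 'a
  assumes "normal_over_GF q n (\<theta> * \<alpha>)" and t: "\<theta> ^ ((q - 1) ^ 2) = 1"
  shows "normal_over_GF q n \<alpha>"
proof -
  have t0: "\<theta> \<noteq> 0"
  proof
    assume "\<theta> = 0"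
    hence "(0 :: 'a) ^ ((q - 1) ^ 2) = 1" using t by simp
    thus False using q_gt_1 by (simp add: power_0_left)
  qed
  define z where "z = \<theta> ^ (q - 1)"
  have "z ^ (q - 1) = 1" unfolding z_def power_mult[symmetric] using t by (simp add: power2_eq_square)
  hence "z ^ (q - 1) * z = z" by simp
  moreover have "z ^ (q - 1) * z = z ^ q" using q_gt_1 by (intro power_minus_mult) auto
  ultimately have "z ^ q = z" by metis
  hence z: "z \<in> Fq" by (simp add: Fq_def GF_def)
  have z0: "z \<noteq> 0" using t0 by (simp add: z_def)
  have tq: "\<theta> ^ q = z * \<theta>" unfolding z_def using power_minus_mult[of q \<theta>] q_gt_1 by simp
  have ti: "\<theta> ^ (q ^ i) = z ^ i * \<theta>" for i
  proof (induction i)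
    case (Suc i)
    have "\<theta> ^ (q ^ Suc i) = (\<theta> ^ (q ^ i)) ^ q" by (simp add: power_mult[symmetric] mult.commute)
    also have "\<dots> = (z ^ q) ^ i * \<theta> ^ q" unfolding Suc by (simp add: power_mult_distrib power_mult[symmetric] mult.commute)
    also have "\<dots> = z ^ Suc i * \<theta>" by (simp add: \<open>z ^ q = z\<close> tq)
    finally show ?case .
  qed simp
  have zi: "z ^ i \<in> Fq" for i by (induction i) (auto intro: Fq_mult z)
  have ind: "\<forall>i\<in>{..<n}. c i = 0" if "(\<forall>i\<in>{..<n}. c i \<in> Fq) \<and> (\<Sum>i<n. c i * (\<theta> * \<alpha>) ^ (q ^ i)) = 0" for c
    using assms(1) that unfolding normal_over_GF_def basis_over_def Fq_def[symmetric] by blast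
  have spn: "\<exists>c. (\<forall>i\<in>{..<n}. c i \<in> Fq) \<and> x = (\<Sum>i<n. c i * (\<theta> * \<alpha>) ^ (q ^ i))" for x
    using assms(1) unfolding normal_over_GF_def basis_over_def Fq_def[symmetric] by blast
  show ?thesis unfolding normal_over_GF_def basis_over_def Fq_def[symmetric]
  proof (intro conjI allI impI)
    fix c assume c: "(\<forall>i\<in>{..<n}. c i \<in> Fq) \<and> (\<Sum>i\<in>{..<n}. c i * \<alpha> ^ (q ^ i)) = 0"
    have "(\<Sum>i<n. (c i * inverse (z ^ i)) * (\<theta> * \<alpha>) ^ (q ^ i)) = \<theta> * (\<Sum>i<n. c i * \<alpha> ^ (q ^ i))"
      unfolding sum_distrib_left using z0 by (intro sum.cong refl) (simp add: power_mult_distrib ti)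
    hence "\<forall>i\<in>{..<n}. c i * inverse (z ^ i) = 0"
      using c zi by (intro ind) (auto intro!: Fq_mult Fq_inverse)
    thus "\<forall>i\<in>{..<n}. c i = 0" using z0 by simp
  next
    fix x
    obtain c where c: "\<forall>i\<in>{..<n}. c i \<in> Fq" "\<theta> * x = (\<Sum>i<n. c i * (\<theta> * \<alpha>) ^ (q ^ i))"
      using spn[of "\<theta> * x"] by blast
    have "\<theta> * x = \<theta> * (\<Sum>i<n. (c i * z ^ i) * \<alpha> ^ (q ^ i))"
      unfolding c(2) sum_distrib_left by (intro sum.cong refl) (simp add: power_mult_distrib ti mult_ac)
    hence "x = (\<Sum>i<n. (c i * z ^ i) * \<alpha> ^ (q ^ i))" using t0 by simp
    thus "\<exists>c. (\<forall>i\<in>{..<n}. c i \<in> Fq) \<and> x = (\<Sum>i\<in>{..<n}. c i * \<alpha> ^ (q ^ i))"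
      using c(1) zi by (intro exI[of _ "\<lambda>i. c i * z ^ i"]) (auto intro: Fq_mult)
  qed
qed

end

section \<open>Norm equations\<close>

text \<open>For the nontrivial divisibility, multiply by the gcd \<open>Y\<close> of all three
  numbers: the product with \<open>X\<close> divides each of the four terms of
  \<open>gcd a b * gcd a c\<close>.\<close>

lemma gcd_lcm_distrib_nat: "gcd a (lcm b c) = lcm (gcd a b) (gcd a (c :: nat))"
proof (rule dvd_antisym)
  define Y where "Y = gcd (gcd a b) (gcd a c)"
  define X where "X = gcd a (lcm b c)"
  have Y: "Y dvd a" "Y dvd b" "Y dvd c" unfolding Y_def by (meson dvd_trans gcd_dvd1 gcd_dvd2)+
  have X: "X dvd a" "X dvd lcm b c" unfolding X_def by auto
  have "X * Y dvd a * a" "X * Y dvd a * c" "X * Y dvd b * a"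
    using mult_dvd_mono[OF X(1) Y(1)] mult_dvd_mono[OF X(1) Y(3)] mult_dvd_mono[OF X(1) Y(2)]
    by (simp_all add: mult.commute)
  moreover have "X * Y dvd b * c"
  proof -
    have "Y dvd gcd b c" using Y by simp
    hence "X * Y dvd lcm b c * gcd b c" by (rule mult_dvd_mono[OF X(2)])
    thus ?thesis by (simp add: lcm_mult_gcd)
  qed
  moreover have "gcd a b * gcd a c = gcd (gcd (a * a) (a * b)) (gcd (c * a) (c * b))"
  proof -
    have "gcd a b * gcd a c = gcd (gcd a b * a) (gcd a b * c)" by (rule gcd_mult_distrib_nat)
    also have "gcd a b * a = gcd (a * a) (a * b)" unfolding gcd_mult_distrib_nat[symmetric] by (rule mult.commute)
    also have "gcd a b * c = gcd (c * a) (c * b)" unfolding gcd_mult_distrib_nat[symmetric] by (rule mult.commute)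
    finally show ?thesis .
  qed
  ultimately have "X * Y dvd gcd a b * gcd a c" by (simp add: mult.commute)
  also have "gcd a b * gcd a c = lcm (gcd a b) (gcd a c) * Y" unfolding Y_def by (simp add: lcm_mult_gcd)
  finally have "X * Y dvd lcm (gcd a b) (gcd a c) * Y" .
  note XY = this
  show "gcd a (lcm b c) dvd lcm (gcd a b) (gcd a c)"
  proof (cases "Y = 0")
    case True
    hence "a = 0 \<and> b = 0 \<and> c = 0" by (simp add: Y_def)
    thus ?thesis by simp
  next
    case False
    from XY show ?thesis unfolding X_def[symmetric] dvd_times_right_cancel_iff[OF False] .
  qed
next
  show "lcm (gcd a b) (gcd a c) dvd gcd a (lcm b c)"
    by (rule lcm_least[OF gcd_greatest[OF gcd_dvd1 dvd_trans[OF gcd_dvd2 dvd_lcm1]]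
          gcd_greatest[OF gcd_dvd1 dvd_trans[OF gcd_dvd2 dvd_lcm2]]])
qed

lemma gcd_Lcm_distrib_nat:
  assumes "finite A"
  shows "gcd a (Lcm A) = Lcm ((gcd (a :: nat)) ` A)"
  using assms by (induction A rule: finite_induct) (simp_all add: gcd_lcm_distrib_nat)

text \<open>The moduli need not be coprime. In the induction step, compatibility of the new
  congruence with the lcm \<open>K\<close> of the old moduli follows because gcd distributes over
  \<open>Lcm\<close>; Bezout then supplies the correction.\<close>

lemma generalized_chinese_remainder:
  fixes m s :: "'i \<Rightarrow> nat"
  assumes "finite I" "\<And>i. i \<in> I \<Longrightarrow> m i > 0" "\<And>i j. i \<in> I \<Longrightarrow> j \<in> I \<Longrightarrow> [s i = s j] (mod gcd (m i) (m j))"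
  shows "\<exists>x. \<forall>i\<in>I. [x = s i] (mod m i)"
  using assms
proof (induction I rule: finite_induct)
  case (insert j I)
  have "\<exists>x. \<forall>i\<in>I. [x = s i] (mod m i)" by (rule insert.IH) (use insert.prems in auto)
  then obtain x where x': "\<forall>i\<in>I. [x = s i] (mod m i)" by (rule exE)
  have x: "[x = s i] (mod m i)" if "i \<in> I" for i using x' that by simp
  have mI: "0 \<notin> m ` I"
  proof
    assume "0 \<in> m ` I"
    then obtain i where "i \<in> I" "m i = 0" by auto
    thus False using insert.prems(1)[of i] by simp
  qed
  define K where "K = Lcm (m ` I)"
  have K0: "K > 0" unfolding K_def using mI insert.hyps(1) by (intro Nat.gr0I) (simp add: Lcm_0_iff)
  have "int (gcd (m j) K) dvd int x - int (s j)"
  proof -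
    have "gcd (m j) K = Lcm ((\<lambda>i. gcd (m j) (m i)) ` I)"
      unfolding K_def using insert by (subst gcd_Lcm_distrib_nat) (auto simp: image_image)
    also have "int \<dots> dvd int x - int (s j)"
    proof -
      have "Lcm ((\<lambda>i. gcd (m j) (m i)) ` I) dvd nat \<bar>int x - int (s j)\<bar>"
      proof (rule Lcm_least)
        fix b assume "b \<in> (\<lambda>i. gcd (m j) (m i)) ` I"
        then obtain i where i: "i \<in> I" "b = gcd (m j) (m i)" by auto
        have "[x = s i] (mod b)" using x[OF i(1)] by (rule cong_dvd_modulus_nat) (simp add: i)
        moreover have "[s i = s j] (mod b)" using insert.prems(2)[of i j] i by (simp add: gcd.commute)
        ultimately have "[x = s j] (mod b)" by (rule cong_trans)
        hence "int b dvd int x - int (s j)" by (simp add: cong_int_iff[symmetric] cong_iff_dvd_diff)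
        thus "b dvd nat \<bar>int x - int (s j)\<bar>" by (simp add: dvd_nat_abs_iff)
      qed
      thus ?thesis by (simp add: dvd_nat_abs_iff)
    qed
    finally show ?thesis .
  qed
  then obtain t where t: "int x - int (s j) = int (gcd (m j) K) * t" by (elim dvdE)
  obtain u v where uv: "u * int (m j) + v * int K = int (gcd (m j) K)"
    using bezout_int[of "int (m j)" "int K"] unfolding gcd_int_int_eq by (elim exE)
  define z where "z = int x - v * t * int K"
  have z1: "z = int (s j) + u * t * int (m j)"
  proof -
    have "int x = int (s j) + (u * int (m j) + v * int K) * t" using t unfolding uv by simp
    thus ?thesis unfolding z_def by (simp add: algebra_simps)
  qed
  define y where "y = nat (z mod (int (m j) * int K))"
  have mj: "m j > 0" using insert by auto
  have y: "int y = z mod (int (m j) * int K)" using mj K0 by (simp add: y_def)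
  have "[int y = z] (mod (int (m j) * int K))" by (simp add: y cong_def)
  hence yz: "int (m j) * int K dvd int y - z" by (simp add: cong_iff_dvd_diff)
  have "[y = s i] (mod m i)" if "i \<in> insert j I" for i
  proof (cases "i = j")
    case True
    have "int (m j) dvd int y - z" using yz by (rule dvd_mult_left)
    moreover have "int (m j) dvd z - int (s j)" by (simp add: z1)
    ultimately have "int (m j) dvd (int y - z) + (z - int (s j))" by (rule dvd_add)
    thus ?thesis using True by (simp add: cong_int_iff[symmetric] cong_iff_dvd_diff)
  next
    case False
    hence i: "i \<in> I" using that by simp
    have "m i dvd K" unfolding K_def using i by simp
    hence mK: "int (m i) dvd int K" by simp
    have "int (m i) dvd int y - z" using dvd_trans[OF mK dvd_mult_right[OF yz]] .
    moreover have "int (m i) dvd z - int x" unfolding z_def using mK by simp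
    moreover have "int (m i) dvd int x - int (s i)" using x[OF i] by (simp add: cong_int_iff[symmetric] cong_iff_dvd_diff)
    ultimately have "int (m i) dvd (int y - z) + (z - int x) + (int x - int (s i))" by (intro dvd_add)
    thus ?thesis by (simp add: cong_int_iff[symmetric] cong_iff_dvd_diff)
  qed
  thus ?case by blast
qed simp

text \<open>Euclid's algorithm on the exponents: \<open>q ^ a - 1\<close> and
  \<open>q ^ (a - b) - 1\<close> agree modulo \<open>q ^ b - 1\<close>.\<close>

lemma gcd_power_minus_1:
  assumes "q > (0 :: nat)"
  shows "gcd (q ^ a - 1) (q ^ b - 1) = q ^ gcd a b - 1"
proof (induction "a + b" arbitrary: a b rule: less_induct)
  case less
  have *: "gcd (q ^ a - 1) (q ^ b - 1) = q ^ gcd a b - 1"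
    if "b \<le> a" "b > 0" and IH: "gcd (q ^ (a - b) - 1) (q ^ b - 1) = q ^ gcd (a - b) b - 1" for a b
  proof -
    have "q ^ a = q ^ (a - b) * q ^ b" using that by (simp flip: power_add)
    moreover obtain A B where "q ^ b = Suc B" "q ^ (a - b) = Suc A"
      using assms by (metis gr0_implies_Suc zero_less_power)
    ultimately have "q ^ a - 1 = q ^ (a - b) * (q ^ b - 1) + (q ^ (a - b) - 1)" by simp
    hence "gcd (q ^ b - 1) (q ^ a - 1) = gcd (q ^ b - 1) (q ^ (a - b) - 1)"
      by (simp only: gcd_add_mult)
    hence "gcd (q ^ a - 1) (q ^ b - 1) = gcd (q ^ (a - b) - 1) (q ^ b - 1)"
      unfolding gcd.commute[of "q ^ b - 1"] .
    also have "\<dots> = q ^ gcd (a - b) b - 1" by (rule IH)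
    also have "gcd (a - b) b = gcd a b" using that by (simp add: gcd_diff1_nat)
    finally show ?thesis .
  qed
  consider "a = 0" | "b = 0" | "0 < b" "b \<le> a" | "0 < a" "a \<le> b" by linarith
  thus ?case
  proof cases
    case 3
    show ?thesis by (rule *[OF 3(2,1)], rule less) (use 3 in auto)
  next
    case 4
    have "gcd (q ^ b - 1) (q ^ a - 1) = q ^ gcd b a - 1" by (rule *[OF 4(2,1)], rule less) (use 4 in auto)
    thus ?thesis by (simp add: gcd.commute)
  qed auto
qed

text \<open>The right side consists of the first terms of Euler's pentagonal number series. The
  induction closes only with the extra summand \<open>x = 1 / q ^ (k + 1)\<close>: since
  \<open>x <= 1 / q^2\<close>, the product \<open>(A + x) * (1 - x)\<close> is at least
  \<open>A + x / q\<close>.\<close>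

lemma prod_one_minus_power_ge:
  fixes q :: real
  assumes q: "q \<ge> 2"
  shows "(\<Prod>i=1..k. 1 - 1 / q ^ i) \<ge> 1 - 1 / q - 1 / q\<^sup>2"
proof -
  have "(\<Prod>i=1..k. 1 - 1 / q ^ i) \<ge> 1 - 1 / q - 1 / q\<^sup>2 + 1 / q ^ (k + 1)" if "k > 0" for k
    using that
  proof (induction k rule: nat_induct_non_zero)
    case 1
    show ?case by (simp add: power2_eq_square)
  next
    case (Suc k)
    define x where "x = 1 / q ^ (k + 1)"
    define A where "A = 1 - 1 / q - 1 / q\<^sup>2"
    have x: "0 \<le> x" "x \<le> 1 / q\<^sup>2"
    proof -
      show "0 \<le> x" using q by (simp add: x_def)
      have "q\<^sup>2 \<le> q ^ (k + 1)" using q Suc by (intro power_increasing) auto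
      thus "x \<le> 1 / q\<^sup>2" unfolding x_def using q by (intro divide_left_mono) auto
    qed
    have "1 \<le> q\<^sup>2" using q by (intro one_le_power) auto
    hence q2: "1 / q\<^sup>2 \<le> 1" by (simp add: divide_le_eq_1)
    have "x * (1 - A - x) \<ge> x * (1 / q)" using x by (intro mult_left_mono) (auto simp: A_def)
    hence "A + x * (1 / q) \<le> (A + x) * (1 - x)" by (simp add: algebra_simps)
    also have "\<dots> \<le> (\<Prod>i=1..k. 1 - 1 / q ^ i) * (1 - x)"
      using Suc.IH x q2 by (intro mult_right_mono) (auto simp: A_def x_def)
    also have "\<dots> = (\<Prod>i=1..Suc k. 1 - 1 / q ^ i)" by (simp add: x_def)
    finally show ?case using q by (simp add: A_def x_def field_simps)
  qed
  note pos = this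
  show ?thesis
  proof (cases "k = 0")
    case False
    have "1 / q ^ (k + 1) \<ge> 0" using q by simp
    thus ?thesis using pos[of k] False by linarith
  next
    case True
    have "1 / q \<ge> 0" "1 / q\<^sup>2 \<ge> 0" using q by auto
    hence "1 - 1 / q - 1 / q\<^sup>2 \<le> 1" by linarith
    thus ?thesis using True by simp
  qed
qed

lemma quotient_swap:
  fixes x :: real
  assumes "M * b = k * a" "a \<noteq> 0" "b \<noteq> 0" "k \<noteq> 0" "M \<noteq> 0"
  shows "x / M = (x / a) / (k / b)"
proof -
  have "M = k * a / b" using assms by (simp add: field_simps)
  thus ?thesis by simp
qed

section \<open>The quotient of \<open>q ^ L - 1\<close> by the lcm of the
  \<open>q ^ (L div p) - 1\<close>\<close>

context
  fixes q :: nat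
  assumes q2: "q \<ge> 2"
begin

text \<open>The set \<open>P\<close> is kept variable so that primes can be added one at a time. For
  all prime factors of \<open>L\<close>, the quotient of \<open>q ^ L - 1\<close> by this number is
  Phi_L(q).\<close>

definition norm_lcm :: "nat \<Rightarrow> nat set \<Rightarrow> nat" where
  "norm_lcm L P = Lcm ((\<lambda>p. q ^ (L div p) - 1) ` P)"

lemma norm_lcm_pos:
  assumes "finite P" "L > 0" "\<And>p. p \<in> P \<Longrightarrow> prime p \<and> p dvd L"
  shows "norm_lcm L P > 0"
proof -
  have "q ^ (L div p) - 1 \<noteq> 0" if "p \<in> P" for p
  proof -
    have "p \<le> L" "p > 0" using assms(2) assms(3)[OF that] dvd_imp_le[of p L] prime_gt_0_nat[of p] by auto
    hence "L div p > 0" by (simp add: div_greater_zero_iff)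
    hence "q ^ (L div p) > 1" using q2 by (intro one_less_power) auto
    thus ?thesis by simp
  qed
  hence "0 \<notin> (\<lambda>p. q ^ (L div p) - 1) ` P" by (auto simp del: One_nat_def dest: sym)
  thus ?thesis using assms(1) unfolding norm_lcm_def by (intro Nat.gr0I) (simp add: Lcm_0_iff)
qed

text \<open>This is \<open>lcm * gcd = product\<close>. The gcd passes through the
  \<open>Lcm\<close>, and \<open>L div r\<close> and \<open>L div p\<close> have gcd
  \<open>L div r div p\<close>.\<close>

lemma norm_lcm_insert:
  assumes "finite P" "L > 0" "\<And>p. p \<in> insert r P \<Longrightarrow> prime p \<and> p dvd L" "r \<notin> P"
  shows "norm_lcm L (insert r P) * norm_lcm (L div r) P = (q ^ (L div r) - 1) * norm_lcm L P"
proof -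
  have "norm_lcm L (insert r P) = lcm (q ^ (L div r) - 1) (norm_lcm L P)" by (simp add: norm_lcm_def)
  hence "norm_lcm L (insert r P) * gcd (q ^ (L div r) - 1) (norm_lcm L P) = (q ^ (L div r) - 1) * norm_lcm L P"
    by (simp only: lcm_mult_gcd normalize_nat_def id_apply)
  also have "gcd (q ^ (L div r) - 1) (norm_lcm L P) = norm_lcm (L div r) P"
  proof -
    have "gcd (q ^ (L div r) - 1) (norm_lcm L P) = Lcm ((\<lambda>p. gcd (q ^ (L div r) - 1) (q ^ (L div p) - 1)) ` P)"
      unfolding norm_lcm_def using assms(1) by (subst gcd_Lcm_distrib_nat) (auto simp: image_image)
    also have "(\<lambda>p. gcd (q ^ (L div r) - 1) (q ^ (L div p) - 1)) ` P = (\<lambda>p. q ^ (L div r div p) - 1) ` P"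
    proof (intro image_cong refl)
      fix p assume p: "p \<in> P"
      hence pr: "prime p" "prime r" "p \<noteq> r" "p dvd L" "r dvd L" using assms by auto
      hence "coprime p r" by (simp add: primes_coprime)
      hence "p * r dvd L" using pr by (simp add: divides_mult)
      then obtain k where k: "L = p * r * k" by (elim dvdE)
      have *: "L div r = p * k" "L div p = r * k" "L div r div p = k"
        using pr prime_gt_0_nat[of p] prime_gt_0_nat[of r] by (simp_all add: k)
      have "gcd (p * k) (r * k) = k" using gcd_mult_distrib_nat[of k p r] coprime_imp_gcd_eq_1[OF \<open>coprime p r\<close>]
        by (simp add: mult.commute)
      moreover have "q > 0" using q2 by simp
      ultimately show "gcd (q ^ (L div r) - 1) (q ^ (L div p) - 1) = q ^ (L div r div p) - 1"
        unfolding *(3) unfolding *(1,2) by (simp only: gcd_power_minus_1)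
    qed
    finally show ?thesis by (simp add: norm_lcm_def)
  qed
  finally show ?thesis .
qed

text \<open>Iterating the recursion gives the Moebius product for Phi_L(q), with numerator exponents
  \<open>E\<close> and denominator exponents \<open>D\<close>. The multiplicity clause serves the
  induction: exponents coming from \<open>L\<close> and from \<open>L div r\<close> differ at the
  prime \<open>r\<close>, so the sets stay disjoint.\<close>

lemma norm_lcm_product_formula:
  assumes "finite P" "L > 0" "\<And>p. p \<in> P \<Longrightarrow> prime p \<and> p dvd L"
  shows "\<exists>E D. finite E \<and> finite D \<and>
      (\<forall>e\<in>E \<union> D. e > 0 \<and> (\<forall>s. prime s \<longrightarrow> s \<notin> P \<longrightarrow> multiplicity s e = multiplicity s L)) \<and>
      (real q ^ L - 1) / real (norm_lcm L P) =
        real q powr (real L * (\<Prod>p\<in>P. 1 - 1 / real p)) * (\<Prod>e\<in>E. 1 - 1 / real q ^ e) / (\<Prod>e\<in>D. 1 - 1 / real q ^ e)"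
  using assms
proof (induction P arbitrary: L rule: finite_induct)
  case empty
  have "real q ^ L - 1 = real q powr real L * (1 - 1 / real q ^ L)"
    using q2 by (simp add: powr_realpow field_simps)
  thus ?case using empty by (intro exI[of _ "{L}"] exI[of _ "{}"]) (auto simp: norm_lcm_def)
next
  case (insert r P)
  have r: "prime r" "r dvd L" using insert.prems by auto
  have r0: "r > 0" using r(1) prime_gt_0_nat by auto
  obtain E D where ED: "finite E" "finite D"
    "\<And>e s. e \<in> E \<union> D \<Longrightarrow> e > 0 \<and> (prime s \<longrightarrow> s \<notin> P \<longrightarrow> multiplicity s e = multiplicity s L)"
    "(real q ^ L - 1) / real (norm_lcm L P) =
        real q powr (real L * (\<Prod>p\<in>P. 1 - 1 / real p)) * (\<Prod>e\<in>E. 1 - 1 / real q ^ e) / (\<Prod>e\<in>D. 1 - 1 / real q ^ e)"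
    using insert.IH[of L] insert.prems by auto
  define K where "K = L div r"
  have LK: "L = r * K" using r by (simp add: K_def)
  have K0: "K > 0" using insert.prems LK by (cases K) auto
  have PK: "prime p \<and> p dvd K" if "p \<in> P" for p
  proof -
    have "prime p" "p dvd L" "p \<noteq> r" using that insert.prems insert.hyps by auto
    thus ?thesis using r by (simp add: LK prime_dvd_mult_iff primes_dvd_imp_eq) (metis primes_dvd_imp_eq)
  qed
  obtain E' D' where ED': "finite E'" "finite D'"
    "\<And>e s. e \<in> E' \<union> D' \<Longrightarrow> e > 0 \<and> (prime s \<longrightarrow> s \<notin> P \<longrightarrow> multiplicity s e = multiplicity s K)"
    "(real q ^ K - 1) / real (norm_lcm K P) =
        real q powr (real K * (\<Prod>p\<in>P. 1 - 1 / real p)) * (\<Prod>e\<in>E'. 1 - 1 / real q ^ e) / (\<Prod>e\<in>D'. 1 - 1 / real q ^ e)"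
    using insert.IH[of K] K0 PK by auto
  have mult_r: "multiplicity r L = Suc (multiplicity r K)"
    using r K0 by (simp add: LK prime_elem_multiplicity_mult_distrib)
  have mult_s: "multiplicity s L = multiplicity s K" if "prime s" "s \<noteq> r" for s
  proof -
    have "multiplicity s r = 0" using that r by (simp add: prime_multiplicity_other)
    thus ?thesis using that r0 K0 by (simp add: LK prime_elem_multiplicity_mult_distrib)
  qed
  have disj: "(E \<union> D) \<inter> (E' \<union> D') = {}"
  proof (rule ccontr)
    assume "(E \<union> D) \<inter> (E' \<union> D') \<noteq> {}"
    then obtain e where e: "e \<in> E \<union> D" "e \<in> E' \<union> D'" by blast
    have "multiplicity r e = multiplicity r L" using ED(3)[OF e(1), of r] r insert.hyps by simp
    moreover have "multiplicity r e = multiplicity r K" using ED'(3)[OF e(2), of r] r insert.hyps by simp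
    ultimately show False using mult_r by simp
  qed
  have m1: "norm_lcm L P > 0" "norm_lcm K P > 0" "norm_lcm L (insert r P) > 0"
    using insert.prems insert.hyps K0 PK by (intro norm_lcm_pos; auto)+
  have qK: "real q ^ K > 1" using K0 q2 by (intro one_less_power) auto
  have "norm_lcm L (insert r P) * norm_lcm K P = (q ^ K - 1) * norm_lcm L P"
    unfolding K_def using insert.hyps insert.prems by (intro norm_lcm_insert) auto
  moreover have "real (q ^ K - 1) = real q ^ K - 1" using q2 by (simp add: of_nat_diff)
  ultimately have "real (norm_lcm L (insert r P)) * real (norm_lcm K P) = (real q ^ K - 1) * real (norm_lcm L P)"
    by (metis of_nat_mult)
  hence "(real q ^ L - 1) / real (norm_lcm L (insert r P)) = ((real q ^ L - 1) / real (norm_lcm L P)) / ((real q ^ K - 1) / real (norm_lcm K P))"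
    using m1 qK by (intro quotient_swap) auto
  also have "\<dots> = real q powr (real L * (\<Prod>p\<in>P. 1 - 1 / real p) - real K * (\<Prod>p\<in>P. 1 - 1 / real p)) *
      ((\<Prod>e\<in>E. 1 - 1 / real q ^ e) * (\<Prod>e\<in>D'. 1 - 1 / real q ^ e)) / ((\<Prod>e\<in>D. 1 - 1 / real q ^ e) * (\<Prod>e\<in>E'. 1 - 1 / real q ^ e))"
    unfolding ED(4) ED'(4) powr_diff by (simp add: divide_inverse mult_ac)
  also have "real L * (\<Prod>p\<in>P. 1 - 1 / real p) - real K * (\<Prod>p\<in>P. 1 - 1 / real p) = real L * (\<Prod>p\<in>insert r P. 1 - 1 / real p)"
    using insert.hyps r0 by (simp add: LK field_simps)
  also have "(\<Prod>e\<in>E. 1 - 1 / real q ^ e) * (\<Prod>e\<in>D'. 1 - 1 / real q ^ e) = (\<Prod>e\<in>E \<union> D'. 1 - 1 / real q ^ e)"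
    using disj ED ED' by (intro prod.union_disjoint[symmetric]) auto
  also have "(\<Prod>e\<in>D. 1 - 1 / real q ^ e) * (\<Prod>e\<in>E'. 1 - 1 / real q ^ e) = (\<Prod>e\<in>D \<union> E'. 1 - 1 / real q ^ e)"
    using disj ED ED' by (intro prod.union_disjoint[symmetric]) auto
  finally have fin: "(real q ^ L - 1) / real (norm_lcm L (insert r P)) = real q powr (real L * (\<Prod>p\<in>insert r P. 1 - 1 / real p)) *
     (\<Prod>e\<in>E \<union> D'. 1 - 1 / real q ^ e) / (\<Prod>e\<in>D \<union> E'. 1 - 1 / real q ^ e)" .
  have "e > 0 \<and> (\<forall>s. prime s \<longrightarrow> s \<notin> insert r P \<longrightarrow> multiplicity s e = multiplicity s L)"
    if e: "e \<in> (E \<union> D') \<union> (D \<union> E')" for e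
  proof (cases "e \<in> E \<union> D")
    case True
    thus ?thesis using ED(3) by auto
  next
    case False
    hence "e \<in> E' \<union> D'" using e by auto
    thus ?thesis using ED'(3) mult_s by auto
  qed
  thus ?case using ED(1,2) ED'(1,2) fin by (intro exI[of _ "E \<union> D'"] exI[of _ "D \<union> E'"]) auto
qed

text \<open>The exponents in \<open>E\<close> are distinct, so their product is at least the full
  one over \<open>1..k\<close>; the factors in the denominator are at most 1 and only help.\<close>

lemma norm_lcm_bound:
  assumes L: "L > 0"
  shows "real q ^ totient L * (1 - 1 / real q - 1 / (real q)\<^sup>2) \<le> (real q ^ L - 1) / real (norm_lcm L (prime_factors L))"
proof -
  obtain E D where ED: "finite E" "finite D" "\<And>e. e \<in> E \<union> D \<Longrightarrow> e > 0"
    "(real q ^ L - 1) / real (norm_lcm L (prime_factors L)) =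
       real q powr (real L * (\<Prod>p\<in>prime_factors L. 1 - 1 / real p)) * (\<Prod>e\<in>E. 1 - 1 / real q ^ e) / (\<Prod>e\<in>D. 1 - 1 / real q ^ e)"
    using norm_lcm_product_formula[of "prime_factors L" L] L by (auto simp: in_prime_factors_iff)
  have pos: "0 < 1 - 1 / real q ^ e" "1 - 1 / real q ^ e \<le> 1" if "e > 0" for e
  proof -
    have "real q ^ e > 1" using that q2 by (intro one_less_power) auto
    thus "0 < 1 - 1 / real q ^ e" "1 - 1 / real q ^ e \<le> 1" using q2 by (simp_all add: divide_less_eq_1)
  qed
  define k where "k = Max (insert 1 E)"
  have Ek: "E \<subseteq> {1..k}" using ED(1,3) by (force simp: k_def)
  have "(\<Prod>e\<in>{1..k}. 1 - 1 / real q ^ e) = (\<Prod>e\<in>E. 1 - 1 / real q ^ e) * (\<Prod>e\<in>{1..k} - E. 1 - 1 / real q ^ e)"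
    using prod.subset_diff[OF Ek, of "\<lambda>e. 1 - 1 / real q ^ e"] by (simp add: mult.commute)
  also have "\<dots> \<le> (\<Prod>e\<in>E. 1 - 1 / real q ^ e) * 1"
    using ED(3) less_imp_le[OF pos(1)] pos(2)
    by (intro mult_left_mono prod_le_1 prod_nonneg conjI) (force simp del: diff_ge_0_iff_ge)+
  finally have "(\<Prod>e\<in>{1..k}. 1 - 1 / real q ^ e) \<le> (\<Prod>e\<in>E. 1 - 1 / real q ^ e)" by simp
  with prod_one_minus_power_ge[of "real q" k] q2
  have E1: "1 - 1 / real q - 1 / (real q)\<^sup>2 \<le> (\<Prod>e\<in>E. 1 - 1 / real q ^ e)" by simp
  have D0: "(\<Prod>e\<in>D. 1 - 1 / real q ^ e) > 0" using ED pos by (intro prod_pos) auto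
  have D1: "(\<Prod>e\<in>D. 1 - 1 / real q ^ e) \<le> 1" using ED pos less_imp_le[OF pos(1)] by (intro prod_le_1) blast
  have E0: "(\<Prod>e\<in>E. 1 - 1 / real q ^ e) > 0" using ED pos by (intro prod_pos) auto
  have "real q ^ totient L * (1 - 1 / real q - 1 / (real q)\<^sup>2) \<le> real q ^ totient L * (\<Prod>e\<in>E. 1 - 1 / real q ^ e)"
    using E1 by (intro mult_left_mono) auto
  also have "\<dots> \<le> real q ^ totient L * (\<Prod>e\<in>E. 1 - 1 / real q ^ e) / (\<Prod>e\<in>D. 1 - 1 / real q ^ e)"
    using D0 D1 E0 by (subst pos_le_divide_eq) (auto intro!: mult_left_le)
  finally have "real q ^ totient L * (1 - 1 / real q - 1 / (real q)\<^sup>2) \<le>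
    real q ^ totient L * (\<Prod>e\<in>E. 1 - 1 / real q ^ e) / (\<Prod>e\<in>D. 1 - 1 / real q ^ e)" .
  moreover have "real q powr (real L * (\<Prod>p\<in>prime_factors L. 1 - 1 / real p)) = real q ^ totient L"
    using totient_formula2[of L] q2 by (subst powr_realpow[symmetric]) auto
  ultimately show ?thesis unfolding ED(4) by simp
qed

text \<open>A proper divisor of \<open>L\<close> divides \<open>L div p\<close> for some prime
  \<open>p\<close>.\<close>

lemma Lcm_dvd_norm_lcm:
  assumes "L > 0" "\<And>i. i \<in> I \<Longrightarrow> d i dvd L \<and> d i < L"
  shows "Lcm ((\<lambda>i. q ^ d i - 1) ` I) dvd norm_lcm L (prime_factors L)"
proof (rule Lcm_least)
  fix b assume "b \<in> (\<lambda>i. q ^ d i - 1) ` I"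
  then obtain i where i: "i \<in> I" "b = q ^ d i - 1" by auto
  have d: "d i dvd L" "d i < L" using assms(2)[OF i(1)] by auto
  then obtain c where c: "L = d i * c" by (elim dvdE)
  have "c \<noteq> 1" using c d by auto
  then obtain p where p: "prime p" "p dvd c" using prime_factor_nat by blast
  then obtain c' where c': "c = p * c'" by (elim dvdE)
  have "L div p = d i * c'" using p prime_gt_0_nat[of p] by (simp add: c c')
  hence "b dvd q ^ (L div p) - 1" unfolding i(2) using diff_1_dvd_power_diff_1[of "q ^ d i" c'] by (simp add: power_mult)
  also have "\<dots> dvd norm_lcm L (prime_factors L)" unfolding norm_lcm_def
    using p assms(1) c by (intro dvd_Lcm imageI) (auto simp: in_prime_factors_iff)
  finally show "b dvd norm_lcm L (prime_factors L)" .
qed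

lemma quotient_bound:
  assumes L: "L > 0" "L dvd n" and d: "\<And>i. i \<in> I \<Longrightarrow> d i dvd L \<and> d i < L" and n: "n > 0"
    and c: "c \<ge> 0" "c \<le> (real q ^ L - 1) / real (norm_lcm L (prime_factors L))"
  shows "real q ^ (n - L) * c \<le> real ((q ^ n - 1) div Lcm ((\<lambda>i. q ^ d i - 1) ` I))"
proof -
  define m where "m = Lcm ((\<lambda>i. q ^ d i - 1) ` I)"
  have Ln: "L \<le> n" using L n by (simp add: dvd_imp_le)
  have "m dvd q ^ n - 1" unfolding m_def
  proof (rule Lcm_least)
    fix b assume "b \<in> (\<lambda>i. q ^ d i - 1) ` I"
    then obtain i where i: "i \<in> I" "b = q ^ d i - 1" by auto
    obtain c' where "n = d i * c'" using d[OF i(1)] L(2) dvd_trans by (metis dvdE)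
    thus "b dvd q ^ n - 1" using diff_1_dvd_power_diff_1[of "q ^ d i" c'] by (simp add: i power_mult)
  qed
  then obtain k where k: "q ^ n - 1 = m * k" by (elim dvdE)
  have qn: "q ^ n > 1" using q2 n by (intro one_less_power) auto
  have m0: "m > 0" using k qn by (intro Nat.gr0I) auto
  have mm0: "norm_lcm L (prime_factors L) > 0" using L by (intro norm_lcm_pos) (auto simp: in_prime_factors_iff)
  have le: "m \<le> norm_lcm L (prime_factors L)" unfolding m_def using Lcm_dvd_norm_lcm[OF L(1) d, of I] mm0 by (intro dvd_imp_le) auto
  have qL: "real q ^ L > 1" using q2 L by (intro one_less_power) auto
  have "real q ^ (n - L) * c \<le> real q ^ (n - L) * ((real q ^ L - 1) / real m)"
  proof -
    have "(real q ^ L - 1) / real (norm_lcm L (prime_factors L)) \<le> (real q ^ L - 1) / real m"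
      using le m0 qL by (intro divide_left_mono) auto
    thus ?thesis using c by (intro mult_left_mono) auto
  qed
  also have "\<dots> = (real q ^ n - real q ^ (n - L)) / real m"
    using Ln by (simp add: right_diff_distrib power_add[symmetric])
  also have "\<dots> \<le> (real q ^ n - 1) / real m"
    using q2 by (intro divide_right_mono) auto
  also have "real q ^ n - 1 = real (q ^ n - 1)" using qn by (simp add: of_nat_diff)
  also have "\<dots> / real m = real ((q ^ n - 1) div m)" using m0 unfolding k by simp
  finally show ?thesis by (simp add: m_def)
qed

text \<open>The left side is Phi_6(q). The general factor \<open>1 - 1/q - 1/q^2\<close> is too
  lossy for \<open>n = 12\<close>, and for \<open>n = 18\<close> with \<open>q = 2\<close>.\<close>

lemma norm_lcm_6: "real q ^ 2 - real q + 1 \<le> (real q ^ 6 - 1) / real (norm_lcm 6 (prime_factors 6))"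
proof -
  have p6: "prime_factors (6 :: nat) = {2, 3}"
  proof -
    have "prime_factors (6 :: nat) = prime_factors 2 \<union> prime_factors 3"
      using prime_factors_product[of "2 :: nat" 3] by simp
    thus ?thesis by (auto simp: prime_prime_factors)
  qed
  have "lcm (q ^ 3 - 1) (q ^ 2 - 1) * (q - 1) = (q ^ 3 - 1) * (q ^ 2 - 1)"
    using gcd_power_minus_1[of q 3 2] q2 lcm_mult_gcd[of "q ^ 3 - 1" "q ^ 2 - 1"] by (simp add: gcd_non_0_nat)
  hence "real (lcm (q ^ 3 - 1) (q ^ 2 - 1)) * real (q - 1) = real (q ^ 3 - 1) * real (q ^ 2 - 1)"
    by (metis of_nat_mult)
  hence "real (lcm (q ^ 3 - 1) (q ^ 2 - 1)) * (real q - 1) = (real q ^ 3 - 1) * (real q ^ 2 - 1)"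
    using q2 by (simp add: of_nat_diff)
  moreover have "norm_lcm 6 (prime_factors 6) = lcm (q ^ 3 - 1) (q ^ 2 - 1)" by (simp add: norm_lcm_def p6)
  ultimately have m: "real (norm_lcm 6 (prime_factors 6)) * (real q - 1) = (real q ^ 3 - 1) * (real q ^ 2 - 1)" by simp
  have q1: "real q - 1 > 0" using q2 by simp
  have "real (norm_lcm 6 (prime_factors 6)) > 0" using norm_lcm_pos[of "prime_factors 6" 6] by (simp add: in_prime_factors_iff)
  moreover have "(real q ^ 2 - real q + 1) * real (norm_lcm 6 (prime_factors 6)) * (real q - 1) = (real q ^ 6 - 1) * (real q - 1)"
  proof -
    have "(x ^ 2 - x + 1) * ((x ^ 3 - 1) * (x ^ 2 - 1)) = (x ^ 6 - 1) * (x - 1)" for x :: real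
      by (simp add: algebra_simps eval_nat_numeral)
    thus ?thesis unfolding mult.assoc m .
  qed
  hence "(real q ^ 2 - real q + 1) * real (norm_lcm 6 (prime_factors 6)) = real q ^ 6 - 1" using q1 by simp
  ultimately show ?thesis by (simp add: pos_le_divide_eq)
qed

end

lemma norm_lcm_dvd:
  assumes q2: "q \<ge> 2" and L0: "L > 0" and Ln: "L dvd n"
  shows "norm_lcm q L (prime_factors L) dvd q ^ n - 1"
  unfolding norm_lcm_def[OF q2]
proof (rule Lcm_least)
  fix b assume "b \<in> (\<lambda>p. q ^ (L div p) - 1) ` prime_factors L"
  then obtain p where p: "p dvd L" "b = q ^ (L div p) - 1" by (auto simp: in_prime_factors_iff)
  have "L = p * (L div p)" using p(1) by simp
  hence "L div p dvd L" by (metis dvd_triv_right)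
  then obtain c where "n = (L div p) * c" using Ln by (meson dvd_trans dvdE)
  thus "b dvd q ^ n - 1" using diff_1_dvd_power_diff_1[of "q ^ (L div p)" c] by (simp add: p(2) power_mult)
qed

section \<open>A common solution of the norm equations\<close>

context field_ext
begin

text \<open>With discrete logarithms to a generator \<open>g\<close>, the equations read
  \<open>x = s i\<close> modulo \<open>q ^ d i - 1\<close>, and compatibility of the norms becomes
  congruence modulo \<open>q ^ gcd (d i) (d j) - 1\<close>, which is the gcd of the two
  moduli.\<close>

lemma ex_common_norm_preimage:
  fixes a :: "'i \<Rightarrow> 'a"
  assumes I: "finite I" and d: "\<And>i. i \<in> I \<Longrightarrow> d i dvd n" and a: "\<And>i. i \<in> I \<Longrightarrow> a i \<in> GF q (d i) - {0}"
    and compat: "\<And>i j. i \<in> I \<Longrightarrow> j \<in> I \<Longrightarrow>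
       norm_GF q (d i) (gcd (d i) (d j)) (a i) = norm_GF q (d j) (gcd (d i) (d j)) (a j)"
  shows "\<exists>\<alpha> :: 'a. \<alpha> \<noteq> 0 \<and> (\<forall>i\<in>I. norm_GF q n (d i) \<alpha> = a i)"
proof -
  define N where "N = q ^ n - 1"
  have N0: "N > 0" using qn_gt_1 by (simp add: N_def)
  obtain g :: 'a where g: "g \<noteq> 0" "\<And>x. x \<noteq> 0 \<Longrightarrow> \<exists>i::nat. x = g ^ i"
    using finite_field_primitive_root by blast
  have gN: "g ^ N = 1" unfolding N_def by (rule pow_qn_minus_1[OF g(1)])
  have ord: "N dvd i" if "g ^ i = 1" for i
  proof (rule ccontr)
    assume "\<not> N dvd i"
    hence r0: "i mod N > 0" by (simp add: mod_greater_zero_iff_not_dvd)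
    have "g ^ i = (g ^ N) ^ (i div N) * g ^ (i mod N)" by (simp flip: power_mult power_add)
    hence gr: "g ^ (i mod N) = 1" using that gN by simp
    have "UNIV - {0 :: 'a} \<subseteq> {x. x ^ (i mod N) = 1}"
    proof
      fix x :: 'a assume "x \<in> UNIV - {0}"
      then obtain j where "x = g ^ j" using g(2) by auto
      hence "x ^ (i mod N) = (g ^ (i mod N)) ^ j" by (simp flip: power_mult add: mult.commute)
      thus "x \<in> {x. x ^ (i mod N) = 1}" by (simp add: gr)
    qed
    hence "card (UNIV - {0 :: 'a}) \<le> card {x :: 'a. x ^ (i mod N) = 1}" by (intro card_mono) auto
    also have "\<dots> \<le> i mod N" by (rule card_roots_unity_le[OF r0])
    also have "\<dots> < N" using N0 by simp
    also have "N = card (UNIV - {0 :: 'a})" using card by (simp add: N_def card_Diff_singleton)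
    finally show False by simp
  qed
  have gcong: "[i = j] (mod N)" if "g ^ i = g ^ j" for i j
    using that
  proof (induction i j rule: linorder_wlog)
    case (le i j)
    have "g ^ j = g ^ (i + (j - i))" using le by simp
    hence "g ^ j = g ^ i * g ^ (j - i)" by (simp only: power_add)
    hence "g ^ (j - i) = 1" using le g(1) by simp
    hence "N dvd j - i" by (rule ord)
    thus ?case using le by (simp add: cong_altdef_nat cong_sym_eq[of i])
  qed (simp add: cong_sym_eq)
  have gcong': "g ^ i = g ^ j" if "[i = j] (mod N)" for i j
    using that
  proof (induction i j rule: linorder_wlog)
    case (le i j)
    hence "N dvd j - i" by (simp add: cong_altdef_nat cong_sym_eq[of i])
    then obtain k where "j - i = N * k" by (elim dvdE)
    hence "j = i + N * k" using le by simp
    thus ?case by (simp add: power_add power_mult gN)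
  qed (simp add: cong_sym_eq)
  have d0: "d i > 0" if "i \<in> I" for i using d[OF that] n by (intro Nat.gr0I) auto
  have dv: "q ^ e - 1 dvd q ^ m - 1" if "e dvd m" for e m
    using that diff_1_dvd_power_diff_1[of "q ^ e"] by (auto simp: power_mult)
  define M where "M i = N div (q ^ d i - 1)" for i
  have M: "N = (q ^ d i - 1) * M i" if "i \<in> I" for i
    using dv[OF d[OF that]] by (simp add: M_def N_def)
  have qd: "q ^ e - 1 > 0" if "e > 0" for e using one_less_power[OF q_gt_1 that] by simp
  \<comment> \<open>Since \<open>a i\<close> lies in \<open>GF q (d i)\<close>, its exponent times
    \<open>q ^ d i - 1\<close> is divisible by \<open>N\<close>, so the exponent is a multiple of
    \<open>M i\<close>.\<close>
  have "\<exists>s. a i = g ^ (M i * s)" if i: "i \<in> I" for i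
  proof -
    obtain e where e: "a i = g ^ e" using g(2) a[OF i] by blast
    have "a i * a i ^ (q ^ d i - 1) = a i * 1"
      using a[OF i] power_minus_mult[of "q ^ d i" "a i"] q_gt_1 by (simp add: GF_def mult.commute)
    hence "a i ^ (q ^ d i - 1) = 1" using a[OF i] by (subst (asm) mult_cancel_left) auto
    hence "g ^ (e * (q ^ d i - 1)) = 1" by (simp add: e power_mult)
    from ord[OF this] have "M i * (q ^ d i - 1) dvd e * (q ^ d i - 1)"
      using M[OF i] by (simp add: mult.commute)
    hence "M i dvd e" using qd[OF d0[OF i]] by (simp del: One_nat_def)
    thus ?thesis using e by (auto elim!: dvdE)
  qed
  then obtain s where s: "\<And>i. i \<in> I \<Longrightarrow> a i = g ^ (M i * s i)" by metis
  have "\<exists>x. \<forall>i\<in>I. [x = s i] (mod (q ^ d i - 1))"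
  proof (rule generalized_chinese_remainder[OF I])
    show "q ^ d i - 1 > 0" if "i \<in> I" for i using qd d0 that by blast
    fix i j assume ij: "i \<in> I" "j \<in> I"
    define e where "e = gcd (d i) (d j)"
    have e0: "e > 0" using d0[OF ij(1)] by (simp add: e_def)
    have en: "e dvd n" using d[OF ij(1)] by (auto simp: e_def intro: dvd_trans)
    have Ne: "N = (q ^ e - 1) * (N div (q ^ e - 1))" using dv[OF en] by (simp add: N_def)
    have nrm: "norm_GF q (d l) e (a l) = g ^ (s l * (N div (q ^ e - 1)))" if l: "l \<in> I" "e dvd d l" for l
    proof -
      have "M l * ((q ^ d l - 1) div (q ^ e - 1)) = N div (q ^ e - 1)"
        unfolding M[OF l(1)] using div_mult_swap[OF dv[OF l(2)], of "M l"] by (simp add: mult.commute)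
      hence "(M l * s l) * ((q ^ d l - 1) div (q ^ e - 1)) = s l * (N div (q ^ e - 1))"
        by (simp add: mult_ac)
      thus ?thesis unfolding norm_GF_def s[OF l(1)] power_mult[symmetric] by (simp only:)
    qed
    have "g ^ (s i * (N div (q ^ e - 1))) = g ^ (s j * (N div (q ^ e - 1)))"
      using compat[OF ij] nrm[OF ij(1)] nrm[OF ij(2)] by (simp add: e_def)
    hence c: "[s i * (N div (q ^ e - 1)) = s j * (N div (q ^ e - 1))] (mod (q ^ e - 1) * (N div (q ^ e - 1)))"
      using gcong Ne by simp
    have "N div (q ^ e - 1) > 0" using Ne N0 by (intro Nat.gr0I) auto
    hence "[s i = s j] (mod (q ^ e - 1))"
      using c by (simp add: cong_def mult_mod_left[symmetric] del: One_nat_def)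
    moreover have "q > 0" using q_gt_1 by simp
    ultimately show "[s i = s j] (mod gcd (q ^ d i - 1) (q ^ d j - 1))"
      by (simp only: gcd_power_minus_1 e_def)
  qed
  then obtain x where x: "\<And>i. i \<in> I \<Longrightarrow> [x = s i] (mod (q ^ d i - 1))" by blast
  have "norm_GF q n (d i) (g ^ x) = a i" if i: "i \<in> I" for i
  proof -
    have "[M i * x = M i * s i] (mod (M i * (q ^ d i - 1)))" using x[OF i] by (simp add: cong_def mult_mod_right[symmetric] del: One_nat_def)
    hence "[M i * x = M i * s i] (mod N)" by (subst M[OF i]) (simp add: mult.commute)
    hence "g ^ (M i * x) = a i" using gcong' s[OF i] by simp
    moreover have "norm_GF q n (d i) (g ^ x) = g ^ (M i * x)"
      unfolding norm_GF_def M_def N_def power_mult[symmetric] by (simp only: mult.commute)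
    ultimately show ?thesis by simp
  qed
  thus ?thesis using g(1) by (intro exI[of _ "g ^ x"]) auto
qed

end

section \<open>Numerical estimates\<close>

text \<open>As \<open>L\<close> is at least its radical, \<open>totient L ^ 4 / L ^ 3\<close> is at
  least the product of the \<open>p * (1 - 1/p) ^ 4\<close>. Only \<open>p = 2\<close> and
  \<open>p = 3\<close> give factors below 1, namely 1/8 and 16/27.\<close>

lemma totient_power4_ge:
  assumes "L > 0"
  shows "27 * totient L ^ 4 \<ge> 2 * L ^ 3"
proof -
  define S where "S = prime_factors L"
  define g where "g p = real p * (1 - 1 / real p) ^ 4" for p :: nat
  have fin: "finite S" by (simp add: S_def)
  have pr: "prime p" if "p \<in> S" for p using that by (auto simp: S_def in_prime_factors_iff)
  have g0: "g p > 0" if "prime p" for p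
    using prime_gt_1_nat[OF that] by (simp add: g_def)
  have g5: "g p \<ge> 1" if "prime p" "p \<noteq> 2" "p \<noteq> 3" for p
  proof -
    have "p \<noteq> 4" using that(1) by auto
    hence p5: "p \<ge> 5" using that prime_ge_2_nat[of p] by presburger
    hence "(1 - 1 / real p) ^ 4 \<ge> (4 / 5) ^ 4" by (intro power_mono) (auto simp: field_simps)
    hence "g p \<ge> 5 * (4 / 5) ^ 4" unfolding g_def using p5 by (intro mult_mono) auto
    thus ?thesis by (simp add: power_divide)
  qed
  have "(\<Prod>p\<in>S. g p) = (\<Prod>p\<in>S \<inter> {2, 3}. g p) * (\<Prod>p\<in>S - {2, 3}. g p)"
    using fin by (rule prod.Int_Diff)
  moreover have "(\<Prod>p\<in>S - {2, 3}. g p) \<ge> 1" using g5 pr by (intro prod_ge_1) auto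
  moreover have "(\<Prod>p\<in>S \<inter> {2, 3}. g p) \<ge> 2 / 27"
  proof -
    have "S \<inter> {2, 3} = {} \<or> S \<inter> {2, 3} = {2} \<or> S \<inter> {2, 3} = {3} \<or> S \<inter> {2, 3} = {2, 3}" by blast
    thus ?thesis by (elim disjE) (simp_all add: g_def power_divide)
  qed
  ultimately have gS: "(\<Prod>p\<in>S. g p) \<ge> 2 / 27"
    using mult_mono[of "2 / 27" "\<Prod>p\<in>S \<inter> {2, 3}. g p" 1 "\<Prod>p\<in>S - {2, 3}. g p"] by simp
  have rad: "(\<Prod>p\<in>S. real p) \<le> real L"
  proof -
    have "(\<Prod>p\<in>S. p) \<le> (\<Prod>p\<in>S. p ^ multiplicity p L)"
    proof (intro prod_mono conjI)
      fix p assume p: "p \<in> S"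
      have "multiplicity p L \<ge> 1" using p by (auto simp: S_def prime_factors_multiplicity)
      thus "p \<le> p ^ multiplicity p L" using prime_gt_0_nat[OF pr[OF p]] by (intro self_le_power) auto
    qed simp
    also have "\<dots> = L" unfolding S_def using prod_prime_factors[of L] assms by simp
    finally have "real (\<Prod>p\<in>S. p) \<le> real L" by (rule of_nat_mono)
    thus ?thesis by simp
  qed
  have tot: "real (totient L) = real L * (\<Prod>p\<in>S. 1 - 1 / real p)"
    unfolding S_def by (rule totient_formula2)
  have "real L ^ 3 * (2 / 27) \<le> real L ^ 3 * (\<Prod>p\<in>S. g p)" using gS by (intro mult_left_mono) auto
  also have "(\<Prod>p\<in>S. g p) = (\<Prod>p\<in>S. real p) * (\<Prod>p\<in>S. 1 - 1 / real p) ^ 4"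
    by (simp add: g_def prod.distrib prod_power_distrib)
  also have "real L ^ 3 * \<dots> \<le> real L ^ 3 * (real L * (\<Prod>p\<in>S. 1 - 1 / real p) ^ 4)"
    using rad by (intro mult_left_mono mult_right_mono) auto
  also have "\<dots> = real (totient L) ^ 4" unfolding tot by (simp add: power_mult_distrib eval_nat_numeral)
  finally have "real (2 * L ^ 3) \<le> real (27 * totient L ^ 4)" by simp
  thus ?thesis by (simp only: of_nat_le_iff)
qed

lemma totient_prime_mult:
  assumes "prime p"
  shows "totient (p * m) = (if p dvd m then p else p - 1) * totient m"
proof (cases "p dvd m")
  case True
  have "totient (p * m) * totient p = totient p * totient m * p"
    using totient_gcd[of p m] True by (simp add: gcd_nat.absorb1)
  moreover have "totient p > 0" using prime_gt_0_nat[OF assms] by simp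
  ultimately show ?thesis using True by simp
next
  case False
  hence "coprime p m" using assms by (simp add: prime_imp_coprime)
  thus ?thesis using False totient_prime[OF assms] by (simp add: totient_mult_coprime)
qed

text \<open>The table stops at 88 because from 89 on the fourth-power bound gives
  \<open>totient L >= 16\<close>.\<close>

lemma totient_table:
  "\<forall>L\<in>set [7..<89]. totient L \<ge> 4 \<and> (L \<ge> 13 \<longrightarrow> totient L \<ge> 6) \<and> (L \<ge> 19 \<longrightarrow> totient L \<ge> 8) \<and>
     (L \<ge> 31 \<longrightarrow> totient L \<ge> 12) \<and> (L \<ge> 43 \<longrightarrow> totient L \<ge> 16)"
  by (simp add:
    totient_prime[of 2, simplified] totient_prime[of 3, simplified] totient_prime[of 5, simplified]
    totient_prime[of 7, simplified] totient_prime[of 11, simplified] totient_prime[of 13, simplified]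
    totient_prime[of 17, simplified] totient_prime[of 19, simplified] totient_prime[of 23, simplified]
    totient_prime[of 29, simplified] totient_prime[of 31, simplified] totient_prime[of 37, simplified]
    totient_prime[of 41, simplified] totient_prime[of 43, simplified] totient_prime[of 47, simplified]
    totient_prime[of 53, simplified] totient_prime[of 59, simplified] totient_prime[of 61, simplified]
    totient_prime[of 67, simplified] totient_prime[of 71, simplified] totient_prime[of 73, simplified]
    totient_prime[of 79, simplified] totient_prime[of 83, simplified]
    totient_prime_mult[of 2 2, simplified] totient_prime_mult[of 2 3, simplified]
    totient_prime_mult[of 2 4, simplified] totient_prime_mult[of 3 3, simplified]
    totient_prime_mult[of 2 5, simplified] totient_prime_mult[of 2 6, simplified]
    totient_prime_mult[of 2 7, simplified] totient_prime_mult[of 3 5, simplified]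
    totient_prime_mult[of 2 8, simplified] totient_prime_mult[of 2 9, simplified]
    totient_prime_mult[of 2 10, simplified] totient_prime_mult[of 3 7, simplified]
    totient_prime_mult[of 2 11, simplified] totient_prime_mult[of 2 12, simplified]
    totient_prime_mult[of 5 5, simplified] totient_prime_mult[of 2 13, simplified]
    totient_prime_mult[of 3 9, simplified] totient_prime_mult[of 2 14, simplified]
    totient_prime_mult[of 2 15, simplified] totient_prime_mult[of 2 16, simplified]
    totient_prime_mult[of 3 11, simplified] totient_prime_mult[of 2 17, simplified]
    totient_prime_mult[of 5 7, simplified] totient_prime_mult[of 2 18, simplified]
    totient_prime_mult[of 2 19, simplified] totient_prime_mult[of 3 13, simplified]
    totient_prime_mult[of 2 20, simplified] totient_prime_mult[of 2 21, simplified]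
    totient_prime_mult[of 2 22, simplified] totient_prime_mult[of 3 15, simplified]
    totient_prime_mult[of 2 23, simplified] totient_prime_mult[of 2 24, simplified]
    totient_prime_mult[of 7 7, simplified] totient_prime_mult[of 2 25, simplified]
    totient_prime_mult[of 3 17, simplified] totient_prime_mult[of 2 26, simplified]
    totient_prime_mult[of 2 27, simplified] totient_prime_mult[of 5 11, simplified]
    totient_prime_mult[of 2 28, simplified] totient_prime_mult[of 3 19, simplified]
    totient_prime_mult[of 2 29, simplified] totient_prime_mult[of 2 30, simplified]
    totient_prime_mult[of 2 31, simplified] totient_prime_mult[of 3 21, simplified]
    totient_prime_mult[of 2 32, simplified] totient_prime_mult[of 5 13, simplified]
    totient_prime_mult[of 2 33, simplified] totient_prime_mult[of 2 34, simplified]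
    totient_prime_mult[of 3 23, simplified] totient_prime_mult[of 2 35, simplified]
    totient_prime_mult[of 2 36, simplified] totient_prime_mult[of 2 37, simplified]
    totient_prime_mult[of 3 25, simplified] totient_prime_mult[of 2 38, simplified]
    totient_prime_mult[of 7 11, simplified] totient_prime_mult[of 2 39, simplified]
    totient_prime_mult[of 2 40, simplified] totient_prime_mult[of 3 27, simplified]
    totient_prime_mult[of 2 41, simplified] totient_prime_mult[of 2 42, simplified]
    totient_prime_mult[of 5 17, simplified] totient_prime_mult[of 2 43, simplified]
    totient_prime_mult[of 3 29, simplified] totient_prime_mult[of 2 44, simplified])

lemma totient_ge:
  assumes "L \<ge> 7"
  shows "totient L \<ge> 4" "L \<ge> 13 \<Longrightarrow> totient L \<ge> 6" "L \<ge> 19 \<Longrightarrow> totient L \<ge> 8"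
    "L \<ge> 31 \<Longrightarrow> totient L \<ge> 12" "L \<ge> 43 \<Longrightarrow> totient L \<ge> 16"
proof -
  have big: "totient L \<ge> 16" if "L \<ge> 89"
  proof (rule ccontr)
    assume "\<not> totient L \<ge> 16"
    hence "27 * totient L ^ 4 \<le> 27 * 15 ^ 4" by (intro mult_left_mono power_mono) auto
    moreover have "2 * 89 ^ 3 \<le> 2 * L ^ 3" using that by (intro mult_left_mono power_mono) auto
    ultimately show False using totient_power4_ge[of L] that by simp
  qed
  show "totient L \<ge> 4" "L \<ge> 13 \<Longrightarrow> totient L \<ge> 6" "L \<ge> 19 \<Longrightarrow> totient L \<ge> 8"
    "L \<ge> 31 \<Longrightarrow> totient L \<ge> 12" "L \<ge> 43 \<Longrightarrow> totient L \<ge> 16"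
  proof -
    have *: "totient L \<ge> 4 \<and> (L \<ge> 13 \<longrightarrow> totient L \<ge> 6) \<and> (L \<ge> 19 \<longrightarrow> totient L \<ge> 8) \<and>
      (L \<ge> 31 \<longrightarrow> totient L \<ge> 12) \<and> (L \<ge> 43 \<longrightarrow> totient L \<ge> 16)"
    proof (cases "L \<ge> 89")
      case True
      thus ?thesis using big by linarith
    next
      case False
      hence "L \<in> set [7..<89]" using assms unfolding set_upt atLeastLessThan_iff by linarith
      thus ?thesis using totient_table by (rule bspec[rotated])
    qed
    show "totient L \<ge> 4" "L \<ge> 13 \<Longrightarrow> totient L \<ge> 6" "L \<ge> 19 \<Longrightarrow> totient L \<ge> 8"
      "L \<ge> 31 \<Longrightarrow> totient L \<ge> 12" "L \<ge> 43 \<Longrightarrow> totient L \<ge> 16" using * by simp_all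
  qed
qed

lemma primepow_small:
  assumes "(L :: nat) > 1" "\<not> primepow L"
  shows "L \<ge> 6" "L \<le> 18 \<Longrightarrow> L \<in> {6, 10, 12, 14, 15, 18}"
proof -
  have pp: "primepow (p ^ k)" if "prime p" "k > 0" for p k :: nat using that by simp
  have ne: "L \<noteq> 2" "L \<noteq> 3" "L \<noteq> 4" "L \<noteq> 5" "L \<noteq> 7" "L \<noteq> 8" "L \<noteq> 9" "L \<noteq> 11" "L \<noteq> 13" "L \<noteq> 16" "L \<noteq> 17"
    using assms(2) pp[of 2 1] pp[of 3 1] pp[of 2 2] pp[of 5 1] pp[of 7 1] pp[of 2 3] pp[of 3 2] pp[of 11 1] pp[of 13 1] pp[of 2 4] pp[of 17 1]
    by auto
  show "L \<ge> 6" using ne(1-4) assms(1) by linarith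
  show "L \<in> {6, 10, 12, 14, 15, 18}" if "L \<le> 18"
  proof -
    have "L = 2 \<or> L = 3 \<or> L = 4 \<or> L = 5 \<or> L = 6 \<or> L = 7 \<or> L = 8 \<or> L = 9 \<or> L = 10 \<or> L = 11 \<or>
      L = 12 \<or> L = 13 \<or> L = 14 \<or> L = 15 \<or> L = 16 \<or> L = 17 \<or> L = 18"
      using assms(1) that by presburger
    thus ?thesis using ne by (elim disjE) simp_all
  qed
qed

section \<open>The exponent gained over the square root of the field size\<close>

locale modulus =
  fixes n L :: nat
  assumes L_dvd: "L dvd n" and L_less: "L < n" and L_gt_1: "L > 1" and L_npp: "\<not> primepow L"
begin

text \<open>
  Up to a constant factor, \<open>q ^ (nu / 2)\<close> is the ratio of the lower bound for \<open>card K\<close> to \<open>q ^ (n / 2)\<close>.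
\<close>

definition nu :: nat where "nu = n - 2 * L + 2 * totient L"

lemma L_ge: "L \<ge> 6" using primepow_small(1)[OF L_gt_1 L_npp] .

lemma n_cases: "n = 2 * L \<or> n \<ge> 3 * L"
proof -
  obtain m where m: "n = L * m" using L_dvd by (elim dvdE)
  have "m \<noteq> 0" "m \<noteq> 1" using m L_less by auto
  hence "m = 2 \<or> m \<ge> 3" by linarith
  thus ?thesis
  proof
    assume "m \<ge> 3"
    hence "L * 3 \<le> L * m" by (rule mult_le_mono2)
    thus ?thesis using m by simp
  qed (use m in simp)
qed

lemma n_ge: "n \<ge> 12" using n_cases L_ge by auto

lemma totient_L: "totient L \<ge> 2"
proof (cases "L = 6")
  case False
  thus ?thesis using totient_ge(1)[of L] L_ge by simp
qed simp

lemma nu_ge3: "n \<noteq> 2 * L \<Longrightarrow> 3 * nu \<ge> n + 6 * totient L"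
  unfolding nu_def using n_cases by auto

text \<open>For \<open>n = 2 * L\<close> one has \<open>nu = 2 * totient L\<close>, and the
  thresholds are those of \<open>totient_ge\<close> (\<open>n >= 13\<close> means
  \<open>L >= 7\<close>, and so on). Otherwise \<open>n >= 3 * L\<close>, and
  \<open>nu >= n/3 + 4\<close> reaches the same values.\<close>

lemma nu_table:
  "n \<ge> 13 \<Longrightarrow> nu \<ge> 8" "n \<ge> 25 \<Longrightarrow> nu \<ge> 12" "n \<ge> 37 \<Longrightarrow> nu \<ge> 16" "n \<ge> 61 \<Longrightarrow> nu \<ge> 24" "n \<ge> 85 \<Longrightarrow> nu \<ge> 32"
proof -
  show "n \<ge> 13 \<Longrightarrow> nu \<ge> 8" "n \<ge> 25 \<Longrightarrow> nu \<ge> 12" "n \<ge> 37 \<Longrightarrow> nu \<ge> 16" "n \<ge> 61 \<Longrightarrow> nu \<ge> 24" "n \<ge> 85 \<Longrightarrow> nu \<ge> 32"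
    using totient_ge[of L] nu_ge3 totient_L unfolding nu_def by (cases "n = 2 * L"; simp)+
qed

text \<open>So \<open>nu\<close> is at least of order \<open>n ^ (3/4)\<close>, while the sieve at
  level \<open>q ^ s\<close> about \<open>sqrt n\<close> asks for an exponent of order
  \<open>sqrt n\<close>.\<close>

lemma nu_power: "27 * nu ^ 4 \<ge> 4 * n ^ 3"
proof (cases "n = 2 * L")
  case True
  have "4 * n ^ 3 = 16 * (2 * L ^ 3)" using True by (simp add: power_mult_distrib)
  also have "\<dots> \<le> 16 * (27 * totient L ^ 4)" using totient_power4_ge[of L] L_ge by (intro mult_left_mono) auto
  also have "\<dots> = 27 * nu ^ 4" unfolding nu_def using True by (simp add: power_mult_distrib)
  finally show ?thesis .
next
  case False
  hence 1: "3 * nu \<ge> n + 12" using nu_ge3 totient_L by linarith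
  have "12 * n ^ 3 \<le> (n + 12) * (n + 12) ^ 3" by (intro mult_mono power_mono) auto
  also have "\<dots> = (n + 12) ^ 4" using power_add[of "n + 12" 1 3] by simp
  also have "\<dots> \<le> (3 * nu) ^ 4" using 1 by (intro power_mono) auto
  also have "\<dots> = 81 * nu ^ 4" by (simp add: power_mult_distrib)
  finally show ?thesis by simp
qed

lemma n_small: "n < 25 \<Longrightarrow> n \<in> {12, 18, 20, 24}" "25 \<le> n \<Longrightarrow> n < 37 \<Longrightarrow> n \<in> {28, 30, 36}" "n = 12 \<Longrightarrow> L = 6" "n = 18 \<Longrightarrow> L = 6"
  "n = 38 \<Longrightarrow> False"
proof -
  obtain m where m: "n = L * m" using L_dvd by (elim dvdE)
  have m2: "m \<ge> 2" using m L_less by (cases m) auto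
  have LL: "L \<in> {6, 10, 12, 14, 15, 18}" if "n < 38"
  proof (rule primepow_small(2)[OF L_gt_1 L_npp])
    have "L * 2 \<le> n" using m m2 by simp
    thus "L \<le> 18" using that by simp
  qed
  have norm_lcm: "m \<le> 6" if "n < 38"
  proof -
    have "6 * m \<le> n" using m L_ge by simp
    thus ?thesis using that by simp
  qed
  have m6: "m \<in> {2, 3, 4, 5, 6}" if "n < 38" using m2 norm_lcm[OF that] by auto
  show "n \<in> {12, 18, 20, 24}" if h: "n < 25"
  proof -
    have "n < 38" using h by simp
    from LL[OF this] m6[OF this] show ?thesis using m h by (elim insertE emptyE) simp_all
  qed
  show "n \<in> {28, 30, 36}" if h: "25 \<le> n" "n < 37"
  proof -
    have "n < 38" using h by simp
    from LL[OF this] m6[OF this] show ?thesis using m h by (elim insertE emptyE) simp_all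
  qed
  show "L = 6" if h: "n = 12"
  proof -
    have "n < 38" using h by simp
    from LL[OF this] m6[OF this] show ?thesis using m h by (elim insertE emptyE) simp_all
  qed
  show "L = 6" if h: "n = 18"
  proof -
    have "n < 38" using h by simp
    from LL[OF this] m6[OF this] show ?thesis using m h by (elim insertE emptyE) simp_all
  qed
  \<comment> \<open>Only \<open>L = 19\<close> would fit, which is prime. Excluding 38 lets the even
    \<open>n\<close> from 37 on start at 40, as needed for \<open>q = 2\<close>.\<close>
  show "n = 38 \<Longrightarrow> False"
  proof -
    assume n: "n = 38"
    have "6 * m \<le> L * m" using L_ge by (rule mult_le_mono1)
    hence "6 * m \<le> 38" using m n by linarith
    hence "m = 2 \<or> m = 3 \<or> m = 4 \<or> m = 5 \<or> m = 6" using m2 by presburger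
    moreover have "L * m = 38" using m n by simp
    ultimately have "L = 19" by (elim disjE) (simp_all, presburger+)
    moreover have "prime (19 :: nat)" by simp
    hence "primepow (19 :: nat)" by (rule primepow_prime)
    ultimately show False using L_ge L_npp by auto
  qed
qed

end

text \<open>
  \<open>A\<close> stands for the set of minimal Frobenius invariant subspaces and \<open>\<delta>\<close> for the dimension;
  \<open>N\<close> is the quotient of \<open>n\<close> by a divisor of some power of \<open>q\<close>. The predicate
  \<open>good X\<close> says that the sieve succeeds for subgroups of order at least \<open>X * q ^ (n / 2)\<close>.
\<close>

locale dims =
  fixes q n N :: nat and A :: "'u set" and \<delta> :: "'u \<Rightarrow> nat"
  assumes q2: "q \<ge> 2" and fin: "finite A" and pos: "u \<in> A \<Longrightarrow> \<delta> u \<ge> 1"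
    and dvd_sum: "(\<Sum>u | u \<in> A \<and> \<delta> u dvd D. \<delta> u) \<le> gcd n (q ^ D - 1)"
    and tot: "(\<Sum>u\<in>A. \<delta> u) \<le> N"
begin

text \<open>The cost of the union bound: the sum of \<open>1 / card U\<close> over the subspaces
  left out of \<open>H\<close>.\<close>

definition lam :: "'u set \<Rightarrow> real" where "lam H = (\<Sum>u\<in>A - H. (1 / real q) ^ \<delta> u)"

definition good :: "real \<Rightarrow> bool" where
  "good X \<longleftrightarrow> (\<exists>H\<subseteq>A. lam H < 1 \<and> 2 ^ card H * (1 + real (card (A - H))) \<le> X * (1 - lam H))"

lemma good_mono:
  assumes "good X" "X \<le> Y"
  shows "good Y"
proof -
  obtain H where H: "H \<subseteq> A" "lam H < 1" "2 ^ card H * (1 + real (card (A - H))) \<le> X * (1 - lam H)"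
    using assms(1) unfolding good_def by auto
  have "X * (1 - lam H) \<le> Y * (1 - lam H)" using assms(2) H(2) by (intro mult_right_mono) auto
  with H(3) have "2 ^ card H * (1 + real (card (A - H))) \<le> Y * (1 - lam H)" by (rule order_trans)
  thus ?thesis unfolding good_def using H(1,2) by (intro exI[of _ H] conjI)
qed

lemma card_eq_le_gcd: "d * card {u \<in> A. \<delta> u = d} \<le> gcd n (q ^ d - 1)"
proof -
  have "d * card {u \<in> A. \<delta> u = d} = (\<Sum>u\<in>{u \<in> A. \<delta> u = d}. \<delta> u)" by simp
  also have "\<dots> \<le> (\<Sum>u | u \<in> A \<and> \<delta> u dvd d. \<delta> u)" using fin by (intro sum_mono2) auto
  also have "\<dots> \<le> gcd n (q ^ d - 1)" by (rule dvd_sum)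
  finally show ?thesis .
qed

lemma gcd_le: "d > 0 \<Longrightarrow> gcd n (q ^ d - 1) \<le> q ^ d - 1"
proof -
  assume "d > 0"
  hence "q ^ d > 1" using q2 by (intro one_less_power) auto
  thus ?thesis by (intro gcd_le2_nat) auto
qed

lemma card_eq_le: "d > 0 \<Longrightarrow> d * card {u \<in> A. \<delta> u = d} \<le> q ^ d - 1"
  using card_eq_le_gcd gcd_le le_trans by blast

lemma card_eq_le_real: "d > 0 \<Longrightarrow> real (card {u \<in> A. \<delta> u = d}) \<le> real q ^ d / real d"
proof -
  assume d: "d > 0"
  have "d * card {u \<in> A. \<delta> u = d} \<le> q ^ d" using card_eq_le[OF d] by simp
  hence "real (d * card {u \<in> A. \<delta> u = d}) \<le> real (q ^ d)" by (rule of_nat_mono)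
  thus ?thesis using d by (simp add: field_simps)
qed

lemma card_1_2_le:
  shows "card {u \<in> A. \<delta> u = 1} + 2 * card {u \<in> A. \<delta> u = 2} \<le> gcd n (q ^ 2 - 1)"
proof -
  have "card {u \<in> A. \<delta> u = 1} + 2 * card {u \<in> A. \<delta> u = 2} = (\<Sum>u\<in>{u \<in> A. \<delta> u = 1} \<union> {u \<in> A. \<delta> u = 2}. \<delta> u)"
    using fin by (subst sum.union_disjoint) auto
  also have "\<dots> \<le> (\<Sum>u | u \<in> A \<and> \<delta> u dvd 2. \<delta> u)" using fin by (intro sum_mono2) auto
  also have "\<dots> \<le> gcd n (q ^ 2 - 1)" by (rule dvd_sum)
  finally show ?thesis .
qed

lemma card_1_3_le:
  shows "card {u \<in> A. \<delta> u = 1} + 3 * card {u \<in> A. \<delta> u = 3} \<le> gcd n (q ^ 3 - 1)"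
proof -
  have "card {u \<in> A. \<delta> u = 1} + 3 * card {u \<in> A. \<delta> u = 3} = (\<Sum>u\<in>{u \<in> A. \<delta> u = 1} \<union> {u \<in> A. \<delta> u = 3}. \<delta> u)"
    using fin by (subst sum.union_disjoint) auto
  also have "\<dots> \<le> (\<Sum>u | u \<in> A \<and> \<delta> u dvd 3. \<delta> u)" using fin by (intro sum_mono2) auto
  also have "\<dots> \<le> gcd n (q ^ 3 - 1)" by (rule dvd_sum)
  finally show ?thesis .
qed

lemma card_le_1: "card {u \<in> A. \<delta> u \<le> 1} = card {u \<in> A. \<delta> u = 1}"
  using pos by (intro arg_cong[of _ _ card]) (auto intro: antisym)

lemma card_le_Suc: "card {u \<in> A. \<delta> u \<le> Suc s} = card {u \<in> A. \<delta> u \<le> s} + card {u \<in> A. \<delta> u = Suc s}"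
proof -
  have "{u \<in> A. \<delta> u \<le> Suc s} = {u \<in> A. \<delta> u \<le> s} \<union> {u \<in> A. \<delta> u = Suc s}" by auto
  thus ?thesis using fin by (subst card_Un_disjoint[symmetric]) auto
qed

lemma card_le_2: "2 * card {u \<in> A. \<delta> u \<le> 2} \<le> q ^ 2 + q - 2"
proof -
  have "card {u \<in> A. \<delta> u \<le> 2} = card {u \<in> A. \<delta> u = 1} + card {u \<in> A. \<delta> u = 2}"
    using card_le_Suc[of 1] card_le_1 by (simp add: numeral_2_eq_2)
  moreover have "card {u \<in> A. \<delta> u = 1} + 2 * card {u \<in> A. \<delta> u = 2} \<le> q ^ 2 - 1"
    using card_1_2_le gcd_le[of 2] by simp
  moreover have "card {u \<in> A. \<delta> u = 1} \<le> q - 1" using card_eq_le[of 1] by simp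
  ultimately show ?thesis using q2 by linarith
qed

lemma card_le_power: "card {u \<in> A. \<delta> u \<le> s} \<le> q ^ s"
proof (induction s)
  case 0
  have e: "{u \<in> A. \<delta> u \<le> 0} = {}" using pos by fastforce
  show ?case unfolding e by simp
next
  case (Suc s)
  show ?case
  proof (cases "s = 0")
    case True
    thus ?thesis using card_le_1 card_eq_le[of 1] by simp
  next
    case False
    have "2 * card {u \<in> A. \<delta> u = Suc s} \<le> Suc s * card {u \<in> A. \<delta> u = Suc s}" using False by (intro mult_le_mono1) auto
    also have "\<dots> \<le> q ^ Suc s" using card_eq_le[of "Suc s"] by simp
    finally have "2 * card {u \<in> A. \<delta> u = Suc s} \<le> q ^ Suc s" .
    moreover have "2 * q ^ s \<le> q ^ Suc s" using q2 by simp
    ultimately show ?thesis using Suc card_le_Suc[of s] by linarith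
  qed
qed

lemma card_gt_le:
  assumes "(\<Sum>u | u \<in> A \<and> \<delta> u > s. \<delta> u) \<le> R"
  shows "(s + 1) * card {u \<in> A. \<delta> u > s} \<le> R"
proof -
  have "(s + 1) * card {u \<in> A. \<delta> u > s} = (\<Sum>u | u \<in> A \<and> \<delta> u > s. s + 1)" by simp
  also have "\<dots> \<le> (\<Sum>u | u \<in> A \<and> \<delta> u > s. \<delta> u)" by (intro sum_mono) auto
  finally show ?thesis using assms by simp
qed

lemma sum_gt_le: "(\<Sum>u | u \<in> A \<and> \<delta> u > s. \<delta> u) \<le> N"
proof -
  have "(\<Sum>u | u \<in> A \<and> \<delta> u > s. \<delta> u) \<le> (\<Sum>u\<in>A. \<delta> u)" using fin by (intro sum_mono2) auto
  thus ?thesis using tot by simp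
qed

text \<open>Sieve everything of dimension at most \<open>s\<close>. Dimensions up to
  \<open>t\<close> are counted one by one through \<open>b\<close>; beyond \<open>t\<close> one has
  \<open>q ^ -\<delta> u <= \<delta> u / ((t + 1) * q ^ (t + 1))\<close>, so the total dimension
  \<open>R\<close> bounds the tail.\<close>

lemma good_cut:
  fixes b :: "nat \<Rightarrow> real"
  assumes st: "s \<le> t" and a: "card {u \<in> A. \<delta> u \<le> s} \<le> a"
    and b: "\<And>d. s < d \<Longrightarrow> d \<le> t \<Longrightarrow> real (card {u \<in> A. \<delta> u = d}) \<le> b d"
    and R: "(\<Sum>u | u \<in> A \<and> \<delta> u > s. \<delta> u) \<le> R"
    and l: "l \<ge> (\<Sum>d\<in>{s<..t}. b d / real q ^ d) + real R / (real (t + 1) * real q ^ (t + 1))" "l < 1"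
    and X: "2 ^ a * (1 + real R / real (s + 1)) \<le> X * (1 - l)"
  shows "good X"
proof -
  define H where "H = {u \<in> A. \<delta> u \<le> s}"
  have AH: "A - H = {u \<in> A. \<delta> u > s}" by (auto simp: H_def)
  have q0: "real q > 0" using q2 by simp
  define K where "K = real (t + 1) * real q ^ (t + 1)"
  have K0: "K > 0" using q0 by (simp add: K_def)
  have "lam H \<le> (\<Sum>u\<in>A - H. (if \<delta> u \<le> t then (1 / real q) ^ \<delta> u else 0) + real (\<delta> u) / K)"
    unfolding lam_def
  proof (intro sum_mono)
    fix u assume "u \<in> A - H"
    show "(1 / real q) ^ \<delta> u \<le> (if \<delta> u \<le> t then (1 / real q) ^ \<delta> u else 0) + real (\<delta> u) / K"
    proof (cases "\<delta> u \<le> t")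
      case False
      have "(1 / real q) ^ \<delta> u \<le> (1 / real q) ^ (t + 1)" using False q2 by (intro power_decreasing) auto
      also have "\<dots> = real (t + 1) / K" by (simp add: K_def power_divide)
      also have "\<dots> \<le> real (\<delta> u) / K" using False K0 by (intro divide_right_mono) auto
      finally show ?thesis using False by simp
    qed (use K0 in auto)
  qed
  also have "\<dots> = (\<Sum>u\<in>{u \<in> A. s < \<delta> u \<and> \<delta> u \<le> t}. (1 / real q) ^ \<delta> u) + real (\<Sum>u | u \<in> A \<and> \<delta> u > s. \<delta> u) / K"
    unfolding sum.distrib AH using fin
    by (simp add: sum.If_cases sum_divide_distrib Int_def conj_ac)
  also have "(\<Sum>u\<in>{u \<in> A. s < \<delta> u \<and> \<delta> u \<le> t}. (1 / real q) ^ \<delta> u)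
      = (\<Sum>d\<in>{s<..t}. \<Sum>u\<in>{u \<in> {u \<in> A. s < \<delta> u \<and> \<delta> u \<le> t}. \<delta> u = d}. (1 / real q) ^ \<delta> u)"
    using fin by (intro sum.group[symmetric]) auto
  also have "\<dots> = (\<Sum>d\<in>{s<..t}. real (card {u \<in> A. \<delta> u = d}) / real q ^ d)"
  proof (intro sum.cong refl)
    fix d assume "d \<in> {s<..t}"
    hence "{u \<in> {u \<in> A. s < \<delta> u \<and> \<delta> u \<le> t}. \<delta> u = d} = {u \<in> A. \<delta> u = d}" by auto
    thus "(\<Sum>u\<in>{u \<in> {u \<in> A. s < \<delta> u \<and> \<delta> u \<le> t}. \<delta> u = d}. (1 / real q) ^ \<delta> u) = real (card {u \<in> A. \<delta> u = d}) / real q ^ d"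
      by (simp add: power_divide)
  qed
  also have "\<dots> \<le> (\<Sum>d\<in>{s<..t}. b d / real q ^ d)" using b q0 by (intro sum_mono divide_right_mono) auto
  also have "real (\<Sum>u | u \<in> A \<and> \<delta> u > s. \<delta> u) / K \<le> real R / K"
    using R K0 by (intro divide_right_mono of_nat_mono) auto
  finally have lH: "lam H \<le> l" using l(1) by (simp add: K_def)
  have "card (A - H) * (s + 1) \<le> R" using card_gt_le[OF R] by (simp add: AH mult.commute)
  hence "real (card (A - H) * (s + 1)) \<le> real R" by (rule of_nat_mono)
  hence cB: "real (card (A - H)) \<le> real R / real (s + 1)" by (simp add: field_simps)
  have cH: "(2 :: real) ^ card H \<le> 2 ^ a" using a by (intro power_increasing) (auto simp: H_def)
  have "2 ^ card H * (1 + real (card (A - H))) \<le> 2 ^ a * (1 + real R / real (s + 1))"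
    using cB cH by (intro mult_mono) auto
  also have "\<dots> \<le> X * (1 - l)" by (rule X)
  also have "\<dots> \<le> X * (1 - lam H)"
  proof -
    have "0 < X * (1 - l)" using X by (intro less_le_trans[OF _ X]) (auto intro!: mult_pos_pos add_pos_nonneg)
    hence "X > 0" using l(2) by (simp add: zero_less_mult_iff)
    thus ?thesis using lH by (intro mult_left_mono) auto
  qed
  finally show ?thesis unfolding good_def using lH l(2) by (intro exI[of _ H]) (auto simp: H_def)
qed

lemma good_all: "card A \<le> a \<Longrightarrow> 2 ^ a \<le> X \<Longrightarrow> good X"
proof -
  assume a: "card A \<le> a" "2 ^ a \<le> X"
  have "(2 :: real) ^ card A \<le> 2 ^ a" using a(1) by (intro power_increasing) auto
  hence "2 ^ card A \<le> X" using a(2) by linarith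
  thus ?thesis unfolding good_def by (intro exI[of _ A]) (auto simp: lam_def)
qed

text \<open>Only \<open>j\<close> of the at most \<open>q - 1\<close> one-dimensional subspaces are
  sieved. The remaining ones contribute at most \<open>(q - 1 - j) / q\<close>, all larger
  dimensions at most \<open>N / (2 * q^2) <= j / q\<close>, leaving the margin
  \<open>1 / q\<close>.\<close>

lemma good_partial:
  assumes j: "N \<le> 2 * q * j" "j \<le> q - 1" and X: "2 ^ j * (1 + real N) * real q \<le> X"
  shows "good X"
proof -
  define B where "B = {u \<in> A. \<delta> u = 1}"
  have cB: "card B \<le> q - 1" using card_eq_le[of 1] by (simp add: B_def)
  have finB: "finite B" using fin by (simp add: B_def)
  obtain H where H: "H \<subseteq> B" "card H = min j (card B)"
    using obtain_subset_with_card_n[of "min j (card B)" B] by auto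
  have q0: "real q > 0" using q2 by simp
  have cBH: "card (B - H) + j \<le> q - 1"
    using H cB j(2) finB by (simp add: card_Diff_subset finite_subset)
  have HA: "H \<subseteq> A" using H by (auto simp: B_def)
  have "lam H \<le> (\<Sum>u\<in>A - H. (if \<delta> u = 1 then 1 / real q else 0) + real (\<delta> u) / (2 * real q ^ 2))"
    unfolding lam_def
  proof (intro sum_mono)
    fix u assume u: "u \<in> A - H"
    show "(1 / real q) ^ \<delta> u \<le> (if \<delta> u = 1 then 1 / real q else 0) + real (\<delta> u) / (2 * real q ^ 2)"
    proof (cases "\<delta> u = 1")
      case False
      hence d2: "\<delta> u \<ge> 2" using pos[of u] u by auto
      have "(1 / real q) ^ \<delta> u \<le> (1 / real q) ^ 2" using d2 q2 by (intro power_decreasing) auto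
      also have "\<dots> = 2 / (2 * real q ^ 2)" by (simp add: power_divide)
      also have "\<dots> \<le> real (\<delta> u) / (2 * real q ^ 2)" using d2 q0 by (intro divide_right_mono) auto
      finally show ?thesis using False by simp
    qed (use q0 in simp)
  qed
  also have "\<dots> = real (card (B - H)) / real q + real (\<Sum>u\<in>A - H. \<delta> u) / (2 * real q ^ 2)"
  proof -
    have "(A - H) \<inter> {u. \<delta> u = 1} = B - H" by (auto simp: B_def)
    thus ?thesis unfolding sum.distrib using fin by (simp add: sum.If_cases sum_divide_distrib)
  qed
  also have "\<dots> \<le> (real q - 1 - real j) / real q + (2 * real q * real j) / (2 * real q ^ 2)"
  proof (intro add_mono divide_right_mono)
    show "real (card (B - H)) \<le> real q - 1 - real j" using cBH q2 by linarith
    have "(\<Sum>u\<in>A - H. \<delta> u) \<le> (\<Sum>u\<in>A. \<delta> u)" using fin by (intro sum_mono2) auto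
    hence "(\<Sum>u\<in>A - H. \<delta> u) \<le> 2 * q * j" using tot j(1) by linarith
    hence "real (\<Sum>u\<in>A - H. \<delta> u) \<le> real (2 * q * j)" by (rule of_nat_mono)
    thus "real (\<Sum>u\<in>A - H. \<delta> u) \<le> 2 * real q * real j" by simp
  qed (use q0 in auto)
  also have "\<dots> = 1 - 1 / real q" using q0 by (simp add: field_simps power2_eq_square)
  finally have lH: "lam H \<le> 1 - 1 / real q" .
  have cA: "card A \<le> N"
  proof -
    have "card A = (\<Sum>u\<in>A. 1)" by simp
    also have "\<dots> \<le> (\<Sum>u\<in>A. \<delta> u)" using pos by (intro sum_mono) auto
    finally show ?thesis using tot by simp
  qed
  have "card (A - H) \<le> N" using card_mono[OF fin, of "A - H"] cA by auto
  moreover have "(2 :: real) ^ card H \<le> 2 ^ j" using H by (intro power_increasing) auto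
  ultimately have "2 ^ card H * (1 + real (card (A - H))) \<le> 2 ^ j * (1 + real N)" by (intro mult_mono) auto
  also have "\<dots> \<le> X * (1 / real q)" using X q0 by (simp add: field_simps)
  also have "\<dots> \<le> X * (1 - lam H)"
  proof (intro mult_left_mono)
    have "0 \<le> 2 ^ j * (1 + real N) * real q" by simp
    thus "0 \<le> X" using X by linarith
  qed (use lH in simp)
  finally have "2 ^ card H * (1 + real (card (A - H))) \<le> X * (1 - lam H)" .
  moreover have "1 / real q > 0" using q0 by simp
  hence "lam H < 1" using lH by linarith
  ultimately show ?thesis unfolding good_def using HA by (intro exI[of _ H] conjI)
qed

text \<open>Sieving a single subspace beats a plain union bound: for \<open>N = 12\<close> and
  \<open>q = 13\<close>, where \<open>X = 157\<close>, the latter would need 13 but has only 157/13,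
  whereas here 24 is below 314/13.\<close>

lemma good_singleton:
  assumes X: "2 * real N \<le> X * (1 - (real N - 1) / real q)" "N \<le> q" "N > 0" "X \<ge> 1"
  shows "good X"
proof (cases "A = {}")
  case True
  thus ?thesis using X(4) by (intro good_all[of 0]) auto
next
  case False
  then obtain v where v: "v \<in> A" by auto
  have cA: "card A \<le> N"
  proof -
    have "card A = (\<Sum>u\<in>A. 1)" by simp
    also have "\<dots> \<le> (\<Sum>u\<in>A. \<delta> u)" using pos by (intro sum_mono) auto
    finally show ?thesis using tot by simp
  qed
  have cAv: "card (A - {v}) \<le> N - 1" using cA v fin by simp
  have q0: "real q > 0" using q2 by simp
  have "lam {v} \<le> (\<Sum>u\<in>A - {v}. 1 / real q)"
    unfolding lam_def
  proof (intro sum_mono)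
    fix u assume "u \<in> A - {v}"
    hence "(1 / real q) ^ \<delta> u \<le> (1 / real q) ^ 1" using pos[of u] q2 by (intro power_decreasing) auto
    thus "(1 / real q) ^ \<delta> u \<le> 1 / real q" by simp
  qed
  also have "\<dots> = real (card (A - {v})) / real q" by simp
  also have "\<dots> \<le> (real N - 1) / real q" using cAv X(3) q0 by (intro divide_right_mono) (auto simp: of_nat_diff)
  finally have l: "lam {v} \<le> (real N - 1) / real q" .
  have l1: "(real N - 1) / real q < 1" using X(2,3) q0 by (simp add: field_simps)
  have "2 ^ card {v} * (1 + real (card (A - {v}))) \<le> 2 * real N" using cAv X(3) by (simp add: of_nat_diff)
  also have "\<dots> \<le> X * (1 - (real N - 1) / real q)" by (rule X(1))
  also have "\<dots> \<le> X * (1 - lam {v})" using l X(4) by (intro mult_left_mono) auto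
  finally show ?thesis unfolding good_def using v l l1 by (intro exI[of _ "{v}"] conjI) auto
qed

lemma good_cut_simple:
  assumes "card {u \<in> A. \<delta> u \<le> s} \<le> a" "(\<Sum>u | u \<in> A \<and> \<delta> u > s. \<delta> u) \<le> R"
    and "l \<ge> real R / (real (s + 1) * real q ^ (s + 1))" "l < 1" "2 ^ a * (1 + real R / real (s + 1)) \<le> X * (1 - l)"
  shows "good X"
  by (rule good_cut[of s s a "\<lambda>_. 0" R l]) (use assms in auto)

lemma card_eq_div: "d > 0 \<Longrightarrow> card {u \<in> A. \<delta> u = d} \<le> (q ^ d - 1) div d"
  using card_eq_le[of d] by (simp add: less_eq_div_iff_mult_less_eq mult.commute)

lemma sum_split_1: "(\<Sum>u | u \<in> A \<and> \<delta> u > 1. \<delta> u) + card {u \<in> A. \<delta> u = 1} \<le> N"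
proof -
  have "(\<Sum>u | u \<in> A \<and> \<delta> u > 1. \<delta> u) + card {u \<in> A. \<delta> u = 1} = (\<Sum>u\<in>{u \<in> A. \<delta> u > 1} \<union> {u \<in> A. \<delta> u = 1}. \<delta> u)"
    using fin by (subst sum.union_disjoint) auto
  also have "\<dots> \<le> (\<Sum>u\<in>A. \<delta> u)" using fin by (intro sum_mono2) auto
  finally show ?thesis using tot by simp
qed

lemma sum_split_2:
  assumes "s \<ge> 2"
  shows "(\<Sum>u | u \<in> A \<and> \<delta> u > s. \<delta> u) + card {u \<in> A. \<delta> u = 1} + 2 * card {u \<in> A. \<delta> u = 2} \<le> N"
proof -
  have "(\<Sum>u | u \<in> A \<and> \<delta> u > s. \<delta> u) + (card {u \<in> A. \<delta> u = 1} + 2 * card {u \<in> A. \<delta> u = 2}) =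
      (\<Sum>u\<in>{u \<in> A. \<delta> u > s} \<union> ({u \<in> A. \<delta> u = 1} \<union> {u \<in> A. \<delta> u = 2}). \<delta> u)"
    using fin assms by (subst sum.union_disjoint; (subst sum.union_disjoint)?) auto
  also have "\<dots> \<le> (\<Sum>u\<in>A. \<delta> u)" using fin by (intro sum_mono2) auto
  finally show ?thesis using tot by simp
qed

lemma card_A_le: "card A \<le> N"
proof -
  have "card A = (\<Sum>u\<in>A. 1)" by simp
  also have "\<dots> \<le> (\<Sum>u\<in>A. \<delta> u)" using pos by (intro sum_mono) auto
  finally show ?thesis using tot by simp
qed

lemma card_A_split: "card A = card {u \<in> A. \<delta> u \<le> s} + card {u \<in> A. \<delta> u > s}"
proof -
  have "A = {u \<in> A. \<delta> u \<le> s} \<union> {u \<in> A. \<delta> u > s}" by auto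
  thus ?thesis using fin by (subst card_Un_disjoint[symmetric]) auto
qed

lemma card_A_half: "2 * card A \<le> N + card {u \<in> A. \<delta> u = 1}"
  using card_A_split[of 1] card_le_1 sum_split_1 card_gt_le[OF order_refl, of 1] by simp

lemma card_le_2_split: "card {u \<in> A. \<delta> u \<le> 2} = card {u \<in> A. \<delta> u = 1} + card {u \<in> A. \<delta> u = 2}"
  using card_le_Suc[of 1] card_le_1 by (simp add: numeral_2_eq_2)

lemma card_le_3_split: "card {u \<in> A. \<delta> u \<le> 3} = card {u \<in> A. \<delta> u \<le> 2} + card {u \<in> A. \<delta> u = 3}"
  using card_le_Suc[of 2] by (simp add: numeral_3_eq_3 numeral_2_eq_2)

lemma card_le_4_split: "card {u \<in> A. \<delta> u \<le> 4} = card {u \<in> A. \<delta> u \<le> 3} + card {u \<in> A. \<delta> u = 4}"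
  using card_le_Suc[of 3] by (simp add: eval_nat_numeral)

section \<open>Criteria for \<open>q\<close> at most 4 and small total dimension\<close>

lemma good_q4:
  assumes "q = 4" "N \<le> 60" "7 / 16 + real N / 192 \<le> l" "l < 1" "8 * (1 + real N / 2) \<le> X * (1 - l)"
  shows "good X"
proof (rule good_cut[of 1 2 3 "\<lambda>_. 7" N l])
  show "card {u \<in> A. \<delta> u \<le> 1} \<le> 3" using card_le_1 card_eq_div[of 1] assms by simp
  show "real (card {u \<in> A. \<delta> u = d}) \<le> 7" if "1 < d" "d \<le> 2" for d
    using that card_eq_div[of 2] assms by (cases "d = 2") auto
  have "{1<..2 :: nat} = {2}" by auto
  thus "(\<Sum>d\<in>{1<..2}. 7 / real q ^ d) + real N / (real (2 + 1) * real q ^ (2 + 1)) \<le> l" using assms by simp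
qed (use assms sum_gt_le in auto)

text \<open>The targets are values of \<open>q ^ k * (1 - 1/q - 1/q^2)\<close>: 405 and 45 are
  \<open>3 ^ 6\<close> and \<open>3 ^ 4\<close> times 5/9, and for \<open>q = 2\<close> below 4, 16,
  64, 128 are \<open>2 ^ k / 4\<close> with \<open>k = 4, 6, 8, 9\<close>. The counts are
  \<open>(q ^ d - 1) div d\<close>.\<close>

lemma good_q3_a:
  assumes "q = 3" "N \<le> 28" shows "good 405"
proof (rule good_cut[of 1 2 2 "\<lambda>_. 4" 28 "4 / 9 + 28 / 81"])
  show "card {u \<in> A. \<delta> u \<le> 1} \<le> 2" using card_le_1 card_eq_div[of 1] assms by simp
  show "real (card {u \<in> A. \<delta> u = d}) \<le> 4" if "1 < d" "d \<le> 2" for d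
    using that card_eq_div[of 2] assms by (cases "d = 2") auto
  have "{1<..2 :: nat} = {2}" by auto
  thus "(\<Sum>d\<in>{1<..2}. 4 / real q ^ d) + real (28 :: nat) / (real (2 + 1 :: nat) * real q ^ (2 + 1)) \<le> 4 / 9 + 28 / 81" using assms by simp
  show "(\<Sum>u | u \<in> A \<and> 1 < \<delta> u. \<delta> u) \<le> 28" using sum_gt_le[of 1] assms by linarith
qed auto

lemma good_q3_b:
  assumes "q = 3" "N \<le> 8" shows "good 45"
proof (rule good_cut_simple[of 1 2 8 "4 / 9"])
  show "card {u \<in> A. \<delta> u \<le> 1} \<le> 2" using card_le_1 card_eq_div[of 1] assms by simp
  show "(\<Sum>u | u \<in> A \<and> 1 < \<delta> u. \<delta> u) \<le> 8" using sum_gt_le[of 1] assms by linarith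
qed (use assms in auto)

text \<open>Here 3 does not divide \<open>n\<close>, so the total dimension stays 20, but the gcd
  bounds leave few subspaces of dimension at most 3. If three must be sieved, they use up dimension
  4 and only 16 remains.\<close>

lemma good_q3_20:
  assumes "q = 3" "n = 20" "N \<le> 20" shows "good 45"
proof -
  define w1 w2 w3 where "w1 = card {u \<in> A. \<delta> u = 1}" "w2 = card {u \<in> A. \<delta> u = 2}" "w3 = card {u \<in> A. \<delta> u = 3}"
  have g: "gcd 20 (3 ^ 1 - 1) = (2 :: nat)" "gcd 20 (3 ^ 2 - 1) = (4 :: nat)" "gcd 20 (3 ^ 3 - 1) = (2 :: nat)"
    by (simp_all add: gcd_non_0_nat)
  have w: "w1 \<le> 2" "w1 + 2 * w2 \<le> 4" "w1 + 3 * w3 \<le> 2"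
    using card_eq_le_gcd[of 1] card_1_2_le card_1_3_le g assms by (simp_all add: w1_w2_w3_def del: One_nat_def)
  have c3: "card {u \<in> A. \<delta> u \<le> 3} = w1 + w2 + w3" using card_le_3_split card_le_2_split by (simp add: w1_w2_w3_def)
  have s: "(\<Sum>u | u \<in> A \<and> \<delta> u > 3. \<delta> u) + w1 + 2 * w2 \<le> 20" using sum_split_2[of 3] assms by (simp add: w1_w2_w3_def)
  show ?thesis
  proof (cases "w1 + w2 \<le> 2")
    case True
    show ?thesis
      by (rule good_cut_simple[of 3 2 20 "20 / 324"]) (use True w c3 s assms in auto)
  next
    case False
    hence "w1 = 2" "w2 = 1" "w3 = 0" using w by auto
    thus ?thesis
      by (intro good_cut_simple[of 3 3 16 "16 / 324"]) (use c3 s assms in auto)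
  qed
qed

text \<open>The sieve costs a factor 4 only if two subspaces of dimension at most 2 exist, and then
  these use up at least three of the nine dimensions.\<close>

lemma good_q2_9:
  assumes "q = 2" "N \<le> 9" shows "good 16"
proof -
  define w1 w2 where "w1 = card {u \<in> A. \<delta> u = 1}" "w2 = card {u \<in> A. \<delta> u = 2}"
  have w: "w1 \<le> 1" "w1 + w2 \<le> 2" using card_eq_div[of 1] card_le_2 card_le_2_split assms by (simp_all add: w1_w2_def)
  have c2: "card {u \<in> A. \<delta> u \<le> 2} = w1 + w2" using card_le_2_split by (simp add: w1_w2_def)
  have s: "(\<Sum>u | u \<in> A \<and> \<delta> u > 2. \<delta> u) + w1 + 2 * w2 \<le> 9" using sum_split_2[of 2] assms by (simp add: w1_w2_def)
  show ?thesis
  proof (cases "w1 + w2 \<le> 1")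
    case True
    show ?thesis
      by (rule good_cut_simple[of 2 1 9 "3 / 8"]) (use True w c2 s assms in auto)
  next
    case False
    hence "w1 + 2 * w2 \<ge> 3" using w by auto
    thus ?thesis
      by (intro good_cut_simple[of 2 2 6 "1 / 4"]) (use w c2 s assms in auto)
  qed
qed

lemma good_q2_15:
  assumes "q = 2" "N \<le> 15" shows "good 64"
proof (rule good_cut_simple[of 2 2 15 "5 / 8"])
  show "card {u \<in> A. \<delta> u \<le> 2} \<le> 2" using card_le_2 assms by simp
  show "(\<Sum>u | u \<in> A \<and> 2 < \<delta> u. \<delta> u) \<le> 15" using sum_gt_le[of 2] assms by linarith
qed (use assms in auto)

lemma good_q2_30:
  assumes "q = 2" "N \<le> 30" shows "good 128"
proof (rule good_cut[of 2 4 2 "\<lambda>d. if d = 3 then 2 else 3" 30 "5 / 8"])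
  show "card {u \<in> A. \<delta> u \<le> 2} \<le> 2" using card_le_2 assms by simp
  show "real (card {u \<in> A. \<delta> u = d}) \<le> (if d = 3 then 2 else 3)" if "2 < d" "d \<le> 4" for d
  proof -
    have "d = 3 \<or> d = 4" using that by auto
    thus ?thesis using card_eq_div[of 3] card_eq_div[of 4] assms by auto
  qed
  have "{2<..4 :: nat} = {3, 4}" by auto
  thus "(\<Sum>d\<in>{2<..4}. (if d = 3 then 2 else 3) / real q ^ d) + real (30 :: nat) / (real (4 + 1 :: nat) * real q ^ (4 + 1)) \<le> 5 / 8"
    using assms by simp
  show "(\<Sum>u | u \<in> A \<and> 2 < \<delta> u. \<delta> u) \<le> 30" using sum_gt_le[of 2] assms by linarith
qed auto

lemma good_q2_20:
  assumes "q = 2" "n = 20" "N \<le> 5" shows "good 4"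
proof -
  have g: "gcd 20 (2 ^ 2 - 1) = (1 :: nat)" "gcd 20 (2 ^ 3 - 1) = (1 :: nat)"
    by (simp_all add: gcd_non_0_nat)
  have "card {u \<in> A. \<delta> u = 1} \<le> 1" using card_eq_div[of 1] assms by simp
  moreover have "card {u \<in> A. \<delta> u = 2} = 0" using card_1_2_le g assms by simp
  moreover have "card {u \<in> A. \<delta> u = 3} = 0" using card_1_3_le g assms by simp
  moreover have "4 * card {u \<in> A. \<delta> u > 3} \<le> 5" using card_gt_le[OF sum_gt_le, of 3] assms by simp
  ultimately have "card A \<le> 2" using card_A_split[of 3] card_le_3_split card_le_2_split by linarith
  thus ?thesis by (rule good_all) simp
qed

lemma card_A_q2: "q = 2 \<Longrightarrow> N \<le> 3 \<Longrightarrow> card A \<le> 2" and card_A_q3: "q = 3 \<Longrightarrow> N \<le> 4 \<Longrightarrow> card A \<le> 3"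
  using card_A_half card_eq_div[of 1] by simp_all

lemma good_s1:
  assumes "card {u \<in> A. \<delta> u = 1} \<le> a" "N \<le> R" "real R / (2 * real q ^ 2) < 1"
    "2 ^ a * (1 + real R / 2) \<le> X * (1 - real R / (2 * real q ^ 2))"
  shows "good X"
  by (rule good_cut_simple[of 1 a R "real R / (2 * real q ^ 2)"])
     (use assms card_le_1 sum_gt_le[of 1] in \<open>auto simp: numeral_2_eq_2\<close>)

end

lemma cube_le_two_power: "j \<ge> 10 \<Longrightarrow> j ^ 3 \<le> (2 :: nat) ^ j"
proof (induction j rule: dec_induct)
  case (step j)
  have "3 * j\<^sup>2 + 3 * j + 1 \<le> j ^ 3"
  proof -
    have "10 * j\<^sup>2 \<le> j * j\<^sup>2" using step(1) by (rule mult_le_mono1)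
    moreover have "10 * j \<le> j\<^sup>2" using step(1) by (simp add: power2_eq_square)
    moreover have "j ^ 3 = j * j\<^sup>2" by (simp add: power2_eq_square power3_eq_cube)
    ultimately show ?thesis using step(1) by linarith
  qed
  moreover have "(Suc j) ^ 3 = j ^ 3 + (3 * j\<^sup>2 + 3 * j + 1)"
    by (simp add: power2_eq_square power3_eq_cube algebra_simps)
  ultimately show ?case using step(3) by simp
qed simp

lemma frac_le_inverse:
  fixes q n c e :: nat
  assumes "n \<le> q ^ c" "q > 0" "e > 0"
  shows "real n / (real e * real q ^ c) \<le> 1 / real e"
proof -
  have "real n \<le> real (q ^ c)" using assms(1) by (rule of_nat_mono)
  hence "real n / (real e * real q ^ c) \<le> real q ^ c / (real e * real q ^ c)"
    by (intro divide_right_mono) auto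
  thus ?thesis using assms(2) by simp
qed

text \<open>The sum decreases with \<open>s\<close> and starts at
  \<open>1/3 + 1/4 + 1/5 + 1/6 = 19/20\<close>. It arises because at most \<open>q ^ d / d\<close>
  subspaces have dimension \<open>d\<close>, each costing \<open>q ^ -d\<close> in the union
  bound.\<close>

lemma sum_reciprocals_le:
  assumes "s \<ge> 2"
  shows "(\<Sum>d\<in>{s<..2 * s + 2}. 1 / real d) \<le> 19 / 20"
  using assms
proof (induction s rule: dec_induct)
  case base
  have "{2<..2 * 2 + 2 :: nat} = {3, 4, 5, 6}" by auto
  thus ?case by simp
next
  case (step s)
  have "insert (Suc s) {Suc s<..2 * Suc s + 2} = insert (2 * s + 3) (insert (2 * s + 4) {s<..2 * s + 2})" by auto
  hence "(\<Sum>d\<in>insert (Suc s) {Suc s<..2 * Suc s + 2}. 1 / real d)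
    = (\<Sum>d\<in>insert (2 * s + 3) (insert (2 * s + 4) {s<..2 * s + 2}). 1 / real d)" by (rule arg_cong)
  hence "1 / real (Suc s) + (\<Sum>d\<in>{Suc s<..2 * Suc s + 2}. 1 / real d)
    = 1 / real (2 * s + 3) + (1 / real (2 * s + 4) + (\<Sum>d\<in>{s<..2 * s + 2}. 1 / real d))"
    by (subst (asm) sum.insert; simp)
  moreover have "1 / real (2 * s + 3) \<le> 1 / real (2 * s + 2)" "1 / real (2 * s + 4) \<le> 1 / real (2 * s + 2)"
    by (intro divide_left_mono; simp)+
  moreover have "1 / real (Suc s) = 2 * (1 / real (2 * s + 2))" by (simp add: field_simps)
  ultimately show ?case using step(3) by linarith
qed

lemma totient_table_30: "\<forall>L\<in>set [19..<31]. L \<notin> {20, 24, 30} \<longrightarrow> totient L \<ge> 10" "totient 10 = 4" "totient 15 = 8"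
  by (simp_all add:
    totient_prime[of 2, simplified] totient_prime[of 3, simplified]
    totient_prime_mult[of 2 2, simplified] totient_prime[of 5, simplified]
    totient_prime_mult[of 2 3, simplified] totient_prime[of 7, simplified]
    totient_prime_mult[of 2 4, simplified] totient_prime_mult[of 3 3, simplified]
    totient_prime_mult[of 2 5, simplified] totient_prime[of 11, simplified]
    totient_prime_mult[of 2 6, simplified] totient_prime[of 13, simplified]
    totient_prime_mult[of 2 7, simplified] totient_prime_mult[of 3 5, simplified]
    totient_prime_mult[of 2 8, simplified] totient_prime[of 17, simplified]
    totient_prime_mult[of 2 9, simplified] totient_prime[of 19, simplified]
    totient_prime_mult[of 2 10, simplified] totient_prime_mult[of 3 7, simplified]
    totient_prime_mult[of 2 11, simplified] totient_prime[of 23, simplified]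
    totient_prime_mult[of 2 12, simplified] totient_prime_mult[of 5 5, simplified]
    totient_prime_mult[of 2 13, simplified] totient_prime_mult[of 3 9, simplified]
    totient_prime_mult[of 2 14, simplified] totient_prime[of 29, simplified]
    totient_prime_mult[of 2 15, simplified])

section \<open>Ranges of \<open>q\<close> and \<open>n\<close> in which the sieve succeeds\<close>

locale sieve_data = dims q n n A \<delta> + modulus n L for q n L :: nat and A :: "'u set" and \<delta> :: "'u \<Rightarrow> nat"
begin

text \<open>Rounding \<open>nu / 2\<close> down keeps the powers of \<open>q\<close>
  integral.\<close>

definition k :: nat where "k = nu div 2"

lemma k_table: "n \<ge> 13 \<Longrightarrow> k \<ge> 4" "n \<ge> 25 \<Longrightarrow> k \<ge> 6" "n \<ge> 37 \<Longrightarrow> k \<ge> 8" "n \<ge> 61 \<Longrightarrow> k \<ge> 12" "n \<ge> 85 \<Longrightarrow> k \<ge> 16"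
  using nu_table unfolding k_def by simp_all

lemma nu_ge_if:
  assumes "27 * m ^ 4 < 4 * n ^ 3"
  shows "nu > m"
proof (rule ccontr)
  assume "\<not> nu > m"
  hence "27 * nu ^ 4 \<le> 27 * m ^ 4" by (intro mult_left_mono power_mono) auto
  thus False using nu_power assms by linarith
qed

text \<open>This is the numerical condition of \<open>good_partial\<close> with \<open>j\<close> the
  ceiling of \<open>n / (2 * q)\<close>, after bounding \<open>1 + n\<close> by
  \<open>11/5 * q * j\<close>. For \<open>j < 10\<close> the table of \<open>k\<close> is enough.
  Otherwise \<open>q > j\<close> gives \<open>n + 1 >= 2 * j^2\<close>, the fourth-power bound gives
  \<open>k >= j\<close>, and powers of \<open>q >= 8\<close> outgrow
  \<open>j^3 * 2^j\<close>.\<close>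

lemma regime_partial_core:
  assumes q5: "q \<ge> 5" and j: "j \<ge> 1" "j \<le> q - 1" "2 * q * (j - 1) < n" and n: "n \<ge> 13" "j \<ge> 3 \<Longrightarrow> n \<ge> 25"
  shows "55 * j * 2 ^ j \<le> 19 * q ^ (k - 2)"
proof -
  have big: "55 * j * 2 ^ j \<le> 19 * q ^ (k - 2)" if "55 * j * 2 ^ j \<le> 19 * 5 ^ c" "c + 2 \<le> k" for c
  proof -
    have "(5 :: nat) ^ c \<le> q ^ c" using q5 by (intro power_mono) auto
    also have "\<dots> \<le> q ^ (k - 2)" using q2 that(2) by (intro power_increasing) auto
    finally show ?thesis using that(1) by linarith
  qed
  consider "j \<le> 2" | "3 \<le> j" "j \<le> 4" | "5 \<le> j" "j \<le> 9" | "j \<ge> 10" by linarith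
  thus ?thesis
  proof cases
    case 1
    hence "j = 1 \<or> j = 2" using j by auto
    thus ?thesis using k_table(1)[OF n(1)] by (intro big[of 2]) auto
  next
    case 2
    hence "j = 3 \<or> j = 4" by auto
    thus ?thesis using k_table(2) n by (intro big[of 4]) auto
  next
    case 3
    have "2 * q * (j - 1) \<ge> 2 * 5 * 4" using 3 q5 by (intro mult_le_mono) auto
    hence "n \<ge> 37" using j(3) by linarith
    moreover have "j = 5 \<or> j = 6 \<or> j = 7 \<or> j = 8 \<or> j = 9" using 3 by auto
    ultimately show ?thesis using k_table(3) by (intro big[of 6]) auto
  next
    case 4
    have "2 * q * (j - 1) \<ge> 2 * (j + 1) * (j - 1)" using j 4 by (intro mult_le_mono) auto
    moreover have "2 * (j + 1) * (j - 1) + 2 = 2 * j\<^sup>2"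
      using 4 by (cases j) (auto simp: power2_eq_square algebra_simps)
    ultimately have n1: "n + 1 \<ge> 2 * j\<^sup>2" using j(3) by linarith
    have jj: "j\<^sup>2 \<ge> 10 * j" using 4 by (simp add: power2_eq_square)
    hence n2: "n \<ge> 19 * j" "n \<ge> j\<^sup>2" using n1 4 by linarith+
    have "nu > 2 * j"
    proof (rule nu_ge_if)
      have "27 * (2 * j) ^ 4 = 432 * j ^ 4" by (simp add: power_mult_distrib)
      also have "\<dots> < 4 * (19 * j * (j\<^sup>2 * j\<^sup>2))"
      proof -
        have "j * j ^ 4 \<ge> 10 * j ^ 4" "j ^ 4 > 0" using 4 by auto
        moreover have "19 * j * (j\<^sup>2 * j\<^sup>2) = 19 * (j * j ^ 4)" by (simp add: power2_eq_square power4_eq_xxxx mult.assoc)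
        ultimately show ?thesis by linarith
      qed
      also have "\<dots> \<le> 4 * (n * (n * n))" using n2 by (intro mult_le_mono mult_le_mono2 order_refl) auto
      also have "\<dots> = 4 * n ^ 3" by (simp add: power3_eq_cube mult.assoc)
      finally show "27 * (2 * j) ^ 4 < 4 * n ^ 3" .
    qed
    hence kj: "k \<ge> j" by (simp add: k_def)
    have k16: "k \<ge> 16" using k_table(5) n2 4 by linarith
    have "55 * j * 2 ^ j \<le> 19 * 8 ^ (k - 2)"
    proof -
      have "55 * j \<le> 19 * j ^ 3"
      proof -
        have "55 \<le> 19 * (j * j)" using mult_le_mono[OF 4 4] by linarith
        hence "55 * j \<le> 19 * (j * j) * j" by (rule mult_le_mono1)
        thus ?thesis by (simp only: power3_eq_cube mult.assoc)
      qed
      also have "\<dots> \<le> 19 * 2 ^ j" using cube_le_two_power[OF 4] by simp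
      finally have "55 * j * 2 ^ j \<le> 19 * 2 ^ j * 2 ^ j" by (rule mult_le_mono1)
      also have "\<dots> = 19 * 2 ^ (2 * j)" by (simp add: power_add[symmetric] mult.assoc)
      also have "\<dots> \<le> 19 * 2 ^ (3 * (k - 2))" using kj k16 by (intro mult_left_mono power_increasing) auto
      also have "(2 :: nat) ^ (3 * (k - 2)) = 8 ^ (k - 2)" by (simp add: power_mult)
      finally show ?thesis .
    qed
    also have "\<dots> \<le> 19 * q ^ (k - 2)" using j 4 by (intro mult_left_mono power_mono) auto
    finally show ?thesis .
  qed
qed

lemma regime_partial:
  assumes q5: "q \<ge> 5" and n: "n \<ge> 13" "n \<le> 2 * q * (q - 1)" and ex: "\<not> (q = 5 \<and> n = 24)"
  shows "good (real q ^ k * (19 / 25))"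
proof -
  define j where "j = (n + 2 * q - 1) div (2 * q)"
  have q0: "2 * q > 0" using q5 by simp
  have j1: "n \<le> 2 * q * j"
  proof -
    have "n + 2 * q - 1 < 2 * q * (j + 1)" unfolding j_def using dividend_less_times_div[OF q0, of "n + 2 * q - 1"] by simp
    thus ?thesis using q0 by (simp add: algebra_simps)
  qed
  have j2: "2 * q * (j - 1) < n"
  proof -
    have "2 * q * j \<le> n + 2 * q - 1" unfolding j_def by (rule times_div_less_eq_dividend)
    thus ?thesis using n q0 by (cases j) auto
  qed
  have jpos: "j \<ge> 1" using j1 n by (cases j) auto
  have jq: "j \<le> q - 1"
  proof (rule ccontr)
    assume "\<not> j \<le> q - 1"
    hence "2 * q * (q - 1) \<le> 2 * q * (j - 1)" by (intro mult_le_mono2) auto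
    thus False using j2 n by linarith
  qed
  \<comment> \<open>\<open>j >= 3\<close> means \<open>n > 4 * q >= 20\<close>, and below 25 this
    leaves only \<open>n = 24\<close> with \<open>q = 5\<close>, the excluded pair.\<close>
  have n25: "n \<ge> 25" if "j \<ge> 3"
  proof (rule ccontr)
    assume a: "\<not> n \<ge> 25"
    hence "n \<in> {18, 20, 24}" using n_small(1) n by auto
    moreover have "2 * q * 2 \<le> 2 * q * (j - 1)" using that by (intro mult_le_mono2) auto
    hence "4 * q < n" using j2 by linarith
    ultimately show False using q5 ex by auto
  qed
  have core: "55 * j * 2 ^ j \<le> 19 * q ^ (k - 2)"
    by (rule regime_partial_core[OF q5 jpos jq j2 n(1) n25])
  have qj: "5 \<le> q * j" using mult_le_mono[OF q5 jpos] by simp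
  have "5 * (1 + n) \<le> 11 * (q * j)" using j1 qj by (simp add: mult.assoc)
  hence "5 * (1 + n) * (5 * 2 ^ j * q) \<le> 11 * (q * j) * (5 * 2 ^ j * q)" by (rule mult_le_mono1)
  moreover have "5 * (1 + n) * (5 * 2 ^ j * q) = 25 * (2 ^ j * (1 + n) * q)" by (simp add: algebra_simps)
  moreover have "11 * (q * j) * (5 * 2 ^ j * q) = 55 * j * 2 ^ j * (q * q)" by (simp add: algebra_simps)
  ultimately have "25 * (2 ^ j * (1 + n) * q) \<le> 55 * j * 2 ^ j * (q * q)" by (simp only:)
  also have "\<dots> \<le> 19 * q ^ (k - 2) * (q * q)" using core by (rule mult_le_mono1)
  also have "\<dots> = 19 * q ^ k"
  proof -
    have "k \<ge> 4" using k_table(1) n by simp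
    hence e: "k = (k - 2) + 2" by simp
    have "q ^ k = q ^ (k - 2) * q ^ 2" using arg_cong[OF e, of "power q"] by (simp only: power_add)
    thus ?thesis by (simp add: power2_eq_square)
  qed
  finally have "real (25 * (2 ^ j * (1 + n) * q)) \<le> real (19 * q ^ k)" by (rule of_nat_mono)
  hence "2 ^ j * (1 + real n) * real q \<le> real q ^ k * (19 / 25)" by (simp add: algebra_simps)
  thus ?thesis by (intro good_partial[OF j1 jq])
qed

text \<open>All one-dimensional subspaces are sieved. Dimension 2 contributes at most 1/2 to the
  union bound, and the tail at most 1/3 because \<open>n < q ^ 3\<close>; hence the 5/6.\<close>

lemma regime_s1:
  assumes q5: "q \<ge> 5" and n: "2 * q * (q - 1) < n" "n < q ^ 3"
  shows "good (real q ^ k * (19 / 25))"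
proof -
  have "2 * q * (q - 1) \<ge> 2 * 5 * 4" using q5 by (intro mult_le_mono) auto
  hence n41: "n \<ge> 41" using n by linarith
  have kq: "2 * k \<ge> q + 8"
  proof -
    consider "q \<le> 6" | "7 \<le> q" "q \<le> 24" | "q \<ge> 25" by linarith
    thus ?thesis
    proof cases
      case 1
      thus ?thesis using k_table(3) n41 by linarith
    next
      case 2
      have "2 * q * (q - 1) \<ge> 2 * 7 * 6" using 2 by (intro mult_le_mono) auto
      thus ?thesis using k_table(5) n 2 by linarith
    next
      case 3
      have "nu > 2 * q"
      proof (rule nu_ge_if)
        have qq: "q * q \<ge> 25 * q" using 3 by simp
        have "n \<ge> q * q"
        proof -
          have "2 * q * (q - 1) + 2 * q = 2 * (q * q)" using 3 by (cases q) auto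
          thus ?thesis using n(1) qq 3 by linarith
        qed
        hence "(q * q) * ((q * q) * (q * q)) \<le> n * (n * n)" by (intro mult_le_mono)
        hence "4 * ((q * q) * q ^ 4) \<le> 4 * n ^ 3" by (simp add: eval_nat_numeral mult.assoc)
        moreover have "625 * q ^ 4 \<le> (q * q) * q ^ 4" using mult_le_mono[OF 3 3] by (intro mult_le_mono1) simp
        moreover have "27 * (2 * q) ^ 4 = 432 * q ^ 4" by (simp add: power_mult_distrib)
        moreover have "q ^ 4 > 0" using 3 by simp
        ultimately show "27 * (2 * q) ^ 4 < 4 * n ^ 3" by linarith
      qed
      thus ?thesis using 3 by (simp add: k_def)
    qed
  qed
  show ?thesis
  proof (rule good_cut[of 1 2 "q - 1" "\<lambda>d. real q ^ d / real d" n "5 / 6"])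
    show "card {u \<in> A. \<delta> u \<le> 1} \<le> q - 1" using card_le_1 card_eq_le[of 1] by simp
    have "{1<..2 :: nat} = {2}" by auto
    hence "(\<Sum>d\<in>{1<..2}. real q ^ d / real d / real q ^ d) = 1 / 2" using q5 by simp
    moreover have "real n / (real (2 + 1) * real q ^ (2 + 1)) \<le> 1 / real (2 + 1)"
      by (rule frac_le_inverse) (use n q5 in auto)
    ultimately show "(\<Sum>d\<in>{1<..2}. real q ^ d / real d / real q ^ d) + real n / (real (2 + 1) * real q ^ (2 + 1)) \<le> 5 / 6"
      by simp
    have "2 ^ (q - 1) * (2 + n) * 75 \<le> 19 * q ^ k"
    proof -
      have k3: "k \<ge> 3" using kq q5 by linarith
      have q3: "5 ^ 3 \<le> q ^ 3" using q5 by (rule power_mono) simp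
      have "(2 :: nat) ^ (q - 1) * (2 + n) * 75 \<le> 2 ^ (q - 1) * (2 * q ^ 3) * 75"
        using n q3 by (intro mult_le_mono order_refl) auto
      also have "\<dots> \<le> 19 * (2 ^ (q - 1) * 8) * q ^ 3" by simp
      also have "(2 :: nat) ^ (q - 1) * 8 = 2 ^ (q + 2)"
      proof -
        have "q + 2 = (q - 1) + 3" using q5 by simp
        thus ?thesis by (simp only: power_add) simp
      qed
      also have "19 * 2 ^ (q + 2) * q ^ 3 \<le> 19 * 2 ^ (2 * (k - 3)) * q ^ 3"
        using kq k3 by (intro mult_le_mono order_refl power_increasing) auto
      also have "\<dots> = 19 * 4 ^ (k - 3) * q ^ 3" by (simp add: power_mult)
      also have "\<dots> \<le> 19 * q ^ (k - 3) * q ^ 3" using q5 by (intro mult_le_mono order_refl power_mono) auto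
      also have "\<dots> = 19 * q ^ k" using k3 by (simp add: mult.assoc flip: power_add)
      finally show ?thesis .
    qed
    hence "real (2 ^ (q - 1) * (2 + n) * 75) \<le> real (19 * q ^ k)" by (rule of_nat_mono)
    thus "2 ^ (q - 1) * (1 + real n / real (1 + 1)) \<le> real q ^ k * (19 / 25) * (1 - 5 / 6)"
      by (simp add: field_simps)
  qed (use sum_gt_le card_eq_le_real in auto)
qed

lemma good_s2:
  assumes n: "n < q ^ 6" and a: "2 * a = q ^ 2 + q - 2"
    and X: "20 * (2 ^ a * (1 + real n / 3)) \<le> X"
  shows "good X"
proof (rule good_cut[of 2 5 a "\<lambda>d. real q ^ d / real d" n "19 / 20"])
  show "card {u \<in> A. \<delta> u \<le> 2} \<le> a" using card_le_2 a by simp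
  have "{2<..5 :: nat} = {3, 4, 5}" by auto
  hence "(\<Sum>d\<in>{2<..5}. real q ^ d / real d / real q ^ d) = 1 / 3 + 1 / 4 + 1 / 5" using q2 by simp
  moreover have "real n / (real (5 + 1) * real q ^ (5 + 1)) \<le> 1 / real (5 + 1)"
    by (rule frac_le_inverse) (use n q2 in auto)
  ultimately show "(\<Sum>d\<in>{2<..5}. real q ^ d / real d / real q ^ d) + real n / (real (5 + 1) * real q ^ (5 + 1)) \<le> 19 / 20"
    by simp
  obtain Z where Z: "Z = 2 ^ a * (1 + real n / 3)" by blast
  have "20 * Z \<le> X" using X unfolding Z .
  hence "Z \<le> X * (1 - 19 / 20)" by simp
  thus "2 ^ a * (1 + real n / real (2 + 1)) \<le> X * (1 - 19 / 20)" unfolding Z by simp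
qed (use sum_gt_le card_eq_le_real in auto)

lemma regime_s2:
  assumes q5: "q \<ge> 5" and n: "q ^ 3 \<le> n" "n < q ^ 6"
  shows "good (real q ^ k * (19 / 25))"
proof -
  have ev: "even (q ^ 2 + q - 2)" using q5 by (simp add: power2_eq_square)
  define a where "a = (q ^ 2 + q - 2) div 2"
  have a: "2 * a = q ^ 2 + q - 2" using ev by (simp add: a_def)
  have "5 ^ 3 \<le> q ^ 3" using q5 by (rule power_mono) simp
  hence n125: "n \<ge> 125" using n by simp
  have k16: "k \<ge> 16" using k_table(5) n125 by simp
  \<comment> \<open>The factor 9 is the least integer absorbing the constants of
    \<open>good_s2\<close>: 20/27 is at most 19/25.\<close>
  have main: "9 * 2 ^ a * (3 + n) \<le> q ^ k"
  proof (cases "q \<le> 6")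
    case True
    hence "q = 5 \<or> q = 6" using q5 by auto
    thus ?thesis
    proof
      assume q: "q = 5"
      have "9 * 2 ^ a * (3 + n) \<le> 9 * 2 ^ 14 * (3 + 15625)"
        using n(2) a q by (intro mult_le_mono power_increasing) auto
      also have "\<dots> \<le> 5 ^ 16" by simp
      also have "\<dots> \<le> q ^ k" unfolding q using k16 by (intro power_increasing) auto
      finally show ?thesis .
    next
      assume q: "q = 6"
      have "9 * 2 ^ a * (3 + n) \<le> 9 * 2 ^ 20 * (3 + 46656)"
        using n(2) a q by (intro mult_le_mono power_increasing) auto
      also have "\<dots> \<le> 6 ^ 16" by simp
      also have "\<dots> \<le> q ^ k" unfolding q using k16 by (intro power_increasing) auto
      finally show ?thesis .
    qed
  next
    case False
    hence q7: "q \<ge> 7" by simp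
    have "nu > q\<^sup>2 - 1"
    proof (rule nu_ge_if)
      have "27 * (q\<^sup>2 - 1) ^ 4 \<le> 27 * (q\<^sup>2) ^ 4" by (intro mult_le_mono power_mono) auto
      also have "\<dots> = 27 * q ^ 8" by (simp flip: power_mult)
      also have "\<dots> < 4 * (7 * q ^ 8)" using q7 by simp
      also have "\<dots> \<le> 4 * (q * q ^ 8)" using q7 by (intro mult_le_mono2 mult_le_mono1)
      also have "\<dots> = 4 * (q ^ 3) ^ 3" by (simp flip: power_mult power_Suc)
      also have "\<dots> \<le> 4 * n ^ 3" using n by (intro mult_le_mono2 power_mono) auto
      finally show "27 * (q\<^sup>2 - 1) ^ 4 < 4 * n ^ 3" .
    qed
    hence kq: "2 * k + 1 \<ge> q\<^sup>2" by (simp add: k_def)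
    have qq: "q\<^sup>2 \<ge> 7 * q" using q7 by (simp add: power2_eq_square)
    have ak: "a + 4 \<le> 2 * (k - 6)" using kq qq a q7 by linarith
    have "9 * 2 ^ a * (3 + n) \<le> 2 ^ 4 * 2 ^ a * q ^ 6"
    proof -
      have "7 ^ 6 \<le> q ^ 6" using q7 by (rule power_mono) simp
      hence "9 * (3 + n) \<le> 16 * q ^ 6" using n by simp
      thus ?thesis by (simp add: mult_ac)
    qed
    also have "\<dots> = 2 ^ (a + 4) * q ^ 6" by (simp add: power_add)
    also have "\<dots> \<le> 2 ^ (2 * (k - 6)) * q ^ 6" using ak by (intro mult_le_mono1 power_increasing) auto
    also have "\<dots> = 4 ^ (k - 6) * q ^ 6" by (simp add: power_mult)
    also have "\<dots> \<le> q ^ (k - 6) * q ^ 6" using q7 by (intro mult_le_mono1 power_mono) auto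
    also have "\<dots> = q ^ k" using k16 by (simp flip: power_add)
    finally show ?thesis .
  qed
  hence "real (9 * 2 ^ a * (3 + n)) \<le> real (q ^ k)" by (rule of_nat_mono)
  hence m: "9 * 2 ^ a * (3 + real n) \<le> real q ^ k" by simp
  have "20 * (2 ^ a * (1 + real n / 3)) = (20 / 27) * (9 * 2 ^ a * (3 + real n))" by (simp add: field_simps)
  also have "\<dots> \<le> (20 / 27) * real q ^ k" using m by (intro mult_left_mono) auto
  also have "\<dots> \<le> real q ^ k * (19 / 25)" by simp
  finally show ?thesis by (intro good_s2[OF n(2) a])
qed

text \<open>The cut-offs \<open>s\<close> and \<open>2 * s + 1\<close> are chosen so that the union
  bound is a sum of reciprocals from \<open>s + 1\<close> to \<open>2 * s + 2\<close>, the last one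
  covering the tail; the factor 20 is \<open>1 / (1 - 19/20)\<close>.\<close>

lemma good_s:
  assumes s: "s \<ge> 2" and n: "n < q ^ (2 * s + 2)" "n \<ge> 2"
    and X: "20 * (2 ^ (q ^ s) * real n) \<le> X"
  shows "good X"
proof (rule good_cut[of s "2 * s + 1" "q ^ s" "\<lambda>d. real q ^ d / real d" n "19 / 20"])
  show "card {u \<in> A. \<delta> u \<le> s} \<le> q ^ s" by (rule card_le_power)
  have "(\<Sum>d\<in>{s<..2 * s + 1}. real q ^ d / real d / real q ^ d) = (\<Sum>d\<in>{s<..2 * s + 1}. 1 / real d)"
    using q2 by (intro sum.cong) auto
  moreover have "real n / (real (2 * s + 1 + 1) * real q ^ (2 * s + 1 + 1)) \<le> 1 / real (2 * s + 1 + 1)"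
    by (rule frac_le_inverse) (use n q2 in auto)
  moreover have "(\<Sum>d\<in>{s<..2 * s + 2}. 1 / real d) = 1 / real (2 * s + 2) + (\<Sum>d\<in>{s<..2 * s + 1}. 1 / real d)"
  proof -
    have "{s<..2 * s + 2} = insert (2 * s + 2) {s<..2 * s + 1}" by auto
    thus ?thesis by simp
  qed
  ultimately show "(\<Sum>d\<in>{s<..2 * s + 1}. real q ^ d / real d / real q ^ d)
      + real n / (real (2 * s + 1 + 1) * real q ^ (2 * s + 1 + 1)) \<le> 19 / 20"
    using sum_reciprocals_le[OF s] by (simp only: add.assoc one_add_one)
  have "1 + real n / real (s + 1) \<le> real n"
  proof -
    have "real n / real (s + 1) \<le> real n / 2" using s by (intro divide_left_mono) auto
    moreover have "real n \<ge> 2" using n(2) by simp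
    ultimately show ?thesis by linarith
  qed
  hence "2 ^ (q ^ s) * (1 + real n / real (s + 1)) \<le> 2 ^ (q ^ s) * real n" by (intro mult_left_mono) auto
  also have "\<dots> \<le> X / 20" using X by simp
  finally show "2 ^ (q ^ s) * (1 + real n / real (s + 1)) \<le> X * (1 - 19 / 20)" by simp
qed (use s sum_gt_le card_eq_le_real in auto)

text \<open>The sieve costs \<open>2 ^ z\<close> with \<open>z = q ^ s\<close> at most
  \<open>sqrt n\<close>, while \<open>k\<close> is at least of order \<open>n ^ (3/4)\<close>. The
  constant 36 is 20 divided by 5/9.\<close>

lemma regime_large:
  assumes q3: "q \<ge> 3" and s: "s \<ge> 3" and n: "q ^ (2 * s) \<le> n" "n < q ^ (2 * s + 2)"
  shows "good (real q ^ k * (5 / 9))"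
proof -
  define z where "z = q ^ s"
  have z27: "z \<ge> 27"
  proof -
    have "3 ^ 3 \<le> q ^ 3" using q3 by (rule power_mono) simp
    also have "\<dots> \<le> q ^ s" using s q3 by (intro power_increasing) auto
    finally show ?thesis by (simp add: z_def)
  qed
  have nz: "z ^ 2 \<le> n" using n(1) by (simp add: z_def power_mult[symmetric] mult.commute)
  have nz3: "n \<le> z ^ 3"
  proof -
    have "q ^ 2 \<le> q ^ s" using s q3 by (intro power_increasing) auto
    hence "q ^ 2 * (q ^ s) ^ 2 \<le> q ^ s * (q ^ s) ^ 2" by (rule mult_le_mono1)
    moreover have "q ^ (2 * s + 2) = q ^ 2 * (q ^ s) ^ 2" by (simp only: power_add power_even_eq) (rule mult.commute)
    ultimately have "n \<le> q ^ s * (q ^ s) ^ 2" using n(2) by linarith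
    thus ?thesis by (simp only: z_def power2_eq_square power3_eq_cube mult.assoc)
  qed
  have "nu > 3 * z"
  proof (rule nu_ge_if)
    have "(27 :: nat) * 27 \<le> z * z" using z27 by (intro mult_le_mono)
    hence "729 * z ^ 4 \<le> (z * z) * z ^ 4" by (intro mult_le_mono1) simp
    moreover have "(z * z) * z ^ 4 = (z ^ 2) ^ 3" by (simp add: power2_eq_square power3_eq_cube power4_eq_xxxx mult_ac)
    moreover have "(z ^ 2) ^ 3 \<le> n ^ 3" using nz by (rule power_mono) simp
    moreover have "27 * (3 * z) ^ 4 = 2187 * z ^ 4" by (simp add: power_mult_distrib)
    moreover have "z ^ 4 > 0" using z27 by simp
    ultimately show "27 * (3 * z) ^ 4 < 4 * n ^ 3" by linarith
  qed
  hence kz: "2 * k \<ge> 3 * z" by (simp add: k_def)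
  have "36 * (2 ^ z * z ^ 3) \<le> q ^ k"
  proof -
    have z3: "z ^ 3 \<le> 2 ^ z" using z27 by (intro cube_le_two_power) simp
    \<comment> \<open>Fourth powers replace logarithms: \<open>2 * k >= 3 * z\<close> is used
      through \<open>2 ^ (9 * z) <= 64 ^ k <= 81 ^ k\<close>.\<close>
    have "(36 * (2 ^ z * z ^ 3)) ^ 4 \<le> (36 * (2 ^ z * 2 ^ z)) ^ 4" using z3 by (intro power_mono mult_le_mono order_refl) auto
    also have "\<dots> = 36 ^ 4 * 2 ^ (8 * z)"
      by (simp add: power_mult_distrib power_add[symmetric] power_mult[symmetric])
    also have "\<dots> \<le> 2 ^ 21 * 2 ^ (8 * z)" by (intro mult_le_mono1) simp
    also have "\<dots> \<le> 2 ^ z * 2 ^ (8 * z)" using z27 by (intro mult_le_mono1 power_increasing) auto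
    also have "\<dots> = 2 ^ (9 * z)" by (simp add: power_add[symmetric])
    also have "\<dots> \<le> 2 ^ (6 * k)" using kz by (intro power_increasing) auto
    also have "\<dots> = 64 ^ k" by (simp add: power_mult)
    also have "\<dots> \<le> 81 ^ k" by (intro power_mono) auto
    also have "\<dots> = (3 ^ 4) ^ k" by simp
    also have "\<dots> = (3 ^ k) ^ 4" by (simp only: power_mult[symmetric] mult.commute)
    also have "\<dots> \<le> (q ^ k) ^ 4" using q3 by (intro power_mono) auto
    finally show ?thesis by (simp only: power_mono_iff zero_less_numeral le0)
  qed
  moreover have "36 * (2 ^ z * n) \<le> 36 * (2 ^ z * z ^ 3)" using nz3 by simp
  ultimately have "36 * (2 ^ z * n) \<le> q ^ k" by linarith
  hence "real (36 * (2 ^ z * n)) \<le> real (q ^ k)" by (rule of_nat_mono)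
  hence "20 * (2 ^ z * real n) \<le> real q ^ k * (5 / 9)" by (simp add: mult_ac)
  moreover have "n \<ge> 2" using n_ge by simp
  ultimately show ?thesis unfolding z_def using s n(2) by (intro good_s[of s]) auto
qed

lemma regime_large_2:
  assumes q: "q = 2" and s: "s \<ge> 5" and n: "2 ^ (2 * s) \<le> n" "n < 2 ^ (2 * s + 2)"
  shows "good (2 ^ k * (1 / 4))"
proof -
  define e where "e = s - 1"
  \<comment> \<open>In terms of \<open>y\<close>, half of \<open>2 ^ s\<close>, the cost is about
    \<open>2 ^ (2 * y) * y ^ 2\<close>. Its square, constants included, is at most
    \<open>2 ^ (7 * y)\<close>, which explains the demand \<open>nu > 7 * y\<close>.\<close>
  define y :: nat where "y = 2 ^ e"
  have e: "s = Suc e" "e \<ge> 4" using s by (auto simp: e_def)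
  have ey: "4 * e \<le> y"
    unfolding y_def using e(2) by (induction e rule: dec_induct) auto
  have y16: "y \<ge> 16" using power_increasing[OF e(2), of "2 :: nat"] by (simp add: y_def)
  have y4: "y ^ 4 \<le> 2 ^ y"
  proof -
    have "y ^ 4 = 2 ^ (4 * e)" by (simp add: y_def power_mult[symmetric] mult.commute)
    also have "\<dots> \<le> 2 ^ y" using ey by (intro power_increasing) auto
    finally show ?thesis .
  qed
  have zs: "(2 :: nat) ^ s = 2 * y" by (simp add: e y_def)
  have z2: "(2 :: nat) ^ (2 * s) = 4 * y ^ 2"
  proof -
    have "(2 :: nat) ^ (2 * s) = (2 ^ s) ^ 2" by (simp add: power_mult[symmetric] mult.commute)
    thus ?thesis by (simp add: zs power_mult_distrib)
  qed
  have n1: "4 * y ^ 2 \<le> n" "n \<le> 16 * y ^ 2" using n z2 by auto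
  have "nu > 7 * y"
  proof (rule nu_ge_if)
    have "(16 :: nat) * 16 \<le> y * y" using y16 by (intro mult_le_mono)
    hence "256 * y ^ 4 \<le> (y * y) * y ^ 4" by (intro mult_le_mono1) simp
    moreover have "(4 * y ^ 2) ^ 3 = 64 * ((y * y) * y ^ 4)" by (simp add: power_mult_distrib power2_eq_square power3_eq_cube power4_eq_xxxx mult_ac)
    moreover have "(4 * y ^ 2) ^ 3 \<le> n ^ 3" using n1 by (intro power_mono) auto
    moreover have "27 * (7 * y) ^ 4 = 64827 * y ^ 4" by (simp add: power_mult_distrib)
    moreover have "y ^ 4 > 0" using y16 by simp
    ultimately show "27 * (7 * y) ^ 4 < 4 * n ^ 3" by linarith
  qed
  hence ky: "2 * k \<ge> 7 * y" by (simp add: k_def)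
  have "1280 * (2 ^ (2 * y) * y ^ 2) \<le> 2 ^ k"
  proof -
    have "(1280 * (2 ^ (2 * y) * y ^ 2)) ^ 2 = 1638400 * (2 ^ (4 * y) * y ^ 4)"
      by (simp add: power_mult_distrib power_mult[symmetric])
    also have "\<dots> \<le> 2 ^ 21 * (2 ^ (4 * y) * 2 ^ y)" using y4 by (intro mult_le_mono order_refl) auto
    also have "\<dots> \<le> 2 ^ (2 * y) * (2 ^ (4 * y) * 2 ^ y)" using y16 by (intro mult_le_mono1 power_increasing) auto
    also have "\<dots> = 2 ^ (7 * y)" by (simp add: power_add[symmetric])
    also have "\<dots> \<le> 2 ^ (2 * k)" using ky by (intro power_increasing) auto
    also have "\<dots> = (2 ^ k) ^ 2" by (simp add: power_mult[symmetric] mult.commute)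
    finally show ?thesis by (simp only: power_mono_iff zero_less_numeral le0)
  qed
  moreover have "80 * (2 ^ (2 * y) * n) \<le> 1280 * (2 ^ (2 * y) * y ^ 2)" using n1(2) by simp
  ultimately have "80 * (2 ^ (2 * y) * n) \<le> 2 ^ k" by linarith
  hence "real (80 * (2 ^ (2 * y) * n)) \<le> real (2 ^ k)" by (rule of_nat_mono)
  hence "20 * (2 ^ (2 * y) * real n) \<le> 2 ^ k * (1 / 4)" by simp
  moreover have "n \<ge> 2" using n_ge by simp
  ultimately show ?thesis using s n(2) q zs by (intro good_s[of s]) auto
qed

lemma regime_q4:
  assumes "q = 4" "25 \<le> n" "n < 4096"
  shows "good (4 ^ k * (11 / 16))"
proof (cases "n < 61")
  case True
  have "(4 :: real) ^ 6 \<le> 4 ^ k" using k_table(2) assms by (intro power_increasing) auto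
  thus ?thesis using True assms by (intro good_q4[of "3 / 4"]) auto
next
  case False
  have "20 * (2 ^ 9 * (1 + real n / 3)) \<le> 4 ^ k * (11 / 16)"
  proof (cases "n < 85")
    case True
    have "(4 :: real) ^ 12 \<le> 4 ^ k" using k_table(4) False by (intro power_increasing) auto
    moreover have "real n \<le> 85" using True by simp
    ultimately show ?thesis by simp
  next
    case False
    have "(4 :: real) ^ 16 \<le> 4 ^ k" using k_table(5) False by (intro power_increasing) auto
    moreover have "real n \<le> 4096" using assms by simp
    ultimately show ?thesis by simp
  qed
  thus ?thesis using assms by (intro good_s2[of 9]) auto
qed

lemma regime_q3:
  assumes "q = 3" "37 \<le> n" "n < 729"
  shows "good (3 ^ k * (5 / 9))"
proof (cases "n < 61")
  case True
  have k8: "(3 :: real) ^ 8 \<le> 3 ^ k" using k_table(3) assms by (intro power_increasing) auto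
  show ?thesis
  proof (rule good_cut[of 2 3 5 "\<lambda>_. 8" 60 "8 / 27 + 60 / 324"])
    show "card {u \<in> A. \<delta> u \<le> 2} \<le> 5" using card_le_2 assms by simp
    show "real (card {u \<in> A. \<delta> u = d}) \<le> 8" if "2 < d" "d \<le> 3" for d
      using that card_eq_div[of 3] assms by (cases "d = 3") auto
    have "{2<..3 :: nat} = {3}" by auto
    thus "(\<Sum>d\<in>{2<..3}. 8 / real q ^ d) + real (60 :: nat) / (real (3 + 1 :: nat) * real q ^ (3 + 1)) \<le> 8 / 27 + 60 / 324"
      using assms by simp
    show "(\<Sum>u | u \<in> A \<and> 2 < \<delta> u. \<delta> u) \<le> 60" using sum_gt_le[of 2] True by linarith
    show "2 ^ 5 * (1 + real (60 :: nat) / real (2 + 1 :: nat)) \<le> 3 ^ k * (5 / 9) * (1 - (8 / 27 + 60 / 324))" using k8 by simp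
  qed auto
next
  case False
  have "20 * (2 ^ 5 * (1 + real n / 3)) \<le> 3 ^ k * (5 / 9)"
  proof (cases "n < 85")
    case True
    have "(3 :: real) ^ 12 \<le> 3 ^ k" using k_table(4) False by (intro power_increasing) auto
    moreover have "real n \<le> 85" using True by simp
    ultimately show ?thesis by simp
  next
    case False
    have "(3 :: real) ^ 16 \<le> 3 ^ k" using k_table(5) False by (intro power_increasing) auto
    moreover have "real n \<le> 729" using assms by simp
    ultimately show ?thesis by simp
  qed
  thus ?thesis using assms by (intro good_s2[of 5]) auto
qed

text \<open>The counts 2, 3, 6 are \<open>(2 ^ d - 1) div d\<close> for \<open>d = 3, 4, 5\<close>;
  they contribute \<open>2/8 + 3/16 + 6/32 = 5/8\<close>, and 384 is
  \<open>6 * 2 ^ 6\<close>.\<close>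

lemma good_q2_s2:
  assumes "q = 2" "n \<le> R" "5 / 8 + real R / 384 \<le> l" "l < 1" "4 * (1 + real R / 3) \<le> X * (1 - l)"
  shows "good X"
proof (rule good_cut[of 2 5 2 "\<lambda>d. if d = 3 then 2 else if d = 4 then 3 else 6" R l])
  show "card {u \<in> A. \<delta> u \<le> 2} \<le> 2" using card_le_2 assms by simp
  show "real (card {u \<in> A. \<delta> u = d}) \<le> (if d = 3 then 2 else if d = 4 then 3 else 6)" if "2 < d" "d \<le> 5" for d
  proof -
    have "d = 3 \<or> d = 4 \<or> d = 5" using that by auto
    thus ?thesis using card_eq_div[of 3] card_eq_div[of 4] card_eq_div[of 5] assms by auto
  qed
  have "{2<..5 :: nat} = {3, 4, 5}" by auto
  thus "(\<Sum>d\<in>{2<..5}. (if d = 3 then 2 else if d = 4 then 3 else 6) / real q ^ d) + real R / (real (5 + 1 :: nat) * real q ^ (5 + 1)) \<le> l"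
    using assms by simp
  show "(\<Sum>u | u \<in> A \<and> 2 < \<delta> u. \<delta> u) \<le> R" using sum_gt_le[of 2] assms by linarith
qed (use assms in auto)

text \<open>For odd \<open>n\<close> the total dimension cannot be halved. In return
  \<open>n\<close> is not \<open>2 * L\<close> and \<open>L\<close> is odd, which pushes
  \<open>nu\<close> up to 24.\<close>

lemma regime_q2_odd:
  assumes "q = 2" "37 \<le> n" "n < 61" "odd n"
  shows "good (2 ^ k * (1 / 4))"
proof -
  have nL: "n \<noteq> 2 * L" using assms by auto
  have "odd L" using L_dvd assms(4) by (elim dvdE) auto
  have "L \<ge> 13"
  proof (rule ccontr)
    assume "\<not> L \<ge> 13"
    hence "L \<in> {6, 10, 12, 14, 15, 18}" using primepow_small(2)[OF L_gt_1 L_npp] by simp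
    thus False using \<open>odd L\<close> \<open>\<not> L \<ge> 13\<close> by auto
  qed
  hence "totient L \<ge> 6" using totient_ge(2)[of L] by simp
  hence "nu \<ge> 24" using nu_ge3[OF nL] assms by linarith
  hence "k \<ge> 12" by (simp add: k_def)
  hence "(2 :: real) ^ 12 \<le> 2 ^ k" by (intro power_increasing) auto
  thus ?thesis using assms by (intro good_q2_s2[of 60 "25 / 32"]) auto
qed

text \<open>The sieving level rises from 2 to 3 to 4 with \<open>n\<close>, as \<open>k\<close>
  grows enough to pay for it. The counts 3, 6, 10, 18, 31 are \<open>(2 ^ d - 1) div d\<close> for
  \<open>d\<close> from 4 to 8.\<close>

lemma regime_q2:
  assumes "q = 2" "61 \<le> n" "n < 1024"
  shows "good (2 ^ k * (1 / 4))"
proof -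
  consider "n < 85" | "85 \<le> n" "n < 400" | "400 \<le> n" by linarith
  thus ?thesis
  proof cases
    case 1
    have "(2 :: real) ^ 12 \<le> 2 ^ k" using k_table(4) assms by (intro power_increasing) auto
    thus ?thesis using assms 1 by (intro good_q2_s2[of 84 "27 / 32"]) auto
  next
    case 2
    have k16: "(2 :: real) ^ 16 \<le> 2 ^ k" using k_table(5) 2 by (intro power_increasing) auto
    show ?thesis
    proof (rule good_cut[of 3 8 4 "\<lambda>d. if d = 4 then 3 else if d = 5 then 6 else if d = 6 then 10 else if d = 7 then 18 else 31" 400 "22 / 25"])
      show "card {u \<in> A. \<delta> u \<le> 3} \<le> 4" using card_le_3_split card_le_2 card_eq_div[of 3] assms by simp
      show "real (card {u \<in> A. \<delta> u = d}) \<le> (if d = 4 then 3 else if d = 5 then 6 else if d = 6 then 10 else if d = 7 then 18 else 31)"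
        if "3 < d" "d \<le> 8" for d
      proof -
        have "d = 4 \<or> d = 5 \<or> d = 6 \<or> d = 7 \<or> d = 8" using that by auto
        thus ?thesis using card_eq_div[of 4] card_eq_div[of 5] card_eq_div[of 6] card_eq_div[of 7] card_eq_div[of 8] assms by auto
      qed
      have "{3<..8 :: nat} = {4, 5, 6, 7, 8}" by auto
      thus "(\<Sum>d\<in>{3<..8}. (if d = 4 then 3 else if d = 5 then 6 else if d = 6 then 10 else if d = 7 then 18 else 31) / real q ^ d)
        + real (400 :: nat) / (real (8 + 1 :: nat) * real q ^ (8 + 1)) \<le> 22 / 25" using assms by simp
      show "(\<Sum>u | u \<in> A \<and> 3 < \<delta> u. \<delta> u) \<le> 400" using sum_gt_le[of 3] 2 by linarith
      show "2 ^ 4 * (1 + real (400 :: nat) / real (3 + 1 :: nat)) \<le> 2 ^ k * (1 / 4) * (1 - 22 / 25)" using k16 by simp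
    qed auto
  next
    case 3
    have "nu > 54"
    proof (rule nu_ge_if)
      have "400 ^ 3 \<le> n ^ 3" using 3 by (rule power_mono) simp
      thus "27 * 54 ^ 4 < 4 * n ^ 3" by simp
    qed
    hence "k \<ge> 27" by (simp add: k_def)
    hence k27: "(2 :: real) ^ 27 \<le> 2 ^ k" by (intro power_increasing) auto
    show ?thesis
    proof (rule good_cut[of 4 9 7 "\<lambda>d. real q ^ d / real d" 1024 "19 / 20"])
      show "card {u \<in> A. \<delta> u \<le> 4} \<le> 7"
        using card_le_4_split card_le_3_split card_le_2 card_eq_div[of 3] card_eq_div[of 4] assms by simp
      have "{4<..9 :: nat} = {5, 6, 7, 8, 9}" by auto
      thus "(\<Sum>d\<in>{4<..9}. real q ^ d / real d / real q ^ d) + real (1024 :: nat) / (real (9 + 1 :: nat) * real q ^ (9 + 1)) \<le> 19 / 20"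
        using assms by simp
      show "(\<Sum>u | u \<in> A \<and> 4 < \<delta> u. \<delta> u) \<le> 1024" using sum_gt_le[of 4] assms by linarith
      show "2 ^ 7 * (1 + real (1024 :: nat) / real (4 + 1 :: nat)) \<le> 2 ^ k * (1 / 4) * (1 - 19 / 20)" using k27 by simp
    qed (use card_eq_le_real in auto)
  qed
qed

end

section \<open>Normal elements with prescribed norms\<close>

lemma not_primepowI:
  fixes m :: nat
  assumes "prime a" "prime b" "a \<noteq> b" "a dvd m" "b dvd m"
  shows "\<not> primepow m"
proof
  assume "primepow m"
  then obtain p j where p: "prime p" "m = p ^ j" by (auto simp: primepow_def)
  have "a = p" "b = p" using assms p by (metis prime_dvd_power primes_dvd_imp_eq)+
  thus False using assms by simp
qed

lemma coprime_power_minus_1: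
  fixes q :: nat
  assumes "q > 0" "s dvd q ^ j" "D > 0"
  shows "coprime s (q ^ D - 1)"
proof -
  have "coprime (q ^ D) (q ^ D - 1)" using assms(1) by (intro coprime_diff_one_right_nat) simp
  moreover have "q dvd q ^ D" using assms(3) by (intro dvd_power) auto
  ultimately have "coprime q (q ^ D - 1)" using coprime_divisors[of q "q ^ D" "q ^ D - 1" "q ^ D - 1"] by simp
  hence "coprime (q ^ j) (q ^ D - 1)" by (cases "j = 0") (simp_all only: coprime_power_left_iff power_0 coprime_1_left simp_thms)
  thus ?thesis using coprime_divisors[OF assms(2) dvd_refl] by blast
qed

context field_ext
begin

lemma dims_minimals:
  assumes "n = s * N" "s dvd q ^ j"
  shows "dims q n N minimals fdim"
proof
  show "q \<ge> 2" using q_gt_1 by simp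
  show "fdim u \<ge> 1" if "u \<in> minimals" for u using card_minimal(2)[OF that] by simp
  show "(\<Sum>U | U \<in> minimals \<and> fdim U dvd D. fdim U) \<le> gcd n (q ^ D - 1)" for D by (rule sum_fdim_dvd)
  show "(\<Sum>U\<in>minimals. fdim U) \<le> N"
    using coprime_power_minus_1[OF _ assms(2)] q_gt_1 by (intro sum_fdim_total[OF assms(1)]) auto
qed auto

end

context field_ext_char
begin

lemma normal_of_good:
  fixes \<alpha> :: 'a
  assumes "dims q n N minimals fdim" "dims.good q minimals fdim X"
    and M: "M dvd q ^ n - 1" "X * sqrt (real q) ^ n \<le> real M" and a: "\<alpha> \<noteq> 0"
  shows "\<exists>x. x ^ M = 1 \<and> normal_over_GF q n (\<alpha> * x)"
proof -
  interpret dims q n N minimals fdim by fact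
  obtain H where H: "H \<subseteq> minimals" "lam H < 1" "2 ^ card H * (1 + real (card (minimals - H))) \<le> X * (1 - lam H)"
    using assms(2) unfolding good_def by auto
  have "0 < 2 ^ card H * (1 + real (card (minimals - H)))" by (intro mult_pos_pos) auto
  hence "0 < X * (1 - lam H)" using H(3) by linarith
  hence "X > 0" using H(2) by (simp add: zero_less_mult_iff)
  thus ?thesis using H M a by (intro normal_in_coset_split[of M \<alpha> H X "lam H"]) (auto simp: lam_def)
qed

text \<open>Everything is sieved, and both \<open>sqrt (q ^ n - M)\<close> and the
  \<open>- 1\<close> are retained. For \<open>n = 12\<close> the coarse criterion just fails: the
  known ratio is 3 against 4 for \<open>q = 2\<close>, and 7 against 8 for
  \<open>q = 3\<close>.\<close>

lemma normal_in_coset_all: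
  fixes \<alpha> :: 'a
  assumes M: "M dvd q ^ n - 1" and a: "\<alpha> \<noteq> 0" and c: "card minimals \<le> c"
    and E: "real (q ^ n) - real M \<le> E ^ 2" "E \<ge> 0" "E * (2 ^ c - 1) < real M"
  shows "\<exists>x. x ^ M = 1 \<and> normal_over_GF q n (\<alpha> * x)"
proof (rule normal_in_coset[OF M a, of minimals "{}"])
  have "sqrt (real (q ^ n) - real M) \<le> E" using E(1,2) by (intro real_le_lsqrt) auto
  moreover have "(2 :: real) ^ card minimals \<le> 2 ^ c" using c by (intro power_increasing) auto
  moreover have "(1 :: real) \<le> 2 ^ card minimals" by simp
  ultimately have "sqrt (real (q ^ n) - real M) * (2 ^ card minimals - 1) \<le> E * (2 ^ c - 1)"
    using E(2) by (intro mult_mono) auto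
  thus "sqrt (real (q ^ n) - real M) * (2 ^ card minimals * (1 + real (card {})) - (1 + (\<Sum>U\<in>{}. 1 / real (card U))))
      < real M * (1 - (\<Sum>U\<in>{}. 1 / real (card U)))" using E(3) by simp
qed auto

text \<open>By Bezout an element of order dividing \<open>B\<close> splits as
  \<open>y * \<theta>\<close> with \<open>y ^ M = 1\<close> and
  \<open>\<theta> ^ ((q - 1) ^ 2) = 1\<close>, and \<theta> may be dropped without losing normality.
  The value \<open>B + 1\<close> in place of 1 keeps the multipliers natural numbers.\<close>

lemma normal_in_coset_kummer:
  fixes \<alpha> :: 'a
  assumes "\<exists>x. x ^ B = 1 \<and> normal_over_GF q n (\<alpha> * x)"
    and B: "B = b * M" "B = c * (q - 1) ^ 2" "b * u + c * v = B + 1"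
  shows "\<exists>x. x ^ M = 1 \<and> normal_over_GF q n (\<alpha> * x)"
proof -
  obtain x where x: "x ^ B = 1" "normal_over_GF q n (\<alpha> * x)" using assms(1) by blast
  define y where "y = x ^ (b * u)"
  define \<theta> where "\<theta> = x ^ (c * v)"
  have "y * \<theta> = x ^ (B + 1)" unfolding y_def \<theta>_def power_add[symmetric] B(3) ..
  hence xy: "x = y * \<theta>" using x(1) by simp
  have "y ^ M = (x ^ B) ^ u" unfolding y_def B(1) by (simp add: power_mult[symmetric] mult_ac)
  hence y: "y ^ M = 1" using x(1) by simp
  have "\<theta> ^ ((q - 1) ^ 2) = (x ^ B) ^ v" unfolding \<theta>_def B(2) by (simp add: power_mult[symmetric] mult_ac)
  hence t: "\<theta> ^ ((q - 1) ^ 2) = 1" using x(1) by simp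
  have "normal_over_GF q n (\<theta> * (\<alpha> * y))" using x(2) by (simp add: xy mult_ac)
  from normal_mult_kummer[OF this t] y show ?thesis by blast
qed

text \<open>Now \<open>L = 6\<close>, and the ratio is Phi_6(q). If 2 or 3 divides \<open>q\<close>,
  the total dimension falls to 3 or 4 and everything is sieved. For \<open>q = 11\<close> only two
  one-dimensional subspaces occur, and for \<open>q >= 13\<close> the union bound is cheap. Values 5
  and 7 have up to 4 and 6 one-dimensional subspaces and need the enlarged group.\<close>

lemma normal_in_coset_12:
  fixes \<alpha> :: 'a
  assumes n12: "n = 12" and a: "\<alpha> \<noteq> 0" and M: "M dvd q ^ 12 - 1" "real q ^ 6 * (real q ^ 2 - real q + 1) \<le> real M"
    and M5: "q = 5 \<Longrightarrow> M = 328146" and M7: "q = 7 \<Longrightarrow> M = 5058950"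
  shows "\<exists>x. x ^ M = 1 \<and> normal_over_GF q n (\<alpha> * x)"
proof -
  define X where "X = real q ^ 2 - real q + 1"
  have sq: "sqrt (real q) ^ n = real q ^ 6"
  proof -
    have "sqrt (real q) ^ (2 * 6) = (sqrt (real q) ^ 2) ^ 6" by (rule power_mult)
    thus ?thesis by (simp add: n12)
  qed
  have XM: "X * sqrt (real q) ^ n \<le> real M" using M(2) by (simp add: sq X_def mult.commute)
  have Md: "M dvd q ^ n - 1" using M(1) n12 by simp
  note concl = normal_of_good[OF _ _ Md XM a]
  have nn: "n = 1 * n" "1 dvd q ^ 0" by auto
  have np: "q \<noteq> 6" "q \<noteq> 10" "q \<noteq> 12"
    using q not_primepowI[of 2 3 6] not_primepowI[of 2 5 10] not_primepowI[of 2 3 12] by auto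
  consider "q = 2" | "q = 3" | "q = 4" | "q = 5" | "q = 7" | "q = 8" | "q = 9" | "q = 11" | "q \<ge> 13"
    using np q_gt_1 by (cases "q \<ge> 13") (force simp: not_le less_Suc_eq numeral_eq_Suc)+
  thus ?thesis
  proof cases
    case 1
    interpret dims q n 3 minimals fdim by (rule dims_minimals[of 4 _ 2]) (use 1 n12 in auto)
    \<comment> \<open>Here \<open>M >= 192\<close>, and \<open>125 / 2\<close> lies slightly above
      \<open>sqrt (4096 - 192)\<close>. In the next case \<open>M >= 5103\<close> and
      \<open>1451 / 2\<close> is chosen in the same way.\<close>
    show ?thesis by (rule normal_in_coset_all[OF Md a card_A_q2[OF 1], of "125 / 2"])
      (use M(2) 1 n12 in \<open>auto simp: power2_eq_square\<close>)
  next
    case 2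
    interpret dims q n 4 minimals fdim by (rule dims_minimals[of 3 _ 1]) (use 2 n12 in auto)
    show ?thesis by (rule normal_in_coset_all[OF Md a card_A_q3[OF 2], of "1451 / 2"])
      (use M(2) 2 n12 in \<open>auto simp: power2_eq_square\<close>)
  next
    case 3
    interpret dims q n 3 minimals fdim by (rule dims_minimals[of 4 _ 1]) (use 3 n12 in auto)
    have "good X" by (rule good_all[OF card_A_le]) (simp add: X_def 3)
    thus ?thesis by (rule concl[OF dims_axioms])
  next
    case 4
    interpret dims q n n minimals fdim by (rule dims_minimals[OF nn])
    \<comment> \<open>The enlarged subgroup has order \<open>2625168 = lcm M ((q - 1) ^ 2)\<close>, and similarly for \<open>q = 7\<close>.\<close>
    have "good 168"
      by (rule good_s1[of 4 12]) (use 4 n12 card_eq_div[of 1] in auto)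
    hence "\<exists>x. x ^ 2625168 = 1 \<and> normal_over_GF q n (\<alpha> * x)"
      by (rule normal_of_good[OF dims_axioms]) (use 4 n12 a sq in auto)
    thus ?thesis by (rule normal_in_coset_kummer[of _ _ 8 _ 164073 307637 1]) (use 4 M5 in auto)
  next
    case 5
    interpret dims q n n minimals fdim by (rule dims_minimals[OF nn])
    have "good 774"
      by (rule good_s1[of 6 12]) (use 5 n12 card_eq_div[of 1] in auto)
    hence "\<exists>x. x ^ 91061100 = 1 \<and> normal_over_GF q n (\<alpha> * x)"
      by (rule normal_of_good[OF dims_axioms]) (use 5 n12 a sq in auto)
    thus ?thesis by (rule normal_in_coset_kummer[of _ _ 18 _ 2529475 3232107 13]) (use 5 M7 in auto)
  next
    case 6
    interpret dims q n 3 minimals fdim by (rule dims_minimals[of 4 _ 1]) (use 6 n12 in auto)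
    have "good X" by (rule good_all[OF card_A_le]) (simp add: X_def 6)
    thus ?thesis by (rule concl[OF dims_axioms])
  next
    case 7
    interpret dims q n 4 minimals fdim by (rule dims_minimals[of 3 _ 1]) (use 7 n12 in auto)
    have "good X" by (rule good_all[OF card_A_le]) (simp add: X_def 7)
    thus ?thesis by (rule concl[OF dims_axioms])
  next
    case 8
    interpret dims q n n minimals fdim by (rule dims_minimals[OF nn])
    have "gcd 12 10 = (2 :: nat)" by (simp add: gcd_non_0_nat)
    hence "card {u \<in> minimals. fdim u = 1} \<le> 2" using card_eq_le_gcd[of 1] 8 n12 by simp
    hence "good X"
      by (rule good_s1[of 2 12]) (use 8 n12 in \<open>auto simp: X_def\<close>)
    thus ?thesis by (rule concl[OF dims_axioms])
  next
    case 9
    interpret dims q n n minimals fdim by (rule dims_minimals[OF nn])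
    have q13: "real q \<ge> 13" using 9 by simp
    have "real q * (real q - 1) \<ge> 13 * 12" using q13 by (intro mult_mono) auto
    hence X157: "X \<ge> 157" by (simp add: X_def power2_eq_square algebra_simps)
    have "2 / 13 \<le> 1 - 11 / real q" using q13 by (simp add: field_simps)
    hence "157 * (2 / 13) \<le> X * (1 - 11 / real q)" using X157 by (intro mult_mono) auto
    hence "24 \<le> X * (1 - 11 / real q)" by linarith
    hence "good X" using X157 9 by (intro good_singleton) (auto simp: n12)
    thus ?thesis by (rule concl[OF dims_axioms])
  qed
qed

text \<open>Small cases gain from the characteristic: when it divides \<open>n\<close>,
  \<open>dims_minimals\<close> lowers the total dimension to the quotient \<open>N\<close>, often
  enough to rescue a weak bound for \<open>M\<close>.\<close>

lemma normal_in_coset_modulus: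
  fixes \<alpha> :: 'a
  assumes mod: "modulus n L" and a: "\<alpha> \<noteq> 0"
  defines "M \<equiv> (q ^ n - 1) div norm_lcm q L (prime_factors L)"
  shows "\<exists>x. x ^ M = 1 \<and> normal_over_GF q n (\<alpha> * x)"
proof -
  interpret modulus n L by fact
  have q2: "q \<ge> 2" using q_gt_1 by simp
  have L0: "L > 0" using L_gt_1 by simp
  define I where "I = prime_factors L"
  have mmI: "norm_lcm q L I = Lcm ((\<lambda>p. q ^ (L div p) - 1) ` I)" using norm_lcm_def[OF q2] by simp
  have dI: "L div p dvd L \<and> L div p < L" if "p \<in> I" for p
  proof -
    have "prime p" "p dvd L" using that by (auto simp: I_def in_prime_factors_iff)
    thus ?thesis using L0 prime_gt_1_nat[of p] by (auto simp: div_dvd_iff_mult)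
  qed
  have bound: "real q ^ (n - L) * c \<le> real M" if "c \<ge> 0" "c \<le> (real q ^ L - 1) / real (norm_lcm q L (prime_factors L))" for c
    unfolding M_def I_def[symmetric] mmI
    using quotient_bound[OF q2 L0 L_dvd dI n that] by simp
  have "norm_lcm q L I dvd q ^ n - 1" unfolding I_def by (rule norm_lcm_dvd[OF q2 L0 L_dvd])
  hence "M * norm_lcm q L I = q ^ n - 1" unfolding M_def I_def[symmetric] by simp
  hence Md: "M dvd q ^ n - 1" by (metis dvd_triv_left)
  define cq where "cq = 1 - 1 / real q - 1 / (real q)\<^sup>2"
  have cq0: "cq \<ge> 0"
  proof -
    have "1 / real q \<le> 1 / 2" "1 / (real q)\<^sup>2 \<le> 1 / 2\<^sup>2"
      using q2 by (intro divide_left_mono power_mono; simp)+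
    thus ?thesis by (simp add: cq_def)
  qed
  have Mge: "real q ^ (n - L + totient L) * cq \<le> real M"
    using bound[OF _ norm_lcm_bound[OF q2 L0]] cq0 by (simp add: power_add mult.assoc cq_def)
  have n2L: "n \<ge> 2 * L" using n_cases by auto
  \<comment> \<open>Since \<open>nu + n = 2 * (n - L + totient L)\<close>, the main factor of the
    bound for \<open>M\<close> is \<open>sqrt q ^ (nu + n)\<close>; rounding loses at most a factor
    \<open>sqrt q\<close>.\<close>
  have XM: "real q ^ (nu div 2) * c * sqrt (real q) ^ n \<le> real M" if "0 \<le> c" "c \<le> cq" for c
  proof -
    have s1: "sqrt (real q) \<ge> 1" using q2 by simp
    have "real q ^ (nu div 2) = sqrt (real q) ^ (2 * (nu div 2))" by (simp add: power_mult)
    also have "\<dots> \<le> sqrt (real q) ^ nu" using s1 by (intro power_increasing) auto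
    finally have "real q ^ (nu div 2) * sqrt (real q) ^ n \<le> sqrt (real q) ^ nu * sqrt (real q) ^ n"
      by (intro mult_right_mono) auto
    also have "\<dots> = sqrt (real q) ^ (2 * (n - L + totient L))"
    proof -
      have "nu + n = 2 * (n - L + totient L)" unfolding nu_def using n2L by simp
      thus ?thesis by (simp only: power_add[symmetric])
    qed
    also have "\<dots> = real q ^ (n - L + totient L)" using power_mult[of "sqrt (real q)" 2 "n - L + totient L"] by simp
    finally have "c * (real q ^ (nu div 2) * sqrt (real q) ^ n) \<le> cq * real q ^ (n - L + totient L)"
      using that cq0 by (intro mult_mono) auto
    thus ?thesis using Mge by (simp add: mult_ac)
  qed
  have fin: ?thesis if "dims q n N minimals fdim" "dims.good q minimals fdim (real q ^ (nu div 2) * c)" "0 \<le> c" "c \<le> cq" for N c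
    by (rule normal_of_good[OF that(1,2) Md XM[OF that(3,4)] a])
  have cq5: "19 / 25 \<le> cq" if "q \<ge> 5"
  proof -
    have "1 / real q \<le> 1 / 5" "1 / (real q)\<^sup>2 \<le> 1 / 5\<^sup>2"
      using that by (intro divide_left_mono power_mono; simp)+
    thus ?thesis by (simp add: cq_def)
  qed
  have cq3: "5 / 9 \<le> cq" if "q \<ge> 3"
  proof -
    have "1 / real q \<le> 1 / 3" "1 / (real q)\<^sup>2 \<le> 1 / 3\<^sup>2"
      using that by (intro divide_left_mono power_mono; simp)+
    thus ?thesis by (simp add: cq_def)
  qed
  have L6: "real q ^ (n - 6) * (real q ^ 2 - real q + 1) \<le> real M" if "L = 6"
  proof -
    have "real q * (real q - 1) \<ge> 0" using q2 by simp
    hence "real q ^ 2 - real q + 1 \<ge> 0" by (simp add: power2_eq_square algebra_simps)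
    from bound[OF this] norm_lcm_6[OF q2] show ?thesis using that by simp
  qed
  show ?thesis
  proof (cases "n = 12")
    case True
    hence L: "L = 6" by (rule n_small(3))
    have p6: "prime_factors (6 :: nat) = {2, 3}"
    proof -
      have "prime_factors (6 :: nat) = prime_factors 2 \<union> prime_factors 3"
        using prime_factors_product[of "2 :: nat" 3] by simp
      thus ?thesis by (auto simp: prime_prime_factors)
    qed
    have "lcm 124 24 = (744 :: nat)" "lcm 342 48 = (2736 :: nat)" by (simp_all add: lcm_nat_def gcd_non_0_nat)
    hence "norm_lcm q L (prime_factors L) = 744" if "q = 5" unfolding norm_lcm_def[OF q2] L p6 using that by simp
    moreover have "norm_lcm q L (prime_factors L) = 2736" if "q = 7"
      unfolding norm_lcm_def[OF q2] L p6 using that \<open>lcm 342 48 = (2736 :: nat)\<close> by simp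
    ultimately have "q = 5 \<Longrightarrow> M = 328146" "q = 7 \<Longrightarrow> M = 5058950" by (simp_all add: M_def True)
    thus ?thesis using Md L6[OF L] True a by (intro normal_in_coset_12) auto
  next
    case False
    hence n13: "n \<ge> 13" using n_ge by simp
    have dn: "dims q n n minimals fdim" by (rule dims_minimals[of 1 _ 0]) auto
    interpret S: sieve_data q n L minimals fdim
      using dn modulus_axioms by (simp add: sieve_data_def)
    have kS: "nu div 2 = S.k" by (simp add: S.k_def)
    note finS = fin[OF dn, unfolded kS]
    have large: ?thesis if "q \<ge> 3" "n \<ge> q ^ 6"
    proof -
      have "q ^ 2 \<ge> 2" using q2 power_increasing[of 1 2 q] by simp
      moreover have "n \<ge> 1" using n by simp
      ultimately obtain s where s: "(q ^ 2) ^ s \<le> n" "n < (q ^ 2) ^ (s + 1)" using ex_power_ivl1[of "q ^ 2" n] by blast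
      have s3: "s \<ge> 3"
      proof (rule ccontr)
        assume "\<not> s \<ge> 3"
        hence "(q ^ 2) ^ (s + 1) \<le> (q ^ 2) ^ 3" using q2 by (intro power_increasing) auto
        also have "\<dots> = q ^ 6" by (simp flip: power_mult)
        finally show False using s(2) that(2) by linarith
      qed
      have "S.good (real q ^ S.k * (5 / 9))"
      proof (rule S.regime_large[OF that(1) s3])
        show "q ^ (2 * s) \<le> n" using s(1) by (simp only: power_mult)
        have "2 * s + 2 = 2 * (s + 1)" by simp
        thus "n < q ^ (2 * s + 2)" using s(2) by (simp only: power_mult)
      qed
      thus ?thesis by (rule finS) (use cq3[OF that(1)] in auto)
    qed
    consider "q = 2" | "q = 3" | "q = 4" | "q \<ge> 5" using q2 by linarith
    thus ?thesis
    proof cases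
      case 4
      have main: "S.good (real q ^ S.k * (19 / 25))" if "n < q ^ 6"
      proof -
        consider "q = 5 \<and> n = 24" | "\<not> (q = 5 \<and> n = 24)" "n \<le> 2 * q * (q - 1)" | "2 * q * (q - 1) < n" "n < q ^ 3" | "q ^ 3 \<le> n"
          by linarith
        thus ?thesis
        proof cases
          case 1
          \<comment> \<open>Partial sieving with \<open>j = 3\<close> would need 1000, but only 475
            is guaranteed; sieving all one-dimensional subspaces, at most four, is enough.\<close>
          have "(5 :: real) ^ 4 \<le> 5 ^ S.k" using S.k_table(1) 1 by (intro power_increasing) auto
          thus ?thesis using 1 S.card_eq_div[of 1] by (intro S.good_s1[of 4 24]) auto
        next
          case 2
          thus ?thesis using S.regime_partial[OF 4 n13] by simp
        next
          case 3
          thus ?thesis using S.regime_s1[OF 4] by simp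
        next
          case case4: 4
          thus ?thesis using S.regime_s2[OF 4] that by simp
        qed
      qed
      show ?thesis
      proof (cases "n < q ^ 6")
        case True
        show ?thesis by (rule finS[OF main[OF True]]) (use cq5[OF 4] in auto)
      next
        case False
        thus ?thesis using 4 by (intro large) auto
      qed
    next
      case 3
      have c4: "11 / 16 \<le> cq" using 3 by (simp add: cq_def power2_eq_square)
      consider "n \<ge> 4096" | "25 \<le> n" "n < 4096" | "n < 25" by linarith
      thus ?thesis
      proof cases
        case 1
        thus ?thesis using 3 by (intro large) auto
      next
        case 2
        have "S.good (real q ^ S.k * (11 / 16))" using S.regime_q4[OF 3 2] 3 by simp
        thus ?thesis by (rule finS) (use c4 in auto)
      next
        case case3: 3
        hence nn: "n \<in> {18, 20, 24}" using n_small(1) False by auto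
        have k4: "(4 :: real) ^ 4 \<le> 4 ^ (nu div 2)" using S.k_table(1) n13 by (intro power_increasing) (auto simp: kS)
        \<comment> \<open>The three values of \<open>n\<close> are even, so their total dimensions
          drop to 9, 5 and 3.\<close>
        have g: ?thesis if "dims q n N minimals fdim" "N \<le> 9" for N
        proof -
          interpret T: dims q n N minimals fdim by fact
          have "T.good (real q ^ (nu div 2) * (11 / 16))"
          proof (rule T.good_q4[OF 3, of "31 / 64"])
            have "real N \<le> 9" using that(2) by simp
            thus "7 / 16 + real N / 192 \<le> 31 / 64" by simp
            have "8 * (1 + real N / 2) \<le> 44" using \<open>real N \<le> 9\<close> by simp
            also have "\<dots> \<le> 4 ^ (nu div 2) * (11 / 16) * (1 - 31 / 64 :: real)" using k4 by simp
            finally show "8 * (1 + real N / 2) \<le> real q ^ (nu div 2) * (11 / 16) * (1 - 31 / 64)" using 3 by simp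
          qed (use that in auto)
          thus ?thesis by (rule fin[OF that(1)]) (use c4 in auto)
        qed
        from nn consider "n = 18" | "n = 20" | "n = 24" by auto
        thus ?thesis
        proof cases
          case 1
          thus ?thesis using 3 by (intro g[of 9] dims_minimals[of 2 _ 1]) auto
        next
          case 2
          thus ?thesis using 3 by (intro g[of 5] dims_minimals[of 4 _ 1]) auto
        next
          case case3: 3
          thus ?thesis using 3 by (intro g[of 3] dims_minimals[of 8 _ 2]) auto
        qed
      qed
    next
      case 2
      have c3: "5 / 9 \<le> cq" using cq3 2 by simp
      consider "n \<ge> 729" | "37 \<le> n" "n < 729" | "25 \<le> n" "n < 37" | "n < 25" by linarith
      thus ?thesis
      proof cases
        case 1
        thus ?thesis using 2 by (intro large) auto
      next
        case case2: 2
        have "S.good (real q ^ S.k * (5 / 9))" using S.regime_q3[OF 2 case2] 2 by simp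
        thus ?thesis by (rule finS) (use c3 in auto)
      next
        case 3
        have k6: "(3 :: real) ^ 6 \<le> 3 ^ (nu div 2)" using S.k_table(2) 3 by (intro power_increasing) (auto simp: kS)
        have g: ?thesis if "dims q n N minimals fdim" "N \<le> 28" for N
        proof -
          interpret T: dims q n N minimals fdim by fact
          have "405 \<le> real q ^ (nu div 2) * (5 / 9)" using k6 2 by simp
          with T.good_q3_a[OF 2 that(2)] have "T.good (real q ^ (nu div 2) * (5 / 9))" by (rule T.good_mono)
          thus ?thesis by (rule fin[OF that(1)]) (use c3 in auto)
        qed
        from n_small(2)[OF 3] consider "n = 28" | "n = 30" | "n = 36" by auto
        thus ?thesis
        proof cases
          case 1
          thus ?thesis using 2 by (intro g[of 28] dims_minimals[of 1 _ 1]) auto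
        next
          case case2: 2
          thus ?thesis using 2 by (intro g[of 10] dims_minimals[of 3 _ 1]) auto
        next
          case case3: 3
          thus ?thesis using 2 by (intro g[of 4] dims_minimals[of 9 _ 2]) auto
        qed
      next
        case 4
        have k4: "(3 :: real) ^ 4 \<le> 3 ^ (nu div 2)" using S.k_table(1) n13 by (intro power_increasing) (auto simp: kS)
        hence X45: "45 \<le> real q ^ (nu div 2) * (5 / 9)" using 2 by simp
        have g: ?thesis if "dims q n N minimals fdim" "N \<le> 8" for N
        proof -
          interpret T: dims q n N minimals fdim by fact
          have "T.good (real q ^ (nu div 2) * (5 / 9))" by (rule T.good_mono[OF T.good_q3_b[OF 2 that(2)] X45])
          thus ?thesis by (rule fin[OF that(1)]) (use c3 in auto)
        qed
        from n_small(1)[OF 4] False consider "n = 18" | "n = 20" | "n = 24" by auto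
        thus ?thesis
        proof cases
          case 1
          thus ?thesis using 2 by (intro g[of 2] dims_minimals[of 9 _ 2]) auto
        next
          case case2: 2
          have "S.good (real q ^ (nu div 2) * (5 / 9))"
            using case2 by (intro S.good_mono[OF S.good_q3_20[OF 2] X45]) auto
          thus ?thesis by (rule fin[OF dn]) (use c3 in auto)
        next
          case 3
          thus ?thesis using 2 by (intro g[of 8] dims_minimals[of 3 _ 1]) auto
        qed
      qed
    next
      case 1
      have c2: "1 / 4 \<le> cq" using 1 by (simp add: cq_def power2_eq_square)
      have g: ?thesis if N: "dims q n N minimals fdim" and X: "dims.good q minimals fdim X" "X \<le> 2 ^ (nu div 2) * (1 / 4)" for N X
      proof -
        interpret T: dims q n N minimals fdim by fact
        have "T.good (real q ^ (nu div 2) * (1 / 4))" using X(2) 1 by (intro T.good_mono[OF X(1)]) simp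
        thus ?thesis by (rule fin[OF N]) (use c2 in auto)
      qed
      consider "n \<ge> 1024" | "61 \<le> n" "n < 1024" | "37 \<le> n" "n < 61" "odd n" | "37 \<le> n" "n < 61" "even n" | "25 \<le> n" "n < 37" | "n < 25" by linarith
      thus ?thesis
      proof cases
        case case1: 1
        obtain s where s: "(4 :: nat) ^ s \<le> n" "n < 4 ^ (s + 1)" using ex_power_ivl1[of 4 n] n by auto
        have s5: "s \<ge> 5"
        proof (rule ccontr)
          assume "\<not> s \<ge> 5"
          hence "(4 :: nat) ^ (s + 1) \<le> 4 ^ 5" by (intro power_increasing) auto
          thus False using s(2) case1 by simp
        qed
        have e: "(4 :: nat) ^ j = 2 ^ (2 * j)" for j by (simp add: power_mult)
        have "S.good (2 ^ S.k * (1 / 4))"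
          using s s5 unfolding e by (intro S.regime_large_2[OF 1, of s]) auto
        thus ?thesis by (rule g[OF dn]) (simp add: kS)
      next
        case 2
        show ?thesis by (rule g[OF dn S.regime_q2[OF 1 2]]) (simp add: kS)
      next
        case 3
        show ?thesis by (rule g[OF dn S.regime_q2_odd[OF 1 3]]) (simp add: kS)
      next
        case 4
        \<comment> \<open>Even \<open>n\<close> halves the total dimension. If
          \<open>nu < 18\<close>, only \<open>n = 40, 48, 60\<close> remain, where higher powers of
          2 reduce it to at most 15.\<close>
        define N where "N = n div 2"
        have nN: "n = 2 * N" using 4 by (simp add: N_def)
        have dN: "dims q n N minimals fdim" by (rule dims_minimals[of 2 _ 1]) (use nN 1 in auto)
        interpret T: dims q n N minimals fdim by fact
        show ?thesis
        proof (cases "nu \<ge> 18")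
          case True
          hence "(2 :: real) ^ 9 \<le> 2 ^ (nu div 2)" by (intro power_increasing) auto
          thus ?thesis using T.good_q2_30[OF 1] nN 4 by (intro g[OF dN, of 128]) auto
        next
          case False
          have "n \<noteq> 38" using n_small(5) by auto
          hence n40: "n \<ge> 40" using 4 by presburger
          have nL: "n = 2 * L"
          proof (rule ccontr)
            assume "n \<noteq> 2 * L"
            from nu_ge3[OF this] totient_L n40 False show False by linarith
          qed
          have "totient L \<le> 8" using False nL unfolding nu_def by simp
          moreover have "L \<in> set [19..<31]" using nL 4 unfolding set_upt atLeastLessThan_iff by linarith
          ultimately have "L \<in> {20, 24, 30}" using totient_table_30(1) by fastforce
          hence nn: "n = 40 \<or> n = 48 \<or> n = 60" using nL by auto
          have "nu \<ge> 16" using nu_table(3) 4 by simp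
          hence "(2 :: real) ^ 8 \<le> 2 ^ (nu div 2)" by (intro power_increasing) auto
          hence X: "64 \<le> (2 :: real) ^ (nu div 2) * (1 / 4)" by simp
          have h: ?thesis if d: "dims q n K minimals fdim" "K \<le> 15" for K
          proof -
            interpret U: dims q n K minimals fdim by fact
            show ?thesis by (rule g[OF d(1) U.good_q2_15[OF 1 d(2)] X])
          qed
          from nn show ?thesis
          proof (elim disjE)
            assume "n = 40"
            thus ?thesis using 1 by (intro h[of 5] dims_minimals[of 8 _ 3]) auto
          next
            assume "n = 48"
            thus ?thesis using 1 by (intro h[of 3] dims_minimals[of 16 _ 4]) auto
          next
            assume "n = 60"
            thus ?thesis using 1 by (intro h[of 15] dims_minimals[of 4 _ 2]) auto
          qed
        qed
      next
        case 5
        have k6: "(2 :: real) ^ 6 \<le> 2 ^ (nu div 2)" using S.k_table(2) 5 by (intro power_increasing) (auto simp: kS)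
        hence X: "16 \<le> (2 :: real) ^ (nu div 2) * (1 / 4)" by simp
        have h: ?thesis if d: "dims q n K minimals fdim" "K \<le> 9" for K
        proof -
          interpret U: dims q n K minimals fdim by fact
          show ?thesis by (rule g[OF d(1) U.good_q2_9[OF 1 d(2)] X])
        qed
        from n_small(2)[OF 5] consider "n = 28" | "n = 30" | "n = 36" by auto
        thus ?thesis
        proof cases
          case case1: 1
          thus ?thesis using 1 by (intro h[of 7] dims_minimals[of 4 _ 2]) auto
        next
          case 2
          \<comment> \<open>Total dimension 15 calls for 64 instead of 16; each possible
            \<open>L\<close>, that is 6, 10 or 15, yields \<open>nu >= 16\<close>.\<close>
          have d15: "dims q n 15 minimals fdim" by (rule dims_minimals[of 2 _ 1]) (use 1 2 in auto)
          interpret U: dims q n 15 minimals fdim by fact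
          have "L \<in> {6, 10, 12, 14, 15, 18}" using primepow_small(2)[OF L_gt_1 L_npp] n2L 2 by simp
          moreover have "L dvd 30" using L_dvd 2 by simp
          ultimately have "L = 6 \<or> L = 10 \<or> L = 15" by auto
          hence "nu \<ge> 16" unfolding nu_def using 2 totient_table_30(2,3) by auto
          hence "(2 :: real) ^ 8 \<le> 2 ^ (nu div 2)" by (intro power_increasing) auto
          thus ?thesis using U.good_q2_15[OF 1] by (intro g[OF d15, of 64]) auto
        next
          case 3
          thus ?thesis using 1 by (intro h[of 9] dims_minimals[of 4 _ 2]) auto
        qed
      next
        case 6
        have k4: "(2 :: real) ^ 4 \<le> 2 ^ (nu div 2)" using S.k_table(1) n13 by (intro power_increasing) (auto simp: kS)
        hence X: "4 \<le> (2 :: real) ^ (nu div 2) * (1 / 4)" by simp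
        from n_small(1)[OF 6] False consider "n = 18" | "n = 20" | "n = 24" by auto
        thus ?thesis
        proof cases
          case case1: 1
          have d9: "dims q n 9 minimals fdim" by (rule dims_minimals[of 2 _ 1]) (use 1 case1 in auto)
          interpret U: dims q n 9 minimals fdim by fact
          have "sqrt (real q) ^ (2 * 9) = (sqrt (real q) ^ 2) ^ 9" by (rule power_mult)
          hence sq: "sqrt (real q) ^ n = 512" using 1 case1 by simp
          \<comment> \<open>\<open>L = 6\<close> is forced, and the exact value Phi_6(2) = 3 gives
            the ratio 24, where the general constant 1/4 would give 8 and 16 is required.\<close>
          have "real q ^ (18 - 6) * (real q ^ 2 - real q + 1) \<le> real M" using L6[OF n_small(4)[OF case1]] case1 by simp
          hence "24 * sqrt (real q) ^ n \<le> real M" unfolding sq using 1 by simp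
          moreover have "U.good 24" by (rule U.good_mono[OF U.good_q2_9[OF 1]]) auto
          ultimately show ?thesis by (intro normal_of_good[OF d9 _ Md _ a])
        next
          case 2
          have d5: "dims q n 5 minimals fdim" by (rule dims_minimals[of 4 _ 2]) (use 1 2 in auto)
          interpret U: dims q n 5 minimals fdim by fact
          show ?thesis using U.good_q2_20[OF 1 2] X by (intro g[OF d5, of 4]) auto
        next
          case 3
          have d3: "dims q n 3 minimals fdim" by (rule dims_minimals[of 8 _ 3]) (use 1 3 in auto)
          interpret U: dims q n 3 minimals fdim by fact
          have "U.good 4" by (rule U.good_all[OF U.card_A_q2[OF 1]]) auto
          thus ?thesis using X by (intro g[OF d3, of 4])
        qed
      qed
    qed
  qed
qed

end

theorem theorem3:
  fixes q n k :: nat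
    and d :: "nat \<Rightarrow> nat"
    and a :: "nat \<Rightarrow> 'a :: finite_field"
  assumes q: "primepow q"
    and card: "CARD('a) = q ^ n"
    and n: "n > 1" "\<not> primepow n"
    and k: "1 < k" "k < card {e. e dvd n}"
    and d_dvd: "\<forall>i\<in>{1..k}. d i dvd n \<and> d i < n"
    and d_less: "\<forall>i\<in>{1..k}. \<forall>j\<in>{1..k}. i < j \<longrightarrow> d i < d j"
    and d_ndvd: "\<forall>i\<in>{1..k}. \<forall>j\<in>{1..k}. i \<noteq> j \<longrightarrow> \<not> d i dvd d j"
    and a: "\<forall>i\<in>{1..k}. a i \<in> GF q (d i) - {0}"
    and a_norm: "\<forall>i\<in>{1..k}. \<forall>j\<in>{1..k}. i < j \<longrightarrow>
                   norm_GF q (d i) (gcd (d i) (d j)) (a i) =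
                   norm_GF q (d j) (gcd (d i) (d j)) (a j)"
    and lcm: "(LCM i\<in>{1..k}. d i) < n"
  shows "\<exists>\<alpha>::'a. \<alpha> \<noteq> 0 \<and> normal_over_GF q n \<alpha> \<and> (\<forall>i\<in>{1..k}. norm_GF q n (d i) \<alpha> = a i)"
proof -
  have fe: "field_ext TYPE('a) q n" using q card n by unfold_locales auto
  interpret F: field_ext q n "TYPE('a)" by (rule fe)
  from F.ex_additive_character obtain \<psi> :: "'a \<Rightarrow> complex" where
    psi: "(\<forall>x y. \<psi> (x + y) = \<psi> x * \<psi> y) \<and> (\<forall>x. cmod (\<psi> x) = 1) \<and> (\<exists>x. \<psi> x \<noteq> 1) \<and> (\<forall>x. \<psi> (x ^ q) = \<psi> x)"
    by (rule exE)
  interpret C: field_ext_char q n "TYPE('a)" \<psi> by unfold_locales (use psi in auto)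
  define L where "L = (LCM i\<in>{1..k}. d i)"
  have dL: "d i dvd L" if "i \<in> {1..k}" for i unfolding L_def using that by simp
  \<comment> \<open>If some \<open>d i\<close> were the lcm, any other \<open>d j\<close> would
    divide it; \<open>1 < k\<close> provides such a \<open>j\<close>.\<close>
  have dL': "d i \<noteq> L" if i: "i \<in> {1..k}" for i
  proof
    assume "d i = L"
    define j where "j = (if i = 1 then 2 else 1 :: nat)"
    have j: "j \<in> {1..k}" "j \<noteq> i" using k by (auto simp: j_def)
    hence "d j dvd d i" using dL[OF j(1)] \<open>d i = L\<close> by simp
    thus False using d_ndvd j i by blast
  qed
  have Ln: "L dvd n" unfolding L_def using d_dvd by (intro Lcm_least) auto
  have L0: "L > 0" using Ln n(1) by (intro Nat.gr0I) auto
  have dlt: "d i < L" if "i \<in> {1..k}" for i using dvd_imp_le[OF dL[OF that] L0] dL'[OF that] by simp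
  have i12: "1 \<in> {1..k}" "2 \<in> {1..k}" using k by auto
  have nd: "\<not> d 1 dvd d 2" "\<not> d 2 dvd d 1" using d_ndvd i12 by auto
  have "L \<noteq> 1" using dL[OF i12(1)] dL[OF i12(2)] nd by auto
  \<comment> \<open>The divisors of a prime power form a chain, against the incomparability of
    \<open>d 1\<close> and \<open>d 2\<close>.\<close>
  moreover have "\<not> primepow L"
  proof
    assume "primepow L"
    then obtain p e where p: "prime p" "L = p ^ e" by (auto simp: primepow_def)
    obtain e1 e2 where "d 1 = p ^ e1" "d 2 = p ^ e2"
      using dL[OF i12(1)] dL[OF i12(2)] divides_primepow_nat[OF p(1)] p(2) by metis
    thus False using nd le_imp_power_dvd[of e1 e2 p] le_imp_power_dvd[of e2 e1 p] by (cases "e1 \<le> e2") auto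
  qed
  ultimately have mod: "modulus n L" using Ln lcm L0 unfolding L_def[symmetric] by unfold_locales auto
  have q2: "q \<ge> 2" using F.q_gt_1 by simp
  have compat: "norm_GF q (d i) (gcd (d i) (d j)) (a i) = norm_GF q (d j) (gcd (d i) (d j)) (a j)"
    if "i \<in> {1..k}" "j \<in> {1..k}" for i j
  proof -
    consider "i < j" | "i = j" | "j < i" by linarith
    thus ?thesis
    proof cases
      case 1
      thus ?thesis using a_norm that by blast
    next
      case 3
      hence "norm_GF q (d j) (gcd (d j) (d i)) (a j) = norm_GF q (d i) (gcd (d j) (d i)) (a i)" using a_norm that by blast
      thus ?thesis by (simp add: gcd.commute)
    qed auto
  qed
  obtain \<beta> :: 'a where b: "\<beta> \<noteq> 0" "\<forall>i\<in>{1..k}. norm_GF q n (d i) \<beta> = a i"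
    using F.ex_common_norm_preimage[of "{1..k}" d a, OF _ _ _ compat] d_dvd a by auto
  define m where "m = norm_lcm q L (prime_factors L)"
  define M where "M = (q ^ n - 1) div m"
  obtain x :: 'a where x: "x ^ M = 1" "normal_over_GF q n (\<beta> * x)"
    using C.normal_in_coset_modulus[OF mod b(1)] unfolding M_def m_def by blast
  have mM: "m * M = q ^ n - 1" unfolding M_def m_def using norm_lcm_dvd[OF q2 L0 Ln] by simp
  have M0: "M > 0" using mM F.qn_gt_1 by (intro Nat.gr0I) auto
  have x0: "x \<noteq> 0" using x(1) M0 by (auto simp: power_0_left)
  have "norm_GF q n (d i) (\<beta> * x) = a i" if i: "i \<in> {1..k}" for i
  proof -
    \<comment> \<open>Consequently the exponent of each norm is a multiple of \<open>M\<close>, and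
      solutions of \<open>x ^ M = 1\<close> have norm 1.\<close>
    have "q ^ d i - 1 dvd m"
      using Lcm_dvd_norm_lcm[OF q2 L0, of "{i}" d] dL[OF i] dlt[OF i] by (simp add: m_def)
    then obtain c where c: "m = (q ^ d i - 1) * c" by (elim dvdE)
    have "(q ^ n - 1) div (q ^ d i - 1) = M * c"
    proof -
      have "d i dvd n" using d_dvd i by blast
      hence "d i > 0" using n(1) by (intro Nat.gr0I) auto
      hence q1: "q ^ d i - 1 \<noteq> 0" using one_less_power[OF F.q_gt_1, of "d i"] by simp
      have "q ^ n - 1 = (q ^ d i - 1) * (M * c)" using mM c by (simp add: mult_ac)
      thus ?thesis using q1 by (metis nonzero_mult_div_cancel_left)
    qed
    hence "norm_GF q n (d i) x = 1" by (simp add: norm_GF_def power_mult x(1))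
    thus ?thesis using b(2) i by (simp add: norm_GF_def power_mult_distrib)
  qed
  thus ?thesis using x b(1) x0 by (intro exI[of _ "\<beta> * x"]) auto
qed

end
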